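(* Let $\mathcal U^+=U_q^+(\mathfrak{sl}_{n+1})$ if $q$ is not a root of $1$, respectively $\mathcal U^+=u_q^+(\mathfrak{sl}_{n+1})$ if $q$ has finite multiplicative order $t>2$. Let $\theta=(\theta_1,\dots,\theta_n)$ be an integer sequence with $0\le\theta_k\le n-k+1$. The following conditions on $U=\mathbf U^1_\theta\subseteq\mathcal U^+$ are equivalent: i. $U$ is $\mathrm{ad}_r$-invariant. ii. The sets $T_k$, $1\le k\le n$, associated with $\theta$ have the form $T_k=[j(k),n]$, where $j(k)=\min\{j\mid k\le j,\ j\in T_j\}$ (with $T_k=\emptyset$ if there is no such $j$). iii. $U=K(\pi)$ for a suitable $\pi\subseteq[1,n]$.
   Context: Let $\mathbf k$ be a field, $n\ge 1$, and $q\in\mathbf k$, $q\ne 0,\pm1$. Let $G$ be a commutative group, $g_1,\dots,g_n\in G$, and let $\chi^1,\dots,\chi^n:G\to\mathbf k^*$ be characters such that $p_{ij}:=\chi^i(g_j)$ satisfy $p_{ii}=q$, $p_{i\,i+1}p_{i+1\,i}=q^{-1}$, and $p_{ij}p_{ji}=1$ for $|i-j|>1$. Let $X=\{x_1,\dots,x_n\}$ and let $G\langle X\rangle$ be the skew group algebra generated by $\mathbf k[G]$ and the free algebra $\mathbf k\langle X\rangle$ with $g^{-1}x_ig=\chi^i(g)x_i$; it is a Hopf algebra with $\Delta(x_i)=x_i\otimes1+g_i\otimes x_i$, $\Delta(g)=g\otimes g$. For a word $u$ in $X$ let $g_u$ and $\chi^u$ be obtained from $u$ by replacing each $x_i$ by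 $g_i$, resp. $\chi^i$; put $[u,v]=uv-\chi^u(g_v)vu$, extended bilinearly to polynomials homogeneous in each variable. $U_q^+(\mathfrak{sl}_{n+1})$ is the quotient Hopf algebra of $G\langle X\rangle$ by the relations $[[x_i,x_{i+1}],x_{i+1}]=[x_i,[x_i,x_{i+1}]]=0$ and $[x_i,x_j]=0$ for $|i-j|>1$. If $q$ has finite multiplicative order $t>2$, then $u_q^+(\mathfrak{sl}_{n+1})=G\langle X\rangle/\mathbf\Lambda$, where $\mathbf\Lambda$ is the biggest Hopf ideal contained in the ideal generated by all $x_ix_j$. Put $u[k,k]=x_k$, $u[k,m]=[x_k,u[k+1,m]]$. For a set $S$ of integers with $S\cap[k,m-1]=\{s_1<\dots<s_r\}$ put $$\Psi^S(k,m)=[[\ldots[u[1+s_r,m],u[1+s_{r-1},s_r]],\ldots,u[1+s_1,s_2]],u[k,s_1]]$$ ($=u[k,m]$ if $r=0$). For $\theta$ define subsets $R_k,T_k\subseteq[k,n]$ by downward induction on $k$. If $\theta_k=0$, put $R_k=T_k=\emptyset$; if $\theta_n=1$, put $R_n=T_n=\{n\}$. If $\theta_k\ne0$ and $R_i,T_i$ are defined for $i>k$, then $R_k$ consists of $\tilde\theta_k=k+\theta_k-1$ and of all $m$ such that: (a) $k\le m<\tilde\theta_k$; (b) $\tilde\theta_k\notin T_{m+1}$; (c) for all $r$ with $k\le r<m$: $m\in T_{r+1}\Leftrightarrow\tilde\theta_k\in T_{r+1}$. Then $T_k=R_k\cup\bigcup_{s\in R_k\setminus\{n\}}T_{s+1}$.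 $\mathbf U^1_\theta$ is the subalgebra with $1$ generated by the elements $(g_kg_{k+1}\cdots g_m)^{-1}\Psi^{T_k}(k,m)$, where $1\le k\le m\le n$ and $m\in T_k$. The right adjoint action of a Hopf algebra with antipode $\sigma$ on itself is $(\mathrm{ad}_r a)b=\sum\sigma(a^{(1)})\,b\,a^{(2)}$; in $\mathcal U^+$ this gives $(\mathrm{ad}_r g)b=g^{-1}bg$ for $g\in G$ and $(\mathrm{ad}_r x_i)b=g_i^{-1}(bx_i-x_ib)$. A subspace is $\mathrm{ad}_r$-invariant if it is stable under $\mathrm{ad}_r a$ for all $a\in\mathcal U^+$. For $\pi\subseteq[1,n]$, $K(\pi)$ is the (unital) subalgebra of $\mathcal U^+$ generated by all elements $\mathrm{ad}_r(x_{i_1}x_{i_2}\cdots x_{i_l})(g_j^{-1}x_j)$ with $l\ge0$, $j\in\pi$, and $i_1,\dots,i_l\notin\pi$. *)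

theory Defs
  imports
    Complex_Main
    "HOL-Library.Poly_Mapping"
    "HOL-Algebra.QuotRing"
    "HOL-Algebra.Generated_Rings"
begin

section \<open>Vector spaces with a given basis\<close>

text \<open>The vector space over \<open>'k\<close> with basis (contained in) the type \<open>'b\<close> is \<open>'b \<Rightarrow>\<^sub>0 'k\<close>.\<close>

definition scale_pm :: "'k::field \<Rightarrow> ('b \<Rightarrow>\<^sub>0 'k) \<Rightarrow> ('b \<Rightarrow>\<^sub>0 'k)" where
  "scale_pm c f = Poly_Mapping.map ((*) c) f"

definition lin_ext :: "('b \<Rightarrow> ('c \<Rightarrow>\<^sub>0 'k)) \<Rightarrow> ('b \<Rightarrow>\<^sub>0 'k::field) \<Rightarrow> ('c \<Rightarrow>\<^sub>0 'k)" where
  "lin_ext \<phi> f = (\<Sum>b\<in>Poly_Mapping.keys f. scale_pm (Poly_Mapping.lookup f b) (\<phi> b))"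

text \<open>The tensor product of two such spaces has the pairs of basis elements as its basis.\<close>

definition tensor :: "('b \<Rightarrow>\<^sub>0 'k::field) \<Rightarrow> ('c \<Rightarrow>\<^sub>0 'k) \<Rightarrow> ('b \<times> 'c \<Rightarrow>\<^sub>0 'k)" where
  "tensor f h = lin_ext (\<lambda>b. lin_ext (\<lambda>c. Poly_Mapping.single (b, c) 1) h) f"

text \<open>The algebra with basis \<open>B\<close>, unit \<open>e\<close> and multiplication \<open>b b' = c b b' \<cdot> (b \<diamondop> b')\<close>
  for \<open>b, b' \<in> B\<close>, where \<open>c b b'\<close> is a scalar.\<close>

definition twisted_algebra ::
  "'b set \<Rightarrow> ('b \<Rightarrow> 'b \<Rightarrow> 'b) \<Rightarrow> ('b \<Rightarrow> 'b \<Rightarrow> 'k::field) \<Rightarrow> 'b \<Rightarrow> ('b \<Rightarrow>\<^sub>0 'k) ring" where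
  "twisted_algebra B m c e =
    \<lparr>carrier = {f. Poly_Mapping.keys f \<subseteq> B},
     monoid.mult = (\<lambda>f h. lin_ext (\<lambda>b. lin_ext (\<lambda>b'. Poly_Mapping.single (m b b') (c b b')) h) f),
     one = Poly_Mapping.single e 1,
     zero = 0,
     add = (+)\<rparr>"


section \<open>Characters\<close>

definition character :: "('g, 'm) monoid_scheme \<Rightarrow> ('g \<Rightarrow> 'k::field) \<Rightarrow> bool" where
  "character G \<psi> \<longleftrightarrow> (\<forall>a\<in>carrier G. \<psi> a \<noteq> 0) \<and>
     (\<forall>a\<in>carrier G. \<forall>b\<in>carrier G. \<psi> (a \<otimes>\<^bsub>G\<^esub> b) = \<psi> a * \<psi> b)"


section \<open>The Hopf algebra \<open>G\<langle>X\<rangle>\<close>, its quotients and subalgebras\<close>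

text \<open>The locale only fixes the parameters; all hypotheses on them are stated in the theorem.
  A word in \<open>X = {x\<^sub>1, \<dots>, x\<^sub>n}\<close> is a list of indices in \<open>{1..n}\<close>.\<close>

locale skew_hopf =
  fixes n :: nat
    and G :: "('g, 'm) monoid_scheme" (structure)
    and g :: "nat \<Rightarrow> 'g"
    and \<chi> :: "nat \<Rightarrow> 'g \<Rightarrow> 'k::field"
begin

definition g_word :: "nat list \<Rightarrow> 'g" where
  "g_word u = foldr (\<lambda>i h. g i \<otimes> h) u \<one>"

definition chi_word :: "nat list \<Rightarrow> 'g \<Rightarrow> 'k" where
  "chi_word u h = (\<Prod>i\<leftarrow>u. \<chi> i h)"

text \<open>The pair \<open>(a, u)\<close> stands for the basis element \<open>a u\<close> of \<open>G\<langle>X\<rangle>\<close>, with the group element on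
  the left. The relation \<open>b\<^sup>-\<^sup>1 x\<^sub>i b = \<chi>\<^sup>i(b) x\<^sub>i\<close> gives \<open>u b = \<chi>\<^sup>u(b) b u\<close>, and hence
  \<open>(a u) (b v) = \<chi>\<^sup>u(b) (a b) (u v)\<close>.\<close>

definition skew_basis :: "('g \<times> nat list) set" where
  "skew_basis = carrier G \<times> lists {1..n}"

definition basis_mult :: "'g \<times> nat list \<Rightarrow> 'g \<times> nat list \<Rightarrow> 'g \<times> nat list" where
  "basis_mult b b' = (fst b \<otimes> fst b', snd b @ snd b')"

definition basis_coeff :: "'g \<times> nat list \<Rightarrow> 'g \<times> nat list \<Rightarrow> 'k" where
  "basis_coeff b b' = chi_word (snd b) (fst b')"

definition skew_algebra :: "('g \<times> nat list \<Rightarrow>\<^sub>0 'k) ring" where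
  "skew_algebra = twisted_algebra skew_basis basis_mult basis_coeff (\<one>, [])"

definition scalar :: "'k \<Rightarrow> ('g \<times> nat list \<Rightarrow>\<^sub>0 'k)" where
  "scalar c = Poly_Mapping.single (\<one>, []) c"

definition grp :: "'g \<Rightarrow> ('g \<times> nat list \<Rightarrow>\<^sub>0 'k)" where
  "grp a = Poly_Mapping.single (a, []) 1"

definition word :: "nat list \<Rightarrow> ('g \<times> nat list \<Rightarrow>\<^sub>0 'k)" where
  "word u = Poly_Mapping.single (\<one>, u) 1"

abbreviation var :: "nat \<Rightarrow> ('g \<times> nat list \<Rightarrow>\<^sub>0 'k)" where
  "var i \<equiv> word [i]"

text \<open>The algebra \<open>G\<langle>X\<rangle> \<otimes> G\<langle>X\<rangle>\<close>, with \<open>(a \<otimes> b) (a' \<otimes> b') = a a' \<otimes> b b'\<close>.\<close>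

definition tensor_algebra :: "(('g \<times> nat list) \<times> ('g \<times> nat list) \<Rightarrow>\<^sub>0 'k) ring" where
  "tensor_algebra = twisted_algebra (skew_basis \<times> skew_basis)
     (\<lambda>p p'. (basis_mult (fst p) (fst p'), basis_mult (snd p) (snd p')))
     (\<lambda>p p'. basis_coeff (fst p) (fst p') * basis_coeff (snd p) (snd p'))
     ((\<one>, []), (\<one>, []))"

text \<open>\<open>\<Delta>\<close> is the algebra homomorphism, and \<open>\<sigma>\<close> the algebra antihomomorphism, with the following
  values on generators: \<open>\<Delta>(a) = a \<otimes> a\<close>, \<open>\<Delta>(x\<^sub>i) = x\<^sub>i \<otimes> 1 + g\<^sub>i \<otimes> x\<^sub>i\<close>, \<open>\<sigma>(a) = a\<^sup>-\<^sup>1\<close>,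
  \<open>\<sigma>(x\<^sub>i) = - g\<^sub>i\<^sup>-\<^sup>1 x\<^sub>i\<close>. The counit has \<open>\<epsilon>(a) = 1\<close>, \<open>\<epsilon>(x\<^sub>i) = 0\<close>.\<close>

definition comult :: "('g \<times> nat list \<Rightarrow>\<^sub>0 'k) \<Rightarrow> (('g \<times> nat list) \<times> ('g \<times> nat list) \<Rightarrow>\<^sub>0 'k)" where
  "comult = lin_ext (\<lambda>(a, u). foldl
     (\<lambda>t i. t \<otimes>\<^bsub>tensor_algebra\<^esub> (tensor (var i) (scalar 1) + tensor (grp (g i)) (var i)))
     (tensor (grp a) (grp a)) u)"

definition counit :: "('g \<times> nat list \<Rightarrow>\<^sub>0 'k) \<Rightarrow> 'k" where
  "counit f = (\<Sum>(a, u)\<in>Poly_Mapping.keys f. if u = [] then Poly_Mapping.lookup f (a, u) else 0)"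

definition antipode :: "('g \<times> nat list \<Rightarrow>\<^sub>0 'k) \<Rightarrow> ('g \<times> nat list \<Rightarrow>\<^sub>0 'k)" where
  "antipode = lin_ext (\<lambda>(a, u). foldr
     (\<lambda>i t. (- (grp (inv (g i)) \<otimes>\<^bsub>skew_algebra\<^esub> var i)) \<otimes>\<^bsub>skew_algebra\<^esub> t)
     (rev u) (grp (inv a)))"

definition hopf_ideal :: "('g \<times> nat list \<Rightarrow>\<^sub>0 'k) set \<Rightarrow> bool" where
  "hopf_ideal I \<longleftrightarrow> ideal I skew_algebra \<and>
     (\<forall>f\<in>I. comult f \<in> module.span scale_pm
        {tensor a b | a b. a \<in> carrier skew_algebra \<and> b \<in> carrier skew_algebra \<and> (a \<in> I \<or> b \<in> I)}) \<and>
     (\<forall>f\<in>I. counit f = 0) \<and>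
     (\<forall>f\<in>I. antipode f \<in> I)"

text \<open>The bracket \<open>[u, v] = u v - \<chi>\<^sup>u(g\<^sub>v) v u\<close>, bilinear in the words. It is meant for elements of
  the free algebra, i.e. with all group components equal to \<open>1\<close>.\<close>

definition bracket ::
  "('g \<times> nat list \<Rightarrow>\<^sub>0 'k) \<Rightarrow> ('g \<times> nat list \<Rightarrow>\<^sub>0 'k) \<Rightarrow> ('g \<times> nat list \<Rightarrow>\<^sub>0 'k)" where
  "bracket f h = lin_ext (\<lambda>b. lin_ext (\<lambda>b'.
       Poly_Mapping.single b 1 \<otimes>\<^bsub>skew_algebra\<^esub> Poly_Mapping.single b' 1
       - scale_pm (chi_word (snd b) (g_word (snd b')))
           (Poly_Mapping.single b' 1 \<otimes>\<^bsub>skew_algebra\<^esub> Poly_Mapping.single b 1)) h) f"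

text \<open>The ideals defining \<open>U\<^sub>q\<^sup>+(sl\<^sub>n\<^sub>+\<^sub>1)\<close> and \<open>u\<^sub>q\<^sup>+(sl\<^sub>n\<^sub>+\<^sub>1)\<close>.\<close>

definition serre_ideal :: "('g \<times> nat list \<Rightarrow>\<^sub>0 'k) set" where
  "serre_ideal = genideal skew_algebra
     ({bracket (bracket (var i) (var (i + 1))) (var (i + 1)) | i. 1 \<le> i \<and> i < n} \<union>
      {bracket (var i) (bracket (var i) (var (i + 1))) | i. 1 \<le> i \<and> i < n} \<union>
      {bracket (var i) (var j) | i j. i \<in> {1..n} \<and> j \<in> {1..n} \<and> \<bar>int i - int j\<bar> > 1})"

definition Lambda_ideal :: "('g \<times> nat list \<Rightarrow>\<^sub>0 'k) set" where
  "Lambda_ideal = (GREATEST I. hopf_ideal I \<and>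
     I \<subseteq> genideal skew_algebra {var i \<otimes>\<^bsub>skew_algebra\<^esub> var j | i j. i \<in> {1..n} \<and> j \<in> {1..n}})"

text \<open>Below \<open>I\<close> is a Hopf ideal and the ambient Hopf algebra is \<open>G\<langle>X\<rangle> / I\<close>.\<close>

definition quotient :: "('g \<times> nat list \<Rightarrow>\<^sub>0 'k) set \<Rightarrow> ('g \<times> nat list \<Rightarrow>\<^sub>0 'k) set ring" where
  "quotient I = skew_algebra Quot I"

definition proj :: "('g \<times> nat list \<Rightarrow>\<^sub>0 'k) set \<Rightarrow> ('g \<times> nat list \<Rightarrow>\<^sub>0 'k) \<Rightarrow> ('g \<times> nat list \<Rightarrow>\<^sub>0 'k) set"
  where "proj I f = I +>\<^bsub>skew_algebra\<^esub> f"

definition subalgebra_gen ::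
  "('g \<times> nat list \<Rightarrow>\<^sub>0 'k) set \<Rightarrow> ('g \<times> nat list \<Rightarrow>\<^sub>0 'k) set set \<Rightarrow> ('g \<times> nat list \<Rightarrow>\<^sub>0 'k) set set" where
  "subalgebra_gen I S = generate_ring (quotient I) (range (\<lambda>c. proj I (scalar c)) \<union> S)"

text \<open>\<open>(ad\<^sub>r a) b = \<Sum> \<sigma>(a\<^sup>(\<^sup>1\<^sup>)) b a\<^sup>(\<^sup>2\<^sup>)\<close> in \<open>G\<langle>X\<rangle>\<close>. The structure maps of \<open>G\<langle>X\<rangle> / I\<close> are induced by
  those of \<open>G\<langle>X\<rangle>\<close>, so its adjoint action is computed on representatives. As \<open>I\<close> is a Hopf ideal,
  all the cosets in the union below are equal; the style is that of the definition of \<^const>\<open>rcoset_mult\<close>.\<close>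

definition ad_r :: "('g \<times> nat list \<Rightarrow>\<^sub>0 'k) \<Rightarrow> ('g \<times> nat list \<Rightarrow>\<^sub>0 'k) \<Rightarrow> ('g \<times> nat list \<Rightarrow>\<^sub>0 'k)" where
  "ad_r a b = lin_ext (\<lambda>(p, p').
     antipode (Poly_Mapping.single p 1) \<otimes>\<^bsub>skew_algebra\<^esub> b \<otimes>\<^bsub>skew_algebra\<^esub> Poly_Mapping.single p' 1)
     (comult a)"

definition ad_r_quotient ::
  "('g \<times> nat list \<Rightarrow>\<^sub>0 'k) set \<Rightarrow> ('g \<times> nat list \<Rightarrow>\<^sub>0 'k) set \<Rightarrow> ('g \<times> nat list \<Rightarrow>\<^sub>0 'k) set
   \<Rightarrow> ('g \<times> nat list \<Rightarrow>\<^sub>0 'k) set" where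
  "ad_r_quotient I A B = (\<Union>a\<in>A. \<Union>b\<in>B. proj I (ad_r a b))"

definition ad_r_invariant ::
  "('g \<times> nat list \<Rightarrow>\<^sub>0 'k) set \<Rightarrow> ('g \<times> nat list \<Rightarrow>\<^sub>0 'k) set set \<Rightarrow> bool" where
  "ad_r_invariant I U \<longleftrightarrow> (\<forall>A\<in>carrier (quotient I). \<forall>B\<in>U. ad_r_quotient I A B \<in> U)"

definition K_subalgebra ::
  "('g \<times> nat list \<Rightarrow>\<^sub>0 'k) set \<Rightarrow> nat set \<Rightarrow> ('g \<times> nat list \<Rightarrow>\<^sub>0 'k) set set" where
  "K_subalgebra I \<pi> = subalgebra_gen I
     {ad_r_quotient I (proj I (word w)) (proj I (grp (inv (g j)) \<otimes>\<^bsub>skew_algebra\<^esub> var j)) | w j.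
        w \<in> lists ({1..n} - \<pi>) \<and> j \<in> \<pi>}"

text \<open>\<open>u_elem k m\<close> is \<open>u[k, m]\<close>, for \<open>k \<le> m\<close>.\<close>

function u_elem :: "nat \<Rightarrow> nat \<Rightarrow> ('g \<times> nat list \<Rightarrow>\<^sub>0 'k)" where
  "u_elem k m = (if m \<le> k then var k else bracket (var k) (u_elem (k + 1) m))"
  by auto
termination by (relation "measure (\<lambda>(k, m). m - k)") auto

declare u_elem.simps [simp del]

text \<open>\<open>Psi_list k m [s\<^sub>1, \<dots>, s\<^sub>r]\<close> is \<open>\<Psi>\<^sup>S(k, m)\<close> for \<open>S \<inter> [k, m - 1] = {s\<^sub>1 < \<dots> < s\<^sub>r}\<close>; the outermost
  bracket is the one with \<open>u[k, s\<^sub>1]\<close>.\<close>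

fun Psi_list :: "nat \<Rightarrow> nat \<Rightarrow> nat list \<Rightarrow> ('g \<times> nat list \<Rightarrow>\<^sub>0 'k)" where
  "Psi_list k m [] = u_elem k m"
| "Psi_list k m (s # ss) = bracket (Psi_list (1 + s) m ss) (u_elem k s)"

definition Psi :: "nat set \<Rightarrow> nat \<Rightarrow> nat \<Rightarrow> ('g \<times> nat list \<Rightarrow>\<^sub>0 'k)" where
  "Psi S k m = Psi_list k m (sorted_list_of_set (S \<inter> {k..<m}))"

end


section \<open>The sets \<open>R\<^sub>k\<close> and \<open>T\<^sub>k\<close>\<close>

text \<open>\<open>R_step n \<theta> T k\<close> is \<open>R\<^sub>k\<close>, given the sets \<open>T\<^sub>i\<close> for \<open>i > k\<close>. For \<open>k = n\<close>, \<open>\<theta>\<^sub>n = 1\<close> the general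
  rule gives \<open>R\<^sub>n = T\<^sub>n = {n}\<close>, so that this case is not listed separately.
  The guard \<open>n < k\<close> in \<open>T_set\<close> only serves to make the recursion total.\<close>

definition R_step :: "(nat \<Rightarrow> nat) \<Rightarrow> (nat \<Rightarrow> nat set) \<Rightarrow> nat \<Rightarrow> nat set" where
  "R_step \<theta> T k =
    (if \<theta> k = 0 then {}
     else let e = k + \<theta> k - 1 in
       {e} \<union> {m. k \<le> m \<and> m < e \<and> e \<notin> T (m + 1) \<and>
                (\<forall>r. k \<le> r \<and> r < m \<longrightarrow> (m \<in> T (r + 1) \<longleftrightarrow> e \<in> T (r + 1)))})"

lemma R_step_cong [fundef_cong]:
  assumes "\<theta> = \<theta>'" "k = k'" "\<And>i. k' < i \<Longrightarrow> T i = T' i"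
  shows "R_step \<theta> T k = R_step \<theta>' T' k'"
  using assms by (auto simp: R_step_def Let_def less_Suc_eq_le)

lemma R_step_ge: "s \<in> R_step \<theta> T k \<Longrightarrow> k \<le> s"
  by (auto simp: R_step_def Let_def split: if_splits)

function T_set :: "nat \<Rightarrow> (nat \<Rightarrow> nat) \<Rightarrow> nat \<Rightarrow> nat set" where
  "T_set n \<theta> k =
    (if n < k then {}
     else R_step \<theta> (T_set n \<theta>) k \<union> (\<Union>s \<in> R_step \<theta> (T_set n \<theta>) k - {n}. T_set n \<theta> (s + 1)))"
  by auto
termination
  by (relation "measure (\<lambda>(n, \<theta>, k). n + 1 - k)") (auto dest: R_step_ge)

declare T_set.simps [simp del]

definition (in skew_hopf) U1 ::
  "('g \<times> nat list \<Rightarrow>\<^sub>0 'k) set \<Rightarrow> (nat \<Rightarrow> nat) \<Rightarrow> ('g \<times> nat list \<Rightarrow>\<^sub>0 'k) set set" where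
  "U1 I \<theta> = subalgebra_gen I
     {proj I (grp (inv (g_word [k..<m + 1])) \<otimes>\<^bsub>skew_algebra\<^esub> Psi (T_set n \<theta> k) k m) | k m.
        1 \<le> k \<and> k \<le> m \<and> m \<le> n \<and> m \<in> T_set n \<theta> k}"

end

theory Submission
  imports Defs "HOL-Library.Multiset"
begin

text \<open>
  Everything is lifted to \<open>G\<langle>X\<rangle>\<close>, modulo the Hopf ideal \<open>I\<close>. About \<open>I\<close> only three things are used: it is a Hopf
  ideal, it contains the quantum Serre relations, and its elements have no terms of word length less than two; so
  the generic case and the root of unity case are treated together.

  The operators \<open>ad\<^sub>r x\<^sub>i\<close> are skew derivations, and on a homogeneous \<open>P\<close> they are brackets up to units:
  \<open>(ad\<^sub>r x\<^sub>i)(g\<^sub>P\<^sup>-\<^sup>1 P) = - \<chi>\<^sup>i(g\<^sub>P)\<^sup>-\<^sup>1 (g\<^sub>i g\<^sub>P)\<^sup>-\<^sup>1 [x\<^sub>i, P]\<close>. Hence \<open>K(\<pi>)\<close> is invariant: for \<open>i \<notin> \<pi>\<close> by construction,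
  and for \<open>i \<in> \<pi>\<close> because \<open>(ad\<^sub>r x\<^sub>i) f\<close> is a combination of products of \<open>f\<close> and \<open>g\<^sub>i\<^sup>-\<^sup>1 x\<^sub>i \<in> K(\<pi>)\<close>.

  If \<open>U\<close> is invariant and \<open>m \<in> T\<^sub>k\<close>, then bracketing the generator of degree \<open>[k, m]\<close> with \<open>x\<^sub>m\<^sub>+\<^sub>1\<close> or \<open>x\<^sub>k\<^sub>-\<^sub>1\<close> gives
  an element of \<open>U\<close> that is nonzero modulo \<open>I\<close>, as one sees by stripping off its letters with skew derivatives.
  Since the roots \<open>[k, m]\<close>, \<open>m \<in> T\<^sub>k\<close>, are closed under concatenation, \<open>U\<close> has a nonzero component of an interval degree
  only if the interval is a root. So \<open>m + 1 \<in> T\<^sub>k\<close> and \<open>m \<in> T\<^sub>k\<^sub>-\<^sub>1\<close>, and coclosedness of the roots gives (ii).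

  Under (ii) the generator of degree \<open>[k, m]\<close> is, modulo \<open>I\<close> and up to a unit, obtained from \<open>g\<^sub>j\<^sup>-\<^sup>1 x\<^sub>j\<close>, \<open>j = j(k)\<close>, by applying
  \<open>ad\<^sub>r x\<^sub>i\<close> for \<open>i = j - 1, \<dots>, k, j + 1, \<dots>, m\<close>. A further \<open>ad\<^sub>r x\<^sub>i\<close> with \<open>i \<notin> \<pi> = {j. j \<in> T\<^sub>j}\<close> either prolongs one of the two arms
  or, by the Serre relations for the operators, gives \<open>0\<close>.
\<close>

section \<open>Linear maps and twisted algebras\<close>

text \<open>The obstacle is nonvanishing: in the root of unity case the ideal is given only through
  its maximality, and no basis of the quotient is at hand. What helps is that the coefficient of a
  single letter vanishes on \<open>I\<close>. Since \<open>I\<close> is a coideal, extracting this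
  coefficient in one tensor factor of \<open>comult\<close> gives derivatives that preserve
  \<open>I\<close>, and an element that they reduce to a letter, up to units, lies outside
  \<open>I\<close>. As membership in \<open>U\<close> is known only modulo \<open>I\<close>,
  nonvanishing in a given degree is expressed by a functional that kills both \<open>I\<close> and
  everything without a component of that degree.

  The values 1 and -1 of \<open>q\<close> are excluded at one point each. Every stripped letter
  produces the factor \<open>1 - inverse q\<close>. The middle coefficient of the Serre relation
  contains \<open>1 + q\<close>; if it is nonzero and one outer term vanishes, the other two terms
  vanish together. The value \<open>inverse q\<close> of the pairing of neighbouring letters makes
  the Serre elements skew primitive, so they generate a Hopf ideal, which by maximality lies in
  \<open>Lambda_ideal\<close>.\<close>

abbreviation keys where "keys \<equiv> Poly_Mapping.keys"
abbreviation single where "single \<equiv> Poly_Mapping.single"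
abbreviation lookup where "lookup \<equiv> Poly_Mapping.lookup"

lemma lookup_scale_pm: "lookup (scale_pm c f) b = c * lookup f b"
  unfolding scale_pm_def by (simp add: Poly_Mapping.map.rep_eq when_def)

global_interpretation pm: vector_space "scale_pm :: 'k::field \<Rightarrow> ('b \<Rightarrow>\<^sub>0 'k) \<Rightarrow> _"
  by unfold_locales
    (auto intro!: poly_mapping_eqI simp: lookup_scale_pm lookup_add algebra_simps)

lemma scale_pm_single [simp]: "scale_pm c (single b d) = single b (c * d)"
  by (rule poly_mapping_eqI) (simp add: lookup_scale_pm lookup_single when_def)

lemma keys_scale_pm_subset: "keys (scale_pm c f) \<subseteq> keys f"
  by (auto simp: in_keys_iff lookup_scale_pm)

abbreviation klin :: "(('b \<Rightarrow>\<^sub>0 'k::field) \<Rightarrow> ('c \<Rightarrow>\<^sub>0 'k)) \<Rightarrow> bool" where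
  "klin \<equiv> module_hom scale_pm scale_pm"

lemma klinI:
  assumes "\<And>f h. F (f + h) = F f + F h" and "\<And>c f. F (scale_pm c f) = scale_pm c (F f)"
  shows "klin F"
  using assms by (simp add: module_hom_iff pm.module_axioms)

lemma klin_simps:
  assumes "klin F"
  shows "F (f + h) = F f + F h" "F (f - h) = F f - F h" "F (- f) = - F f" "F 0 = 0"
    "F (scale_pm c f) = scale_pm c (F f)"
  using module_hom.add[OF assms] module_hom.diff[OF assms] module_hom.neg[OF assms]
    module_hom.zero[OF assms] module_hom.scale[OF assms] by auto

lemma pm_sum_single: "f = (\<Sum>b\<in>keys f. scale_pm (lookup f b) (single b 1))"
  by (rule poly_mapping_eqI)
    (auto simp: lookup_sum lookup_single when_def in_keys_iff sum.delta)

text \<open>Multilinear identities are checked by applying this to one argument at a time, with the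
  others frozen, until only basis elements remain; the linearity conditions are met by the
  collection \<open>klin_intros\<close>.\<close>

lemma klin_eqI:
  fixes f :: "'b \<Rightarrow>\<^sub>0 'k::field"
  assumes F: "klin F" and F': "klin F'" and B: "keys f \<subseteq> B"
    and eq: "\<And>b. b \<in> B \<Longrightarrow> F (single b 1) = F' (single b 1)"
  shows "F f = F' f"
proof -
  have "F f = (\<Sum>b\<in>keys f. scale_pm (lookup f b) (F (single b 1)))"
    by (subst pm_sum_single[of f]) (simp only: module_hom.sum[OF F] klin_simps[OF F])
  also have "\<dots> = (\<Sum>b\<in>keys f. scale_pm (lookup f b) (F' (single b 1)))"
    using B eq by (intro sum.cong) auto
  also have "\<dots> = F' f"
    by (subst (2) pm_sum_single[of f]) (simp only: module_hom.sum[OF F'] klin_simps[OF F'])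
  finally show ?thesis .
qed

lemma lin_ext_superset:
  assumes "finite A" "keys f \<subseteq> A"
  shows "lin_ext \<phi> f = (\<Sum>b\<in>A. scale_pm (lookup f b) (\<phi> b))"
  unfolding lin_ext_def using assms by (intro sum.mono_neutral_left) (auto simp: in_keys_iff)

lemma klin_lin_ext:
  fixes \<phi> :: "'b \<Rightarrow> ('c \<Rightarrow>\<^sub>0 'k::field)"
  shows "klin (lin_ext \<phi>)"
proof (rule klinI)
  fix f h :: "'b \<Rightarrow>\<^sub>0 'k"
  let ?A = "keys f \<union> keys h"
  have "keys (f + h) \<subseteq> ?A" by (rule Poly_Mapping.keys_add)
  then show "lin_ext \<phi> (f + h) = lin_ext \<phi> f + lin_ext \<phi> h"
    by (simp add: lin_ext_superset[of ?A] lookup_add pm.scale_left_distrib sum.distrib)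
next
  fix c :: 'k and f :: "'b \<Rightarrow>\<^sub>0 'k"
  show "lin_ext \<phi> (scale_pm c f) = scale_pm c (lin_ext \<phi> f)"
    by (simp add: lin_ext_superset[of "keys f"] keys_scale_pm_subset lookup_scale_pm
        pm.scale_sum_right)
qed

lemmas lin_ext_simps = klin_simps[OF klin_lin_ext]

lemma lin_ext_single [simp]: "lin_ext \<phi> (single b c) = scale_pm c (\<phi> b)"
  by (cases "c = 0") (auto simp: lin_ext_def)

named_theorems klin_intros

lemma klin_id [klin_intros]: "klin (\<lambda>f. f)"
  by (rule klinI) auto

lemma klin_compose: "klin F \<Longrightarrow> klin H \<Longrightarrow> klin (\<lambda>f. H (F f))"
  by (rule klinI) (simp_all add: klin_simps)

lemma klin_zero [klin_intros]: "klin (\<lambda>f. 0)"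
  and klin_add [klin_intros]: "klin F \<Longrightarrow> klin H \<Longrightarrow> klin (\<lambda>f. F f + H f)"
  and klin_diff [klin_intros]: "klin F \<Longrightarrow> klin H \<Longrightarrow> klin (\<lambda>f. F f - H f)"
  and klin_neg [klin_intros]: "klin F \<Longrightarrow> klin (\<lambda>f. - F f)"
  and klin_scale [klin_intros]: "klin F \<Longrightarrow> klin (\<lambda>f. scale_pm c (F f))"
  by (auto intro!: klinI simp: klin_simps pm.scale_right_distrib pm.scale_right_diff_distrib mult.commute)

lemma klin_lin_ext' [klin_intros]: "klin F \<Longrightarrow> klin (\<lambda>f. lin_ext \<phi> (F f))"
  by (rule klin_compose[OF _ klin_lin_ext])

lemma klin_lin_ext_param [klin_intros]:
  assumes "\<And>b. klin (F b)"
  shows "klin (\<lambda>f. lin_ext (\<lambda>b. F b f) h)"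
  unfolding lin_ext_def
  by (rule klinI)
    (simp_all add: klin_simps[OF assms] pm.scale_right_distrib sum.distrib pm.scale_sum_right mult.commute)

lemma lin_ext_cong:
  "(\<And>b. b \<in> keys f \<Longrightarrow> \<phi> b = \<psi> b) \<Longrightarrow> lin_ext \<phi> f = lin_ext \<psi> f"
  unfolding lin_ext_def by (intro sum.cong) auto

lemma klin_lin_ext_comm:
  assumes "klin F"
  shows "F (lin_ext \<phi> f) = lin_ext (\<lambda>b. F (\<phi> b)) f"
  by (rule klin_eqI[where B = UNIV and F = "\<lambda>f. F (lin_ext \<phi> f)" and F' = "lin_ext (\<lambda>b. F (\<phi> b))"])
    (auto intro!: klin_compose[OF _ assms] klin_lin_ext simp: klin_simps[OF assms])

lemma klin_subspace_induct:
  assumes P: "P 0" "\<And>f h. P f \<Longrightarrow> P h \<Longrightarrow> P (f + h)" "\<And>c f. P f \<Longrightarrow> P (scale_pm c f)"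
    and B: "\<And>b. b \<in> keys f \<Longrightarrow> P (\<phi> b)"
  shows "P (lin_ext \<phi> f)"
proof -
  have "P (\<Sum>b\<in>A. scale_pm (lookup f b) (\<phi> b))" if "finite A" "A \<subseteq> keys f" for A
    using that by (induction A) (auto intro: P B)
  then show ?thesis unfolding lin_ext_def by simp
qed

lemma lin_ext_single_self: "lin_ext (\<lambda>b. single b 1) f = f"
  unfolding lin_ext_def by (rule pm_sum_single[symmetric])

lemma keys_lin_ext_subset:
  assumes "\<And>b. b \<in> keys f \<Longrightarrow> keys (\<phi> b) \<subseteq> B"
  shows "keys (lin_ext \<phi> f) \<subseteq> B"
  by (rule klin_subspace_induct[where P = "\<lambda>f. keys f \<subseteq> B"])
    (simp_all add: assms order_trans[OF Poly_Mapping.keys_add Un_least] order_trans[OF keys_scale_pm_subset])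

lemma keys_uminus [simp]: "keys (- f) = keys (f :: 'b \<Rightarrow>\<^sub>0 'k::field)"
  by (auto simp: in_keys_iff)

lemma subspace_keys: "pm.subspace {f :: 'b \<Rightarrow>\<^sub>0 'k::field. \<forall>p\<in>keys f. P p}"
  unfolding pm.subspace_def
proof (intro conjI ballI allI)
  fix f h :: "'b \<Rightarrow>\<^sub>0 'k"
  assume "f \<in> {f. \<forall>p\<in>keys f. P p}" "h \<in> {f. \<forall>p\<in>keys f. P p}"
  then show "f + h \<in> {f. \<forall>p\<in>keys f. P p}"
    using Poly_Mapping.keys_add[of f h] by auto
next
  fix f :: "'b \<Rightarrow>\<^sub>0 'k" and c
  assume "f \<in> {f. \<forall>p\<in>keys f. P p}"
  then show "scale_pm c f \<in> {f. \<forall>p\<in>keys f. P p}"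
    using keys_scale_pm_subset[of c f] by auto
qed simp

section \<open>Tensor products and algebras with a twisted multiplication of basis elements\<close>

lemma klin_tensor1 [klin_intros]: "klin F \<Longrightarrow> klin (\<lambda>f. tensor (F f) h)"
  and klin_tensor2 [klin_intros]: "klin F \<Longrightarrow> klin (\<lambda>f. tensor h (F f))"
  unfolding tensor_def by (intro klin_intros; assumption)+

lemma tensor_single [simp]:
  "tensor (single b c) (single b' d) = single (b, b') (c * d)"
  by (simp add: tensor_def)

lemmas tensor_simps1 = klin_simps[OF klin_tensor1[OF klin_id]]
lemmas tensor_simps2 = klin_simps[OF klin_tensor2[OF klin_id]]

lemma twisted_algebra_simps:
  "carrier (twisted_algebra B m k e) = {f. keys f \<subseteq> B}"
  "\<one>\<^bsub>twisted_algebra B m k e\<^esub> = single e 1"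
  "\<zero>\<^bsub>twisted_algebra B m k e\<^esub> = 0"
  "f \<oplus>\<^bsub>twisted_algebra B m k e\<^esub> h = f + h"
  by (simp_all add: twisted_algebra_def)

lemma klin_twisted_mult1 [klin_intros]:
    "klin F \<Longrightarrow> klin (\<lambda>f. F f \<otimes>\<^bsub>twisted_algebra B m k e\<^esub> h)"
  and klin_twisted_mult2 [klin_intros]:
    "klin F \<Longrightarrow> klin (\<lambda>f. h \<otimes>\<^bsub>twisted_algebra B m k e\<^esub> F f)"
  unfolding twisted_algebra_def monoid.simps by (intro klin_intros; assumption)+

lemma twisted_mult_single:
  "single b c \<otimes>\<^bsub>twisted_algebra B m k e\<^esub> single b' d =
   single (m b b') (c * d * k b b')"
  by (simp add: twisted_algebra_def mult.assoc)

lemma twisted_mult_closed: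
  assumes "\<And>b b'. b \<in> B \<Longrightarrow> b' \<in> B \<Longrightarrow> m b b' \<in> B"
    and "keys f \<subseteq> B" "keys h \<subseteq> B"
  shows "keys (f \<otimes>\<^bsub>twisted_algebra B m k e\<^esub> h) \<subseteq> B"
  unfolding twisted_algebra_def monoid.simps
  using assms by (intro keys_lin_ext_subset) (auto split: if_splits)

text \<open>The hypothesis on \<open>k\<close> is the 2-cocycle identity, which is what
  associativity asks for on basis elements; trilinearity does the rest.\<close>

lemma twisted_mult_assoc:
  fixes f1 :: "'b \<Rightarrow>\<^sub>0 'k::field" and e :: 'b
  assumes m: "\<And>b b' b''. b \<in> B \<Longrightarrow> b' \<in> B \<Longrightarrow> b'' \<in> B \<Longrightarrow> m (m b b') b'' = m b (m b' b'')"
    and k: "\<And>b b' b''. b \<in> B \<Longrightarrow> b' \<in> B \<Longrightarrow> b'' \<in> B \<Longrightarrow> k b b' * k (m b b') b'' = k b' b'' * k b (m b' b'')"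
    and f: "keys f1 \<subseteq> B" "keys f2 \<subseteq> B" "keys f3 \<subseteq> B"
  defines "R \<equiv> twisted_algebra B m k e"
  shows "f1 \<otimes>\<^bsub>R\<^esub> f2 \<otimes>\<^bsub>R\<^esub> f3 = f1 \<otimes>\<^bsub>R\<^esub> (f2 \<otimes>\<^bsub>R\<^esub> f3)"
proof (rule klin_eqI[where f = f1 and B = B and F = "\<lambda>f. f \<otimes>\<^bsub>R\<^esub> f2 \<otimes>\<^bsub>R\<^esub> f3"
      and F' = "\<lambda>f. f \<otimes>\<^bsub>R\<^esub> (f2 \<otimes>\<^bsub>R\<^esub> f3)"])
  fix b1 assume b1: "b1 \<in> B"
  let ?s1 = "single b1 (1::'k)"
  show "?s1 \<otimes>\<^bsub>R\<^esub> f2 \<otimes>\<^bsub>R\<^esub> f3 = ?s1 \<otimes>\<^bsub>R\<^esub> (f2 \<otimes>\<^bsub>R\<^esub> f3)"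
  proof (rule klin_eqI[where f = f2 and B = B and F = "\<lambda>f. ?s1 \<otimes>\<^bsub>R\<^esub> f \<otimes>\<^bsub>R\<^esub> f3"
        and F' = "\<lambda>f. ?s1 \<otimes>\<^bsub>R\<^esub> (f \<otimes>\<^bsub>R\<^esub> f3)"])
    fix b2 assume b2: "b2 \<in> B"
    let ?s2 = "single b2 (1::'k)"
    show "?s1 \<otimes>\<^bsub>R\<^esub> ?s2 \<otimes>\<^bsub>R\<^esub> f3 = ?s1 \<otimes>\<^bsub>R\<^esub> (?s2 \<otimes>\<^bsub>R\<^esub> f3)"
      by (rule klin_eqI[where f = f3 and B = B and F = "\<lambda>f. ?s1 \<otimes>\<^bsub>R\<^esub> ?s2 \<otimes>\<^bsub>R\<^esub> f"
          and F' = "\<lambda>f. ?s1 \<otimes>\<^bsub>R\<^esub> (?s2 \<otimes>\<^bsub>R\<^esub> f)"])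
        (use b1 b2 f in \<open>auto simp: R_def twisted_mult_single m k intro!: klin_intros\<close>)
  qed (use f in \<open>auto simp: R_def intro!: klin_intros\<close>)
qed (use f in \<open>auto simp: R_def intro!: klin_intros\<close>)

lemma ring_twisted_algebra:
  fixes k :: "'b \<Rightarrow> 'b \<Rightarrow> 'k::field"
  assumes closed: "\<And>b b'. b \<in> B \<Longrightarrow> b' \<in> B \<Longrightarrow> m b b' \<in> B" and "e \<in> B"
    and m: "\<And>b b' b''. b \<in> B \<Longrightarrow> b' \<in> B \<Longrightarrow> b'' \<in> B \<Longrightarrow> m (m b b') b'' = m b (m b' b'')"
    and k: "\<And>b b' b''. b \<in> B \<Longrightarrow> b' \<in> B \<Longrightarrow> b'' \<in> B \<Longrightarrow> k b b' * k (m b b') b'' = k b' b'' * k b (m b' b'')"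
    and e: "\<And>b. b \<in> B \<Longrightarrow> m e b = b" "\<And>b. b \<in> B \<Longrightarrow> m b e = b"
      "\<And>b. b \<in> B \<Longrightarrow> k e b = 1" "\<And>b. b \<in> B \<Longrightarrow> k b e = 1"
  shows "ring (twisted_algebra B m k e)" (is "ring ?R")
proof (rule ringI)
  have carrier: "f \<in> carrier ?R \<longleftrightarrow> keys f \<subseteq> B" for f :: "'b \<Rightarrow>\<^sub>0 'k"
    by (simp add: twisted_algebra_simps)
  have add_closed: "keys (f + h) \<subseteq> B"
    if "keys f \<subseteq> B" "keys h \<subseteq> B" for f h :: "'b \<Rightarrow>\<^sub>0 'k"
    using that Poly_Mapping.keys_add[of f h] by blast
  show "abelian_group ?R"
  proof (rule abelian_groupI)
    fix f assume "f \<in> carrier ?R"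
    then show "\<exists>h\<in>carrier ?R. h \<oplus>\<^bsub>?R\<^esub> f = \<zero>\<^bsub>?R\<^esub>"
      by (intro bexI[of _ "- f"]) (auto simp: twisted_algebra_simps)
  qed (simp_all add: carrier add_closed twisted_algebra_simps(2-4) add_ac)
  show "Group.monoid ?R"
  proof (rule monoidI)
    fix f assume f: "f \<in> carrier ?R"
    show "\<one>\<^bsub>?R\<^esub> \<otimes>\<^bsub>?R\<^esub> f = f"
      by (rule klin_eqI[where F = "\<lambda>f. \<one>\<^bsub>?R\<^esub> \<otimes>\<^bsub>?R\<^esub> f" and B = B])
        (use f e in \<open>auto simp: twisted_algebra_simps twisted_mult_single intro!: klin_intros\<close>)
    show "f \<otimes>\<^bsub>?R\<^esub> \<one>\<^bsub>?R\<^esub> = f"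
      by (rule klin_eqI[where F = "\<lambda>f. f \<otimes>\<^bsub>?R\<^esub> \<one>\<^bsub>?R\<^esub>" and B = B])
        (use f e in \<open>auto simp: twisted_algebra_simps twisted_mult_single intro!: klin_intros\<close>)
  next
    fix f h assume "f \<in> carrier ?R" "h \<in> carrier ?R"
    then show "f \<otimes>\<^bsub>?R\<^esub> h \<in> carrier ?R"
      unfolding carrier by (intro twisted_mult_closed closed)
  next
    fix f1 f2 f3 assume "f1 \<in> carrier ?R" "f2 \<in> carrier ?R" "f3 \<in> carrier ?R"
    then show "f1 \<otimes>\<^bsub>?R\<^esub> f2 \<otimes>\<^bsub>?R\<^esub> f3 = f1 \<otimes>\<^bsub>?R\<^esub> (f2 \<otimes>\<^bsub>?R\<^esub> f3)"
      unfolding carrier by (intro twisted_mult_assoc m k)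
  qed (use \<open>e \<in> B\<close> in \<open>simp add: twisted_algebra_simps\<close>)
next
  fix f h l assume "f \<in> carrier ?R" "h \<in> carrier ?R" "l \<in> carrier ?R"
  show "(f \<oplus>\<^bsub>?R\<^esub> h) \<otimes>\<^bsub>?R\<^esub> l = f \<otimes>\<^bsub>?R\<^esub> l \<oplus>\<^bsub>?R\<^esub> h \<otimes>\<^bsub>?R\<^esub> l"
    unfolding twisted_algebra_simps by (rule klin_simps(1)[OF klin_twisted_mult1[OF klin_id]])
  show "l \<otimes>\<^bsub>?R\<^esub> (f \<oplus>\<^bsub>?R\<^esub> h) = l \<otimes>\<^bsub>?R\<^esub> f \<oplus>\<^bsub>?R\<^esub> l \<otimes>\<^bsub>?R\<^esub> h"
    unfolding twisted_algebra_simps by (rule klin_simps(1)[OF klin_twisted_mult2[OF klin_id]])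
qed

section \<open>Closedness and coclosedness of the sets \<open>T\<^sub>k\<close>\<close>

lemma T_set_rec:
  assumes "k \<le> n"
  shows "T_set n \<theta> k = R_step \<theta> (T_set n \<theta>) k \<union> (\<Union>s \<in> R_step \<theta> (T_set n \<theta>) k - {n}. T_set n \<theta> (s + 1))"
  using assms by (subst T_set.simps) simp

lemma T_set_beyond: "n < k \<Longrightarrow> T_set n \<theta> k = {}"
  by (subst T_set.simps) simp

lemma T_set_subset:
  assumes \<theta>: "\<forall>k\<in>{1..n}. \<theta> k \<le> n - k + 1" and "1 \<le> k"
  shows "T_set n \<theta> k \<subseteq> {k..n}"
  using \<open>1 \<le> k\<close>
proof (induction "n + 1 - k" arbitrary: k rule: less_induct)
  case less
  show ?case
  proof (cases "k \<le> n")
    case True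
    have R: "R_step \<theta> (T_set n \<theta>) k \<subseteq> {k..n}"
    proof -
      have "\<theta> k \<le> n - k + 1" using \<theta> less.prems True by simp
      then show ?thesis using True by (auto simp: R_step_def Let_def split: if_splits)
    qed
    have "T_set n \<theta> (s + 1) \<subseteq> {k..n}" if "s \<in> R_step \<theta> (T_set n \<theta>) k - {n}" for s
      using less.hyps[of "s + 1"] R that True by (fastforce simp: subset_iff)
    then show ?thesis using R T_set_rec[OF True] by blast
  qed (simp add: T_set_beyond)
qed

locale theta_sequence =
  fixes n :: nat and \<theta> :: "nat \<Rightarrow> nat"
  assumes theta_le: "\<forall>k\<in>{1..n}. \<theta> k \<le> n - k + 1"
begin

abbreviation "T \<equiv> T_set n \<theta>"
abbreviation "R \<equiv> R_step \<theta> T"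

lemma T_bounds: "1 \<le> k \<Longrightarrow> m \<in> T k \<Longrightarrow> k \<le> m" "1 \<le> k \<Longrightarrow> m \<in> T k \<Longrightarrow> m \<le> n"
  using T_set_subset[OF theta_le, of k] by auto

text \<open>If \<open>j\<close> is not in \<open>R k\<close> itself, it was inherited from
  \<open>T (s + 1)\<close> for some \<open>s\<close> in \<open>R k\<close>; by induction
  \<open>l\<close> lies in that set too and is inherited in the same way.\<close>

lemma T_closed:
  assumes "1 \<le> k" "j \<in> T k" "l \<in> T (j + 1)"
  shows "l \<in> T k"
  using assms
proof (induction "n - k" arbitrary: k rule: less_induct)
  case less
  have k: "k \<le> j" "j \<le> n" "j \<noteq> n"
    using T_bounds[of k j] less.prems T_set_beyond[of n "j + 1" \<theta>] by auto
  then have rec: "T k = R k \<union> (\<Union>s \<in> R k - {n}. T (s + 1))" by (intro T_set_rec) simp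
  show ?case
  proof (cases "j \<in> R k")
    case True
    then show ?thesis using rec less.prems k by auto
  next
    case False
    then obtain s where s: "s \<in> R k" "s \<noteq> n" "j \<in> T (s + 1)" using rec less.prems by auto
    then have "k \<le> s" "s < n" using R_step_ge[of s \<theta> T k] T_bounds[of "s + 1" j] by auto
    then have "l \<in> T (s + 1)" using less.hyps[of "s + 1"] less.prems s by auto
    then show ?thesis using rec s by auto
  qed
qed

text \<open>A root \<open>[k, m]\<close> cut after \<open>r\<close> has a root as its left or as its
  right piece. Conditions (b) and (c) in the definition of \<open>R k\<close> are made for this: it
  is proved first for elements of \<open>R k\<close>, then for the inherited ones.\<close>

lemma T_coclosed:
  assumes "1 \<le> k" "m \<in> T k" "k \<le> r" "r < m"
  shows "r \<in> T k \<or> m \<in> T (r + 1)"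
  using assms
proof (induction "n - k" arbitrary: k m r rule: less_induct)
  case less
  have k: "1 \<le> k" "k < n" using T_bounds[of k m] less.prems by auto
  then have rec: "T k = R k \<union> (\<Union>s \<in> R k - {n}. T (s + 1))" by (intro T_set_rec) simp
  have "\<theta> k \<noteq> 0"
  proof
    assume "\<theta> k = 0"
    then have "R k = {}" by (simp add: R_step_def)
    then show False using rec less.prems by auto
  qed
  define e where "e = k + \<theta> k - 1"
  have R: "m \<in> R k \<longleftrightarrow> m = e \<or> (k \<le> m \<and> m < e \<and> e \<notin> T (m + 1) \<and>
      (\<forall>r. k \<le> r \<and> r < m \<longrightarrow> (m \<in> T (r + 1) \<longleftrightarrow> e \<in> T (r + 1))))" for m
    using \<open>\<theta> k \<noteq> 0\<close> unfolding R_step_def e_def by (simp add: Let_def)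
  note IH = less.hyps
  \<comment> \<open>Condition (b) is assumed, so if \<open>r\<close> is not in \<open>R k\<close>,
    condition (c) fails at some smaller \<open>r'\<close>. Coclosedness of
    \<open>T (r' + 1)\<close>, cut at \<open>r\<close> below \<open>e\<close>, leaves only the
    failure with \<open>r\<close> inside and \<open>e\<close> outside; then \<open>r'\<close> lies
    in \<open>T k\<close> by induction on \<open>r\<close>, and closedness carries \<open>r\<close>
    along.\<close>
  have sub: "r \<in> T k" if "k \<le> r" "r < e" "e \<notin> T (r + 1)" for r
    using that
  proof (induction r rule: less_induct)
    case (less r)
    show ?case
    proof (cases "r \<in> R k")
      case True
      then show ?thesis using rec by auto
    next
      case False
      then obtain r' where r': "k \<le> r'" "r' < r" "(r \<in> T (r' + 1)) \<noteq> (e \<in> T (r' + 1))"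
        using R less.prems by auto
      have "n - (r' + 1) < n - k" using k r' by linarith
      then have "r \<in> T (r' + 1)" "e \<notin> T (r' + 1)"
        using IH[of "r' + 1" e r] r' less.prems by auto
      moreover have "r' \<in> T k" using less.IH[of r'] r' less.prems calculation by auto
      ultimately show ?thesis using T_closed k by blast
    qed
  qed
  \<comment> \<open>For \<open>m = e\<close> this is \<open>sub\<close>. Otherwise (c) for
    \<open>m\<close> makes \<open>m\<close> and \<open>e\<close> lie in the same sets
    \<open>T (r + 1)\<close>, which reduces the claim to \<open>e\<close>.\<close>
  have simple: "r \<in> T k \<or> m \<in> T (r + 1)" if "m \<in> R k" "k \<le> r" "r < m" for m r
    using sub[of r] that R[of m] by auto
  show ?case
  proof (cases "m \<in> R k")
    case True
    then show ?thesis using simple less.prems by blast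
  next
    case False
    then obtain s where s: "s \<in> R k" "s \<noteq> n" "m \<in> T (s + 1)" using rec less.prems by auto
    have ks: "k \<le> s" "s + 1 \<le> m" using R_step_ge[of s \<theta> T k] s T_bounds[of "s + 1" m] by auto
    consider "r = s" | "r < s" | "s < r" by linarith
    then show ?thesis
    proof cases
      case 1
      then show ?thesis using rec s by auto
    next
      case 2
      then have "r \<in> T k \<or> s \<in> T (r + 1)" using simple[of s r] s less.prems by auto
      then show ?thesis using T_closed[of "r + 1" s m] s by auto
    next
      case 3
      then have "r \<in> T (s + 1) \<or> m \<in> T (r + 1)"
        using less.hyps[of "s + 1" m r] less.prems s ks k by auto
      then show ?thesis using rec s by auto
    qed
  qed
qed

definition intervals :: bool where
  "intervals \<longleftrightarrow> (\<forall>k\<in>{1..n}. T k =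
     (if \<exists>j. k \<le> j \<and> j \<in> T j then {(LEAST j. k \<le> j \<and> j \<in> T j)..n} else {}))"

text \<open>The hypotheses make \<open>T k\<close> an upward closed part of \<open>{k..n}\<close>
  that contains every \<open>j \<ge> k\<close> with \<open>j \<in> T j\<close>. By coclosedness its
  least element is such a \<open>j\<close>, hence the least of them.\<close>

lemma intervalsI:
  assumes up: "\<And>k m. 1 \<le> k \<Longrightarrow> m \<in> T k \<Longrightarrow> m < n \<Longrightarrow> m + 1 \<in> T k"
    and down: "\<And>k m. 1 < k \<Longrightarrow> m \<in> T k \<Longrightarrow> m \<in> T (k - 1)"
  shows intervals
  unfolding intervals_def
proof (intro ballI)
  fix k assume k: "k \<in> {1..n}"
  have down': "j \<in> T i" if "1 \<le> i" "i \<le> k'" "j \<in> T k'" for i j k'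
    using that(2,3,1)
  proof (induction k' rule: dec_induct)
    case (step k')
    then show ?case using down[of "Suc k'" j] by simp
  qed
  have up': "l \<in> T k" if "a \<in> T k" "a \<le> l" "l \<le> n" for a l
    using that(2,1,3)
  proof (induction l rule: dec_induct)
    case (step l)
    then show ?case using up[of k l] k by simp
  qed
  show "T k = (if \<exists>j. k \<le> j \<and> j \<in> T j then {(LEAST j. k \<le> j \<and> j \<in> T j)..n} else {})"
  proof (cases "T k = {}")
    case True
    then show ?thesis using down'[of k] k by auto
  next
    case False
    define a where "a = (LEAST a. a \<in> T k)"
    have a: "a \<in> T k" using False unfolding a_def by (auto intro: LeastI)
    have a_le: "a \<le> m" if "m \<in> T k" for m using that unfolding a_def by (rule Least_le)
    have "k \<le> a" using a T_bounds k by simp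
    \<comment> \<open>The root \<open>[k, a]\<close> is cut before its last letter:
      \<open>a - 1\<close> lies outside \<open>T k\<close> by minimality, so the right piece must be
      a root.\<close>
    have "a \<in> T a"
    proof (cases "a = k")
      case False
      then have "a - 1 \<in> T k \<or> a \<in> T (a - 1 + 1)" using T_coclosed[of k a "a - 1"] a \<open>k \<le> a\<close> k by auto
      moreover have "a - 1 \<notin> T k" using a_le[of "a - 1"] False \<open>k \<le> a\<close> by auto
      ultimately show ?thesis using False \<open>k \<le> a\<close> by auto
    qed (use a in simp)
    have least: "(LEAST j. k \<le> j \<and> j \<in> T j) = a"
      using \<open>a \<in> T a\<close> \<open>k \<le> a\<close> a_le down'[of k] k by (intro Least_equality) auto
    have "T k = {a..n}"
    proof (intro equalityI subsetI)
      fix m assume "m \<in> T k"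
      then show "m \<in> {a..n}" using a_le T_bounds(2)[of k m] k by simp
    next
      fix m assume "m \<in> {a..n}"
      then show "m \<in> T k" using up'[OF a, of m] by simp
    qed
    then show ?thesis using least \<open>a \<in> T a\<close> \<open>k \<le> a\<close> by auto
  qed
qed

end

section \<open>The Hopf algebra structure and the adjoint action\<close>

type_synonym ('g, 'k) skew = "'g \<times> nat list \<Rightarrow>\<^sub>0 'k"

locale skew_hopf_algebra = skew_hopf n G g \<chi> + comm_group G
  for n :: nat and G :: "('g, 'm) monoid_scheme" (structure) and g :: "nat \<Rightarrow> 'g"
    and \<chi> :: "nat \<Rightarrow> 'g \<Rightarrow> 'k::field" +
  assumes g_closed [simp]: "i \<in> {1..n} \<Longrightarrow> g i \<in> carrier G"
    and chi_character: "i \<in> {1..n} \<Longrightarrow> character G (\<chi> i)"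
begin

notation skew_algebra ("\<H>")

abbreviation mul (infixl "\<star>" 70) where "f \<star> h \<equiv> f \<otimes>\<^bsub>\<H>\<^esub> h"
abbreviation tmul (infixl "\<star>\<star>" 70) where "f \<star>\<star> h \<equiv> f \<otimes>\<^bsub>tensor_algebra\<^esub> h"
abbreviation sgl where "sgl a u \<equiv> single (a, u) (1::'k)"
abbreviation letters where "letters \<equiv> lists {1..n}"

lemma skew_basis_iff [simp]: "(a, u) \<in> skew_basis \<longleftrightarrow> a \<in> carrier G \<and> u \<in> letters"
  by (auto simp: skew_basis_def)

lemma chi_simps:
  assumes "i \<in> {1..n}"
  shows "a \<in> carrier G \<Longrightarrow> \<chi> i a \<noteq> 0"
    and chi_mult: "a \<in> carrier G \<Longrightarrow> b \<in> carrier G \<Longrightarrow> \<chi> i (a \<otimes> b) = \<chi> i a * \<chi> i b"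
    and chi_one: "\<chi> i \<one> = 1"
    and chi_inv: "a \<in> carrier G \<Longrightarrow> \<chi> i (inv a) = inverse (\<chi> i a)"
proof -
  have c: "a \<in> carrier G \<Longrightarrow> \<chi> i a \<noteq> 0"
    "a \<in> carrier G \<Longrightarrow> b \<in> carrier G \<Longrightarrow> \<chi> i (a \<otimes> b) = \<chi> i a * \<chi> i b" for a b
    using chi_character[OF assms] unfolding character_def by auto
  have one: "\<chi> i \<one> = 1" using c(1)[of \<one>] c(2)[of \<one> \<one>] by simp
  show "a \<in> carrier G \<Longrightarrow> \<chi> i a \<noteq> 0" "\<chi> i \<one> = 1"
    "a \<in> carrier G \<Longrightarrow> b \<in> carrier G \<Longrightarrow> \<chi> i (a \<otimes> b) = \<chi> i a * \<chi> i b"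
    using c one by auto
  show "a \<in> carrier G \<Longrightarrow> \<chi> i (inv a) = inverse (\<chi> i a)"
    using c(1)[of "inv a"] c(1)[of a] c(2)[of a "inv a"] one by (simp add: inverse_unique)
qed

lemma chi_word_simps [simp]:
  "chi_word [] h = 1"
  "chi_word (i # u) h = \<chi> i h * chi_word u h"
  "chi_word (u @ v) h = chi_word u h * chi_word v h"
  by (simp_all add: chi_word_def)

lemma chi_word_nonzero: "u \<in> letters \<Longrightarrow> a \<in> carrier G \<Longrightarrow> chi_word u a \<noteq> 0"
  by (induction u) (auto simp: chi_simps)

lemma chi_word_mult:
  "u \<in> letters \<Longrightarrow> a \<in> carrier G \<Longrightarrow> b \<in> carrier G \<Longrightarrow> chi_word u (a \<otimes> b) = chi_word u a * chi_word u b"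
  by (induction u) (auto simp: chi_mult)

lemma chi_word_one: "u \<in> letters \<Longrightarrow> chi_word u \<one> = 1"
  by (induction u) (auto simp: chi_one)

lemma g_word_simps: "g_word [] = \<one>" "g_word (i # u) = g i \<otimes> g_word u"
  by (simp_all add: g_word_def)

lemma g_word_closed [simp]: "u \<in> letters \<Longrightarrow> g_word u \<in> carrier G"
  by (induction u) (auto simp: g_word_simps)

lemma g_word_append: "u \<in> letters \<Longrightarrow> v \<in> letters \<Longrightarrow> g_word (u @ v) = g_word u \<otimes> g_word v"
  by (induction u) (auto simp: g_word_simps m_assoc)

lemma carrier_skew: "f \<in> carrier \<H> \<longleftrightarrow> keys f \<subseteq> skew_basis"
  and one_skew: "\<one>\<^bsub>\<H>\<^esub> = sgl \<one> []"
  and zero_skew [simp]: "\<zero>\<^bsub>\<H>\<^esub> = 0"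
  and add_skew [simp]: "f \<oplus>\<^bsub>\<H>\<^esub> h = f + h"
  by (simp_all add: skew_algebra_def twisted_algebra_simps)

lemma klin_mul1 [klin_intros]: "klin F \<Longrightarrow> klin (\<lambda>f. F f \<star> h)"
  and klin_mul2 [klin_intros]: "klin F \<Longrightarrow> klin (\<lambda>f. h \<star> F f)"
  unfolding skew_algebra_def by (intro klin_intros; assumption)+

lemmas mul_linear = klin_simps[OF klin_mul1[OF klin_id]] klin_simps[OF klin_mul2[OF klin_id]]

lemma klin_tmul1 [klin_intros]: "klin F \<Longrightarrow> klin (\<lambda>f. F f \<star>\<star> h)"
  and klin_tmul2 [klin_intros]: "klin F \<Longrightarrow> klin (\<lambda>f. h \<star>\<star> F f)"
  unfolding tensor_algebra_def by (intro klin_intros; assumption)+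

lemmas tmul_linear = klin_simps[OF klin_tmul1[OF klin_id]] klin_simps[OF klin_tmul2[OF klin_id]]

lemma mul_single [simp]:
  "single (a, u) c \<star> single (b, v) d =
   single (a \<otimes> b, u @ v) (c * d * chi_word u b)"
  by (simp add: skew_algebra_def twisted_mult_single basis_mult_def basis_coeff_def)

lemma tmul_single [simp]:
  "single ((a, u), (a', u')) c \<star>\<star> single ((b, v), (b', v')) d =
   single ((a \<otimes> b, u @ v), (a' \<otimes> b', u' @ v')) (c * d * (chi_word u b * chi_word u' b'))"
  by (simp add: tensor_algebra_def twisted_mult_single basis_mult_def basis_coeff_def)

sublocale H: ring \<H>
  unfolding skew_algebra_def
  by (rule ring_twisted_algebra)
    (auto simp: basis_mult_def basis_coeff_def chi_word_mult chi_word_one m_assoc)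

sublocale HH: ring tensor_algebra
  unfolding tensor_algebra_def
  by (rule ring_twisted_algebra)
    (auto simp: basis_mult_def basis_coeff_def chi_word_mult chi_word_one m_assoc)

lemma uminus_skew: "f \<in> carrier \<H> \<Longrightarrow> \<ominus>\<^bsub>\<H>\<^esub> f = - f"
  by (rule H.minus_equality) (auto simp: carrier_skew)

lemma uminus_closed [simp]: "f \<in> carrier \<H> \<Longrightarrow> - f \<in> carrier \<H>"
  by (simp add: carrier_skew)

lemma add_closed [simp]: "f \<in> carrier \<H> \<Longrightarrow> h \<in> carrier \<H> \<Longrightarrow> f + h \<in> carrier \<H>"
  using H.a_closed by simp

lemma diff_closed [simp]: "f \<in> carrier \<H> \<Longrightarrow> h \<in> carrier \<H> \<Longrightarrow> f - h \<in> carrier \<H>"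
  using add_closed[of f "- h"] by simp

lemma scale_closed [simp]: "f \<in> carrier \<H> \<Longrightarrow> scale_pm c f \<in> carrier \<H>"
  using keys_scale_pm_subset by (force simp: carrier_skew)

lemma zero_closed [simp]: "0 \<in> carrier \<H>"
  by (simp add: carrier_skew)

lemma mul_closed [simp]: "f \<in> carrier \<H> \<Longrightarrow> h \<in> carrier \<H> \<Longrightarrow> f \<star> h \<in> carrier \<H>"
  by (rule H.m_closed)

lemma single_closed [simp]: "a \<in> carrier G \<Longrightarrow> u \<in> letters \<Longrightarrow> single (a, u) c \<in> carrier \<H>"
  by (auto simp: carrier_skew)

lemma basis_single_closed [simp]: "b \<in> skew_basis \<Longrightarrow> single b c \<in> carrier \<H>"
  by (auto simp: carrier_skew)

lemma scalar_closed [simp]: "scalar c \<in> carrier \<H>"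
  by (simp add: scalar_def)

lemma scalar_mul [simp]: "f \<in> carrier \<H> \<Longrightarrow> scalar c \<star> f = scale_pm c f"
  by (rule klin_eqI[where F = "\<lambda>f. scalar c \<star> f" and B = skew_basis])
    (auto intro!: klin_intros simp: carrier_skew scalar_def)

lemma mul_scalar [simp]: "f \<in> carrier \<H> \<Longrightarrow> f \<star> scalar c = scale_pm c f"
  by (rule klin_eqI[where F = "\<lambda>f. f \<star> scalar c" and B = skew_basis])
    (auto intro!: klin_intros simp: carrier_skew scalar_def chi_word_one)

lemma skew_eqI:
  assumes "klin F" "klin F'" "f \<in> carrier \<H>"
    and "\<And>a u. a \<in> carrier G \<Longrightarrow> u \<in> letters \<Longrightarrow> F (sgl a u) = F' (sgl a u)"
  shows "F f = F' f"
  using klin_eqI[OF assms(1,2), of f skew_basis] assms(3,4) by (auto simp: carrier_skew)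

lemma keysD:
  assumes "(a, u) \<in> keys f" "f \<in> carrier \<H>"
  shows "a \<in> carrier G" "u \<in> letters"
proof -
  have "(a, u) \<in> skew_basis" using assms unfolding carrier_skew by (rule rev_subsetD)
  then show "a \<in> carrier G" "u \<in> letters" by (simp_all only: skew_basis_iff)
qed

lemma subspace_carrier: "pm.subspace (carrier \<H>)"
  unfolding pm.subspace_def by simp

lemma skew_map_subspace:
  assumes "klin F" "pm.subspace A" "f \<in> carrier \<H>"
    and "\<And>a u. (a, u) \<in> keys f \<Longrightarrow> a \<in> carrier G \<Longrightarrow> u \<in> letters \<Longrightarrow> F (sgl a u) \<in> A"
  shows "F f \<in> A"
proof -
  have "lin_ext (\<lambda>b. F (single b 1)) f \<in> A"
  proof (rule klin_subspace_induct[where P = "\<lambda>f. f \<in> A"])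
    fix b assume "b \<in> keys f"
    then show "F (single b 1) \<in> A" using assms(4)[of "fst b" "snd b"] keysD[of "fst b" "snd b" f] assms(3) by simp
  qed (simp_all add: pm.subspace_0 pm.subspace_add pm.subspace_scale assms(2))
  then show ?thesis by (simp flip: klin_lin_ext_comm[OF assms(1)] add: lin_ext_single_self)
qed

lemma carrier_tensor: "t \<in> carrier tensor_algebra \<longleftrightarrow> keys t \<subseteq> skew_basis \<times> skew_basis"
  by (simp add: tensor_algebra_def twisted_algebra_simps)

lemma tensor_eqI:
  assumes "klin F" "klin F'" "t \<in> carrier tensor_algebra"
    and "\<And>a u b v. a \<in> carrier G \<Longrightarrow> u \<in> letters \<Longrightarrow> b \<in> carrier G \<Longrightarrow> v \<in> letters \<Longrightarrow>
      F (single ((a, u), (b, v)) 1) = F' (single ((a, u), (b, v)) 1)"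
  shows "F t = F' t"
  using klin_eqI[OF assms(1,2), of t "skew_basis \<times> skew_basis"] assms(3,4) by (auto simp: carrier_tensor)

text \<open>Up to sign the antipode of \<open>x_i\<close>, and the element from which
  \<open>K(\<pi>)\<close> starts for \<open>i \<in> \<pi>\<close>.\<close>

definition gr_var :: "nat \<Rightarrow> ('g, 'k) skew" where
  "gr_var i = grp (inv (g i)) \<star> var i"

text \<open>The factor \<open>\<one>\<close> stays, as cancelling it would require
  \<open>g i\<close> to lie in \<open>G\<close>, and \<open>i\<close> is arbitrary here.\<close>

lemma gr_var_eq: "gr_var i = sgl (inv (g i) \<otimes> \<one>) [i]"
  by (simp add: gr_var_def grp_def word_def)

lemma gr_var_closed [simp]: "i \<in> {1..n} \<Longrightarrow> gr_var i \<in> carrier \<H>"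
  by (simp add: gr_var_eq)

lemma grp_closed [simp]: "a \<in> carrier G \<Longrightarrow> grp a \<in> carrier \<H>"
  by (simp add: grp_def)

lemma word_closed [simp]: "u \<in> letters \<Longrightarrow> word u \<in> carrier \<H>"
  by (simp add: word_def)

section \<open>Multiplicativity of the comultiplication\<close>

definition comult_var :: "nat \<Rightarrow> (('g \<times> nat list) \<times> ('g \<times> nat list) \<Rightarrow>\<^sub>0 'k)" where
  "comult_var i = tensor (var i) (scalar 1) + tensor (grp (g i)) (var i)"

lemma comult_var_eq: "comult_var i = single ((\<one>, [i]), (\<one>, [])) 1 +
   single ((g i, []), (\<one>, [i])) 1"
  by (simp add: comult_var_def word_def scalar_def grp_def)

lemma klin_comult: "klin comult"
  unfolding comult_def by (rule klin_lin_ext)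

lemma klin_comult' [klin_intros]: "klin F \<Longrightarrow> klin (\<lambda>f. comult (F f))"
  by (rule klin_compose[OF _ klin_comult])

lemma comult_Nil: "comult (sgl a []) = single ((a, []), (a, [])) 1"
  by (simp add: comult_def grp_def)

lemma comult_snoc: "comult (sgl a (u @ [l])) = comult (sgl a u) \<star>\<star> comult_var l"
  by (simp add: comult_def comult_var_def)

lemma tadd_closed: "t \<in> carrier tensor_algebra \<Longrightarrow> t' \<in> carrier tensor_algebra \<Longrightarrow> t + t' \<in> carrier tensor_algebra"
  using HH.a_closed[of t t'] by (simp add: tensor_algebra_def twisted_algebra_simps)

lemma comult_var_closed [simp]: "i \<in> {1..n} \<Longrightarrow> comult_var i \<in> carrier tensor_algebra"
  unfolding comult_var_eq by (intro tadd_closed) (auto simp: carrier_tensor)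

lemma comult_single_closed:
  "a \<in> carrier G \<Longrightarrow> u \<in> letters \<Longrightarrow> comult (sgl a u) \<in> carrier tensor_algebra"
proof (induction u rule: rev_induct)
  case Nil
  then show ?case by (simp add: comult_Nil carrier_tensor)
next
  case (snoc l u)
  then show ?case unfolding comult_snoc by (intro HH.m_closed) auto
qed

lemma comult_closed [simp]: "f \<in> carrier \<H> \<Longrightarrow> comult f \<in> carrier tensor_algebra"
proof -
  have "carrier tensor_algebra = {t. \<forall>p\<in>keys t. p \<in> skew_basis \<times> skew_basis}"
    by (auto simp only: carrier_tensor)
  then have "pm.subspace (carrier tensor_algebra)" using subspace_keys by simp
  then show "f \<in> carrier \<H> \<Longrightarrow> comult f \<in> carrier tensor_algebra"
    by (rule skew_map_subspace[OF klin_comult _ _ comult_single_closed])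
qed

lemma comult_var_grp:
  assumes "i \<in> {1..n}" "b \<in> carrier G"
  shows "comult_var i \<star>\<star> comult (sgl b []) = scale_pm (\<chi> i b) (comult (sgl b []) \<star>\<star> comult_var i)"
  using assms by (simp add: comult_var_eq comult_Nil tmul_linear pm.scale_right_distrib m_comm chi_one)

lemma comult_mult_grp:
  assumes "a \<in> carrier G" "b \<in> carrier G" "u \<in> letters"
  shows "comult (sgl a u) \<star>\<star> comult (sgl b []) = scale_pm (chi_word u b) (comult (sgl (a \<otimes> b) u))"
  using assms(3)
proof (induction u rule: rev_induct)
  case Nil
  then show ?case using assms by (simp add: comult_Nil)
next
  case (snoc l u)
  have "comult (sgl a (u @ [l])) \<star>\<star> comult (sgl b []) =
      comult (sgl a u) \<star>\<star> (comult_var l \<star>\<star> comult (sgl b []))"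
    using snoc.prems assms by (simp add: comult_snoc HH.m_assoc)
  also have "\<dots> = scale_pm (\<chi> l b) (comult (sgl a u) \<star>\<star> comult (sgl b []) \<star>\<star> comult_var l)"
    using snoc.prems assms by (simp add: comult_var_grp tmul_linear HH.m_assoc)
  finally show ?case using snoc by (simp add: tmul_linear comult_snoc mult.commute)
qed

text \<open>\<open>comult\<close> is built up by right multiplication, one letter at a time.
  Induction on the right-hand word leaves the case \<open>v = []\<close>, where the grouplike
  \<open>b\<close> has to pass the letters of \<open>u\<close>.\<close>

lemma comult_mult_single:
  assumes "a \<in> carrier G" "b \<in> carrier G" "u \<in> letters" "v \<in> letters"
  shows "comult (sgl a u) \<star>\<star> comult (sgl b v) = scale_pm (chi_word u b) (comult (sgl (a \<otimes> b) (u @ v)))"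
  using assms(4)
proof (induction v rule: rev_induct)
  case Nil
  then show ?case using assms by (simp add: comult_mult_grp)
next
  case (snoc l v)
  have "comult (sgl a u) \<star>\<star> comult (sgl b (v @ [l])) = comult (sgl a u) \<star>\<star> comult (sgl b v) \<star>\<star> comult_var l"
    using snoc.prems assms by (simp add: comult_snoc HH.m_assoc)
  then show ?case using snoc by (simp add: tmul_linear flip: comult_snoc append_assoc)
qed

lemma comult_mult:
  assumes "f \<in> carrier \<H>" "h \<in> carrier \<H>"
  shows "comult (f \<star> h) = comult f \<star>\<star> comult h"
proof (rule skew_eqI[where f = f and F = "\<lambda>f. comult (f \<star> h)" and F' = "\<lambda>f. comult f \<star>\<star> comult h"])
  fix a u assume a: "a \<in> carrier G" "u \<in> letters"
  show "comult (sgl a u \<star> h) = comult (sgl a u) \<star>\<star> comult h"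
    by (rule skew_eqI[where f = h and F = "\<lambda>h. comult (sgl a u \<star> h)" and F' = "\<lambda>h. comult (sgl a u) \<star>\<star> comult h"])
      (use a assms in \<open>auto intro!: klin_intros simp: comult_mult_single
        simp flip: klin_simps(5)[OF klin_comult]\<close>)
qed (use assms in \<open>auto intro!: klin_intros\<close>)

section \<open>Antimultiplicativity of the antipode\<close>

lemma klin_antipode: "klin antipode"
  unfolding antipode_def by (rule klin_lin_ext)

lemma klin_antipode' [klin_intros]: "klin F \<Longrightarrow> klin (\<lambda>f. antipode (F f))"
  by (rule klin_compose[OF _ klin_antipode])

lemma antipode_Nil: "antipode (sgl a []) = sgl (inv a) []"
  by (simp add: antipode_def grp_def)

lemma antipode_snoc: "antipode (sgl a (u @ [l])) = - (gr_var l \<star> antipode (sgl a u))"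
  by (simp add: antipode_def gr_var_def mul_linear)

lemma antipode_single_closed:
  "a \<in> carrier G \<Longrightarrow> u \<in> letters \<Longrightarrow> antipode (sgl a u) \<in> carrier \<H>"
  by (induction u rule: rev_induct) (simp_all add: antipode_Nil antipode_snoc)

lemma antipode_closed [simp]: "f \<in> carrier \<H> \<Longrightarrow> antipode f \<in> carrier \<H>"
  by (rule skew_map_subspace[OF klin_antipode subspace_carrier _ antipode_single_closed])

text \<open>The product of \<open>a u\<close> and \<open>b\<close> is \<open>chi_word u b\<close>
  times \<open>(a b) u\<close>; antimultiplicativity is written with this scalar on the left so that
  nothing has to be divided.\<close>

lemma antipode_mult_grp:
  assumes "a \<in> carrier G" "b \<in> carrier G" "u \<in> letters"
  shows "scale_pm (chi_word u b) (antipode (sgl (a \<otimes> b) u)) = sgl (inv b) [] \<star> antipode (sgl a u)"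
  using assms(3)
proof (induction u rule: rev_induct)
  case Nil
  then show ?case using assms by (simp add: antipode_Nil inv_mult m_comm)
next
  case (snoc l u)
  have l: "l \<in> {1..n}" "u \<in> letters" using snoc.prems by auto
  have "scale_pm (chi_word (u @ [l]) b) (antipode (sgl (a \<otimes> b) (u @ [l]))) =
      - scale_pm (\<chi> l b) (gr_var l \<star> scale_pm (chi_word u b) (antipode (sgl (a \<otimes> b) u)))"
    by (simp add: antipode_snoc mul_linear mult.commute)
  also have "\<dots> = - (scale_pm (\<chi> l b) (gr_var l \<star> sgl (inv b) []) \<star> antipode (sgl a u))"
    using snoc.IH l assms by (simp add: H.m_assoc mul_linear)
  also have "scale_pm (\<chi> l b) (gr_var l \<star> sgl (inv b) []) = sgl (inv b) [] \<star> gr_var l"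
    using l assms by (simp add: gr_var_eq chi_inv chi_simps m_comm)
  finally show ?case using l assms by (simp add: antipode_snoc H.m_assoc mul_linear)
qed

lemma antipode_mult_single:
  assumes "a \<in> carrier G" "b \<in> carrier G" "u \<in> letters" "v \<in> letters"
  shows "scale_pm (chi_word u b) (antipode (sgl (a \<otimes> b) (u @ v))) = antipode (sgl b v) \<star> antipode (sgl a u)"
  using assms(4)
proof (induction v rule: rev_induct)
  case Nil
  then show ?case using assms by (simp add: antipode_mult_grp antipode_Nil)
next
  case (snoc l v)
  then have l: "l \<in> {1..n}" "v \<in> letters" by auto
  have "scale_pm (chi_word u b) (antipode (sgl (a \<otimes> b) (u @ v @ [l]))) =
      - (gr_var l \<star> scale_pm (chi_word u b) (antipode (sgl (a \<otimes> b) (u @ v))))"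
    using antipode_snoc[of "a \<otimes> b" "u @ v" l] by (simp add: mul_linear)
  also have "\<dots> = - (gr_var l \<star> (antipode (sgl b v) \<star> antipode (sgl a u)))"
    by (simp only: snoc.IH[OF l(2)])
  finally show ?case using l assms by (simp add: antipode_snoc H.m_assoc mul_linear)
qed

lemma antipode_mult:
  assumes "f \<in> carrier \<H>" "h \<in> carrier \<H>"
  shows "antipode (f \<star> h) = antipode h \<star> antipode f"
proof (rule skew_eqI[where f = f and F = "\<lambda>f. antipode (f \<star> h)" and F' = "\<lambda>f. antipode h \<star> antipode f"])
  fix a u assume a: "a \<in> carrier G" "u \<in> letters"
  show "antipode (sgl a u \<star> h) = antipode h \<star> antipode (sgl a u)"
    by (rule skew_eqI[where f = h and F = "\<lambda>h. antipode (sgl a u \<star> h)" and F' = "\<lambda>h. antipode h \<star> antipode (sgl a u)"])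
      (use a assms in \<open>auto intro!: klin_intros simp: antipode_mult_single[symmetric]
        simp flip: klin_simps(5)[OF klin_antipode]\<close>)
qed (use assms in \<open>auto intro!: klin_intros\<close>)

section \<open>The right adjoint action in terms of conjugations and single letters\<close>

definition conjugate :: "'g \<Rightarrow> ('g, 'k) skew \<Rightarrow> ('g, 'k) skew" where
  "conjugate b f = grp (inv b) \<star> f \<star> grp b"

text \<open>This form of \<open>g_i^(-1) (f x_i - x_i f)\<close> involves only
  \<open>gr_var i\<close> and conjugation. The skew Leibniz rule can be read off, and a subalgebra
  that contains \<open>gr_var i\<close> and is stable under conjugation is visibly stable under the
  operator.\<close>

definition ad_var :: "nat \<Rightarrow> ('g, 'k) skew \<Rightarrow> ('g, 'k) skew" where
  "ad_var i f = conjugate (g i) f \<star> gr_var i - gr_var i \<star> f"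

text \<open>The adjoint action is a right action, so the first letter acts first.\<close>

abbreviation ad_word :: "nat list \<Rightarrow> ('g, 'k) skew \<Rightarrow> ('g, 'k) skew" where
  "ad_word u f \<equiv> foldl (\<lambda>f i. ad_var i f) f u"

lemma klin_conj [klin_intros]: "klin F \<Longrightarrow> klin (\<lambda>f. conjugate b (F f))"
  unfolding conjugate_def by (intro klin_intros)

lemma klin_ad_var [klin_intros]: "klin F \<Longrightarrow> klin (\<lambda>f. ad_var i (F f))"
  unfolding ad_var_def by (intro klin_intros)

lemma klin_ad_word [klin_intros]: "klin F \<Longrightarrow> klin (\<lambda>f. ad_word u (F f))"
  by (induction u arbitrary: F) (auto intro!: klin_intros)

lemmas conjugate_linear = klin_simps[OF klin_conj[OF klin_id]]
lemmas ad_var_linear = klin_simps[OF klin_ad_var[OF klin_id]]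
lemmas ad_word_linear = klin_simps[OF klin_ad_word[OF klin_id]]

lemma conjugate_closed [simp]: "b \<in> carrier G \<Longrightarrow> f \<in> carrier \<H> \<Longrightarrow> conjugate b f \<in> carrier \<H>"
  by (simp add: conjugate_def)

lemma ad_var_closed [simp]: "i \<in> {1..n} \<Longrightarrow> f \<in> carrier \<H> \<Longrightarrow> ad_var i f \<in> carrier \<H>"
  by (simp add: ad_var_def)

lemma ad_word_closed [simp]: "u \<in> letters \<Longrightarrow> f \<in> carrier \<H> \<Longrightarrow> ad_word u f \<in> carrier \<H>"
  by (induction u arbitrary: f) auto

lemma conjugate_single:
  assumes "b \<in> carrier G" "a \<in> carrier G" "u \<in> letters"
  shows "conjugate b (single (a, u) c) = single (a, u) (c * chi_word u b)"
proof -
  have "inv b \<otimes> a \<otimes> b = a" using assms by (simp add: m_assoc m_comm[of a b] flip: m_assoc[of "inv b"])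
  then show ?thesis using assms by (simp add: conjugate_def grp_def)
qed

lemma conjugate_mult:
  assumes "b \<in> carrier G" "f \<in> carrier \<H>" "h \<in> carrier \<H>"
  shows "conjugate b (f \<star> h) = conjugate b f \<star> conjugate b h"
proof -
  have "grp b \<star> grp (inv b) = \<one>\<^bsub>\<H>\<^esub>" using assms by (simp add: grp_def one_skew)
  then have "conjugate b f \<star> conjugate b h = grp (inv b) \<star> f \<star> \<one>\<^bsub>\<H>\<^esub> \<star> h \<star> grp b"
    using assms by (simp add: conjugate_def H.m_assoc del: H.l_one H.r_one)
      (metis H.m_assoc grp_closed inv_closed mul_closed)
  then show ?thesis using assms by (simp add: conjugate_def H.m_assoc)
qed

lemma ad_var_eq:
  assumes "i \<in> {1..n}" "f \<in> carrier \<H>"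
  shows "ad_var i f = grp (inv (g i)) \<star> (f \<star> var i - var i \<star> f)"
proof -
  have "grp (g i) \<star> gr_var i = var i"
    using assms by (simp add: gr_var_eq grp_def word_def m_assoc[symmetric])
  then show ?thesis
    using assms by (simp add: ad_var_def conjugate_def H.m_assoc mul_linear)
      (simp add: gr_var_def H.m_assoc)
qed

lemma klin_ad_r: "klin (\<lambda>a. ad_r a b)"
  unfolding ad_r_def by (intro klin_intros)

lemma klin_ad_r2: "klin (ad_r a)"
  unfolding ad_r_def by (intro klin_intros klin_lin_ext_param) (auto intro!: klin_intros split: prod.splits)

lemma ad_r_snoc:
  assumes "a \<in> carrier G" "u \<in> letters" "l \<in> {1..n}" "f \<in> carrier \<H>"
  shows "ad_r (sgl a (u @ [l])) f = ad_var l (ad_r (sgl a u) f)"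
proof -
  let ?L = "lin_ext (\<lambda>(p, p'). antipode (single p 1) \<star> f \<star> single p' 1)"
  \<comment> \<open>The identity holds for every tensor in place of \<open>comult (sgl a u)\<close>,
    so it can be tested on basis tensors.\<close>
  have "?L (comult (sgl a u) \<star>\<star> comult_var l) = ad_var l (?L (comult (sgl a u)))"
  proof (rule tensor_eqI[where F = "\<lambda>t. ?L (t \<star>\<star> comult_var l)" and F' = "\<lambda>t. ad_var l (?L t)"])
    fix b v b' v' assume b: "b \<in> carrier G" "v \<in> letters" "b' \<in> carrier G" "v' \<in> letters"
    \<comment> \<open>The summand \<open>g_l \<otimes> x_l\<close> multiplies the left factor by
      \<open>g_l\<close>; under the antipode this becomes the \<open>g_l^(-1)\<close> in front that
      \<open>ad_var\<close> requires.\<close>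
    have gg: "sgl (inv (g l)) [] \<star> antipode (sgl b v) =
        scale_pm (chi_word v (g l)) (antipode (sgl (b \<otimes> g l) v))"
      using b assms by (simp add: antipode_mult_grp)
    have v: "sgl b' (v' @ [l]) = sgl b' v' \<star> var l"
      using b by (simp add: word_def chi_word_one)
    have "?L (single ((b, v), b', v') 1 \<star>\<star> comult_var l) =
      antipode (sgl b (v @ [l])) \<star> f \<star> sgl b' v' +
      scale_pm (chi_word v (g l)) (antipode (sgl (b \<otimes> g l) v)) \<star> f \<star> sgl b' (v' @ [l])"
      using b by (simp add: comult_var_eq tmul_linear lin_ext_simps chi_word_one mul_linear)
    also have "\<dots> = ad_var l (antipode (sgl b v) \<star> f \<star> sgl b' v')"
      using b assms unfolding gg[symmetric] v
      by (simp add: ad_var_eq antipode_snoc mul_linear H.m_assoc gr_var_def)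
        (simp add: grp_def)
    finally show "?L (single ((b, v), b', v') 1 \<star>\<star> comult_var l) =
        ad_var l (?L (single ((b, v), b', v') 1))"
      by simp
  qed (use assms in \<open>auto intro!: klin_intros\<close>)
  then show ?thesis by (simp add: ad_r_def comult_snoc)
qed

lemma ad_r_single:
  assumes "a \<in> carrier G" "u \<in> letters" "f \<in> carrier \<H>"
  shows "ad_r (sgl a u) f = ad_word u (conjugate a f)"
  using assms(2)
proof (induction u rule: rev_induct)
  case Nil
  then show ?case using assms by (simp add: ad_r_def comult_Nil antipode_Nil conjugate_def grp_def)
next
  case (snoc l u)
  then show ?case using assms by (simp add: ad_r_snoc)
qed

lemma ad_r_closed:
  assumes "a \<in> carrier \<H>" "f \<in> carrier \<H>"
  shows "ad_r a f \<in> carrier \<H>"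
  by (rule skew_map_subspace[OF klin_ad_r subspace_carrier assms(1)]) (simp add: ad_r_single assms(2))

section \<open>Hopf ideals\<close>

lemma ideal_skewD:
  assumes "ideal I \<H>"
  shows "f \<in> I \<Longrightarrow> f \<in> carrier \<H>" "0 \<in> I" "f \<in> I \<Longrightarrow> h \<in> I \<Longrightarrow> f + h \<in> I"
    "f \<in> I \<Longrightarrow> h \<in> carrier \<H> \<Longrightarrow> h \<star> f \<in> I" "f \<in> I \<Longrightarrow> h \<in> carrier \<H> \<Longrightarrow> f \<star> h \<in> I"
    and ideal_scale: "f \<in> I \<Longrightarrow> scale_pm c f \<in> I"
    and ideal_neg: "f \<in> I \<Longrightarrow> - f \<in> I"
    and ideal_diff: "f \<in> I \<Longrightarrow> h \<in> I \<Longrightarrow> f - h \<in> I"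
proof -
  interpret ideal I \<H> by fact
  show c: "f \<in> I \<Longrightarrow> f \<in> carrier \<H>" and "0 \<in> I" and add: "f \<in> I \<Longrightarrow> h \<in> I \<Longrightarrow> f + h \<in> I"
    and "f \<in> I \<Longrightarrow> h \<in> carrier \<H> \<Longrightarrow> h \<star> f \<in> I" "f \<in> I \<Longrightarrow> h \<in> carrier \<H> \<Longrightarrow> f \<star> h \<in> I" for f h
    using a_subset I_l_closed I_r_closed a_closed[of f h] zero_closed by auto
  show s: "f \<in> I \<Longrightarrow> scale_pm c f \<in> I" for c f
    using I_l_closed[of f "scalar c"] c by simp
  show neg: "f \<in> I \<Longrightarrow> - f \<in> I" for f using s[of f "- 1"] by simp
  show "f \<in> I \<Longrightarrow> h \<in> I \<Longrightarrow> f - h \<in> I" using add[of f "- h"] neg[of h] by simp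
qed

lemma ideal_skewI:
  assumes "I \<subseteq> carrier \<H>" "pm.subspace I"
    and "\<And>f h. f \<in> I \<Longrightarrow> h \<in> carrier \<H> \<Longrightarrow> h \<star> f \<in> I"
    and "\<And>f h. f \<in> I \<Longrightarrow> h \<in> carrier \<H> \<Longrightarrow> f \<star> h \<in> I"
  shows "ideal I \<H>"
proof (rule idealI[OF H.ring_axioms])
  show "subgroup I (add_monoid \<H>)"
  proof (rule group.subgroupI[OF H.a_group])
    fix f h assume "f \<in> I" "h \<in> I"
    then show "f \<otimes>\<^bsub>add_monoid \<H>\<^esub> h \<in> I" using pm.subspace_add[OF assms(2)] by simp
  next
    fix f assume f: "f \<in> I"
    then have "inv\<^bsub>add_monoid \<H>\<^esub> f = - f"
      using assms(1) uminus_skew[of f] by (auto simp: a_inv_def)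
    then show "inv\<^bsub>add_monoid \<H>\<^esub> f \<in> I" using pm.subspace_neg[OF assms(2) f] by simp
  qed (use assms(1) pm.subspace_0[OF assms(2)] in auto)
qed (use assms in auto)

lemma subspace_ideal: "ideal I \<H> \<Longrightarrow> pm.subspace I"
  by (simp add: pm.subspace_def ideal_skewD(2,3) ideal_scale)

lemma subspace_vimage: "klin F \<Longrightarrow> pm.subspace A \<Longrightarrow> pm.subspace {f \<in> carrier \<H>. F f \<in> A}"
  unfolding pm.subspace_def by (simp add: klin_simps)

section \<open>Ideals and coideals\<close>

abbreviation tensor_ideal :: "('g, 'k) skew set \<Rightarrow> (('g \<times> nat list) \<times> ('g \<times> nat list) \<Rightarrow>\<^sub>0 'k) set" where
  "tensor_ideal I \<equiv> pm.span {tensor a b | a b. a \<in> carrier \<H> \<and> b \<in> carrier \<H> \<and> (a \<in> I \<or> b \<in> I)}"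

lemma hopf_ideal_alt:
  "hopf_ideal I \<longleftrightarrow> ideal I \<H> \<and> (\<forall>f\<in>I. comult f \<in> tensor_ideal I) \<and> (\<forall>f\<in>I. counit f = 0) \<and>
     (\<forall>f\<in>I. antipode f \<in> I)"
  unfolding hopf_ideal_def ..

lemma klin_span:
  assumes "klin F" "pm.subspace A" "t \<in> pm.span S" "\<And>s. s \<in> S \<Longrightarrow> F s \<in> A"
  shows "F t \<in> A"
proof -
  have "pm.subspace {t. F t \<in> A}"
    using assms(2) unfolding pm.subspace_def by (simp add: klin_simps[OF assms(1)])
  then show ?thesis
    using pm.span_induct[OF assms(3), of "\<lambda>t. F t \<in> A"] assms(4) by auto
qed

lemma tensor_idealI: "a \<in> carrier \<H> \<Longrightarrow> b \<in> carrier \<H> \<Longrightarrow> a \<in> I \<or> b \<in> I \<Longrightarrow> tensor a b \<in> tensor_ideal I"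
  by (rule pm.span_base) auto

lemma tensor_ideal_map:
  assumes "klin F" "pm.subspace A" "t \<in> tensor_ideal I"
    and "\<And>a b. a \<in> carrier \<H> \<Longrightarrow> b \<in> carrier \<H> \<Longrightarrow> a \<in> I \<or> b \<in> I \<Longrightarrow> F (tensor a b) \<in> A"
  shows "F t \<in> A"
  by (rule klin_span[OF assms(1,2,3)]) (use assms(4) in auto)

lemma lin_ext_tensor: "lin_ext \<phi> (tensor a b) = lin_ext (\<lambda>p. lin_ext (\<lambda>p'. \<phi> (p, p')) b) a"
proof (rule klin_eqI[where B = UNIV and F = "\<lambda>a. lin_ext \<phi> (tensor a b)"])
  fix p
  show "lin_ext \<phi> (tensor (single p 1) b) =
      lin_ext (\<lambda>p. lin_ext (\<lambda>p'. \<phi> (p, p')) b) (single p 1)"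
    by (rule klin_eqI[where B = UNIV and F = "\<lambda>b. lin_ext \<phi> (tensor (single p 1) b)"
          and F' = "\<lambda>b. lin_ext (\<lambda>p. lin_ext (\<lambda>p'. \<phi> (p, p')) b) (single p 1)"])
      (auto intro!: klin_intros)
qed (auto intro!: klin_intros)

lemma tensor_mult:
  assumes "a \<in> carrier \<H>" "b \<in> carrier \<H>" "c \<in> carrier \<H>" "d \<in> carrier \<H>"
  shows "tensor a b \<star>\<star> tensor c d = tensor (a \<star> c) (b \<star> d)"
proof (rule skew_eqI[where f = a and F = "\<lambda>a. tensor a b \<star>\<star> tensor c d" and F' = "\<lambda>a. tensor (a \<star> c) (b \<star> d)"])
  fix h u assume 1: "h \<in> carrier G" "u \<in> letters"
  show "tensor (sgl h u) b \<star>\<star> tensor c d = tensor (sgl h u \<star> c) (b \<star> d)"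
  proof (rule skew_eqI[where f = b and F = "\<lambda>b. tensor (sgl h u) b \<star>\<star> tensor c d"
        and F' = "\<lambda>b. tensor (sgl h u \<star> c) (b \<star> d)"])
    fix h2 u2 assume 2: "h2 \<in> carrier G" "u2 \<in> letters"
    show "tensor (sgl h u) (sgl h2 u2) \<star>\<star> tensor c d = tensor (sgl h u \<star> c) (sgl h2 u2 \<star> d)"
    proof (rule skew_eqI[where f = c and F = "\<lambda>c. tensor (sgl h u) (sgl h2 u2) \<star>\<star> tensor c d"
          and F' = "\<lambda>c. tensor (sgl h u \<star> c) (sgl h2 u2 \<star> d)"])
      fix h3 u3 assume 3: "h3 \<in> carrier G" "u3 \<in> letters"
      show "tensor (sgl h u) (sgl h2 u2) \<star>\<star> tensor (sgl h3 u3) d = tensor (sgl h u \<star> sgl h3 u3) (sgl h2 u2 \<star> d)"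
        by (rule skew_eqI[where f = d and F = "\<lambda>d. tensor (sgl h u) (sgl h2 u2) \<star>\<star> tensor (sgl h3 u3) d"
              and F' = "\<lambda>d. tensor (sgl h u \<star> sgl h3 u3) (sgl h2 u2 \<star> d)"])
          (use assms 1 2 3 in \<open>auto intro!: klin_intros\<close>)
    qed (use assms in \<open>auto intro!: klin_intros\<close>)
  qed (use assms in \<open>auto intro!: klin_intros\<close>)
qed (use assms in \<open>auto intro!: klin_intros\<close>)

text \<open>By bilinearity only products of pure tensors matter, and there the factor lying in
  \<open>I\<close> stays in \<open>I\<close>.\<close>

lemma tensor_ideal_ideal:
  assumes I: "ideal I \<H>" and t: "t \<in> tensor_ideal I" and s: "s \<in> carrier tensor_algebra"
  shows "s \<star>\<star> t \<in> tensor_ideal I" "t \<star>\<star> s \<in> tensor_ideal I"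
proof -
  have span: "s = lin_ext (\<lambda>p. tensor (single (fst p) 1) (single (snd p) 1)) s"
    by (simp add: lin_ext_single_self)
  have *: "tensor (single p 1) (single p' 1) \<star>\<star> t \<in> tensor_ideal I"
    "t \<star>\<star> tensor (single p 1) (single p' 1) \<in> tensor_ideal I"
    if "p \<in> skew_basis" "p' \<in> skew_basis" for p p'
    by (rule tensor_ideal_map[OF _ pm.subspace_span t];
        use that I in \<open>auto intro!: klin_intros tensor_idealI simp: tensor_mult simp del: tensor_single
          intro: ideal_skewD\<close>)+
  show "s \<star>\<star> t \<in> tensor_ideal I"
    by (subst span, rule klin_subspace_induct[where P = "\<lambda>s. s \<star>\<star> t \<in> tensor_ideal I"])
      (use s * in \<open>auto simp: tmul_linear carrier_tensor pm.span_zero pm.span_add pm.span_scale simp del: tensor_single\<close>)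
  show "t \<star>\<star> s \<in> tensor_ideal I"
    by (subst span, rule klin_subspace_induct[where P = "\<lambda>s. t \<star>\<star> s \<in> tensor_ideal I"])
      (use s * in \<open>auto simp: tmul_linear carrier_tensor pm.span_zero pm.span_add pm.span_scale simp del: tensor_single\<close>)
qed

text \<open>The ideal generated by all \<open>x_i x_j\<close>, described by word lengths so that
  membership is a condition on the support; \<open>genideal_var_mult\<close> proves that the
  descriptions agree.\<close>

definition decomposables :: "('g, 'k) skew set" where
  "decomposables = {f \<in> carrier \<H>. \<forall>(a, u) \<in> keys f. 2 \<le> length u}"

lemma mul_expand: "f \<star> h = lin_ext (\<lambda>b. single b 1 \<star> h) f"
  "f \<star> h = lin_ext (\<lambda>b. f \<star> single b 1) h"
  by (rule klin_eqI[where B = UNIV and F = "\<lambda>f. f \<star> h"];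
      auto intro!: klin_intros)
    (rule klin_eqI[where B = UNIV and F = "\<lambda>h. f \<star> h"];
      auto intro!: klin_intros)

lemma keys_mul:
  assumes "p \<in> keys (f \<star> h)"
  obtains a u b v where "(a, u) \<in> keys f" "(b, v) \<in> keys h" "p = (a \<otimes> b, u @ v)"
proof -
  let ?B = "{(a \<otimes> b, u @ v) | a u b v. (a, u) \<in> keys f \<and> (b, v) \<in> keys h}"
  have "keys (f \<star> h) \<subseteq> ?B"
    unfolding skew_algebra_def twisted_algebra_def monoid.simps
  proof (intro keys_lin_ext_subset)
    fix b b' assume *: "b \<in> keys f" "b' \<in> keys h"
    have "basis_mult b b' \<in> ?B"
      using * unfolding basis_mult_def by (cases b; cases b') force
    then show "keys (single (basis_mult b b') (basis_coeff b b')) \<subseteq> ?B" by simp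
  qed
  then show thesis using assms that by blast
qed

lemma ideal_decomposables: "ideal decomposables \<H>"
proof (rule ideal_skewI)
  have "decomposables = carrier \<H> \<inter> {f. \<forall>p\<in>keys f. 2 \<le> length (snd p)}"
    by (auto simp: decomposables_def)
  then show "pm.subspace decomposables"
    using pm.subspace_inter[OF subspace_carrier subspace_keys] by simp
qed (fastforce simp: decomposables_def elim!: keys_mul)+

lemma counit_decomposables: "f \<in> decomposables \<Longrightarrow> counit f = 0"
  unfolding counit_def decomposables_def by (intro sum.neutral) fastforce

lemma ad_word_one: "u \<in> letters \<Longrightarrow> u \<noteq> [] \<Longrightarrow> ad_word u (scalar 1) = 0"
proof (induction u)
  case (Cons i u)
  have "ad_var i (scalar 1) = 0"
    using Cons.prems by (simp add: ad_var_eq mul_linear)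
  then show ?case by (simp add: ad_word_linear)
qed simp

lemma ad_r_tensor:
  assumes "a \<in> carrier \<H>" "b \<in> carrier \<H>" "f \<in> carrier \<H>"
  shows "lin_ext (\<lambda>(p, p'). antipode (single p 1) \<star> f \<star> single p' 1) (tensor a b) =
    antipode a \<star> f \<star> b"
  unfolding lin_ext_tensor
proof (rule skew_eqI[where f = a and F' = "\<lambda>a. antipode a \<star> f \<star> b"])
  fix c u assume "c \<in> carrier G" "u \<in> letters"
  then show "lin_ext (\<lambda>p. lin_ext (\<lambda>p'. case (p, p') of (p, p') \<Rightarrow>
      antipode (single p 1) \<star> f \<star> single p' 1) b) (sgl c u) = antipode (sgl c u) \<star> f \<star> b"
    using assms by (simp add: mul_expand(2)[of "antipode (sgl c u) \<star> f" b])
qed (use assms in \<open>auto intro!: klin_intros\<close>)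

text \<open>The identity \<open>\<Sum> \<sigma>(x\<^sup>(\<^sup>1\<^sup>)) x\<^sup>(\<^sup>2\<^sup>) = \<epsilon>(x) = 0\<close>, read off from the adjoint action on \<open>1\<close>.\<close>

lemma antipode_skew_primitive:
  assumes x: "x \<in> decomposables" and a: "a \<in> carrier G"
    and c: "comult x = tensor x (scalar 1) + tensor (grp a) x"
  shows "antipode x = - (grp (inv a) \<star> x)"
proof -
  have xc: "x \<in> carrier \<H>" using x by (simp add: decomposables_def)
  have "ad_r x (scalar 1) = antipode x + antipode (grp a) \<star> x"
    using xc a by (simp add: ad_r_def c lin_ext_simps ad_r_tensor)
  moreover have "ad_r x (scalar 1) \<in> {0}"
  proof (rule skew_map_subspace[OF klin_ad_r pm.subspace_single_0 xc])
    fix b u assume b: "(b, u) \<in> keys x" "b \<in> carrier G" "u \<in> letters"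
    then have "u \<noteq> []" using x by (auto simp: decomposables_def)
    then show "ad_r (sgl b u) (scalar 1) \<in> {0}"
      using b ad_word_one[of u] by (simp add: ad_r_single) (simp add: scalar_def conjugate_single)
  qed
  ultimately show ?thesis using a by (simp add: antipode_Nil grp_def eq_neg_iff_add_eq_0)
qed

text \<open>As \<open>comult\<close> is multiplicative and \<open>antipode\<close>
  antimultiplicative, the elements that they send to \<open>tensor_ideal ?I\<close>, respectively to
  \<open>?I\<close>, form ideals, and these only have to contain the generators. Skew primitivity
  gives this for \<open>comult\<close> directly and for \<open>antipode\<close> through
  \<open>antipode_skew_primitive\<close>; the counit vanishes on
  \<open>decomposables\<close>.\<close>

lemma hopf_ideal_genideal:
  assumes X: "X \<subseteq> decomposables"
    and prim: "\<And>x. x \<in> X \<Longrightarrow> \<exists>a\<in>carrier G. comult x = tensor x (scalar 1) + tensor (grp a) x"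
  shows "hopf_ideal (genideal \<H> X)" "genideal \<H> X \<subseteq> decomposables"
proof -
  let ?I = "genideal \<H> X"
  have Xc: "X \<subseteq> carrier \<H>" using X by (auto simp: decomposables_def)
  have I: "ideal ?I \<H>" by (rule H.genideal_ideal[OF Xc])
  have XI: "X \<subseteq> ?I" by (rule H.genideal_self[OF Xc])
  show dec: "?I \<subseteq> decomposables" by (rule H.genideal_minimal[OF ideal_decomposables X])
  have "ideal {f \<in> carrier \<H>. comult f \<in> tensor_ideal ?I} \<H>"
    by (rule ideal_skewI) (use tensor_ideal_ideal[OF I] in
        \<open>auto intro!: subspace_vimage klin_comult pm.subspace_span simp: comult_mult\<close>)
  moreover have "X \<subseteq> {f \<in> carrier \<H>. comult f \<in> tensor_ideal ?I}"
  proof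
    fix x assume x: "x \<in> X"
    then obtain a where a: "a \<in> carrier G" "comult x = tensor x (scalar 1) + tensor (grp a) x"
      using prim by blast
    have "x \<in> carrier \<H>" "x \<in> ?I" using x Xc XI by auto
    then show "x \<in> {f \<in> carrier \<H>. comult f \<in> tensor_ideal ?I}"
      using a(1) unfolding mem_Collect_eq a(2) by (intro conjI pm.span_add tensor_idealI) auto
  qed
  ultimately have 1: "?I \<subseteq> {f \<in> carrier \<H>. comult f \<in> tensor_ideal ?I}"
    by (rule H.genideal_minimal)
  have "ideal {f \<in> carrier \<H>. antipode f \<in> ?I} \<H>"
    by (rule ideal_skewI) (use ideal_skewD[OF I] in
        \<open>auto intro!: subspace_vimage[OF klin_antipode subspace_ideal[OF I]] simp: antipode_mult\<close>)
  moreover have "X \<subseteq> {f \<in> carrier \<H>. antipode f \<in> ?I}"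
  proof
    fix x assume x: "x \<in> X"
    then obtain a where a: "a \<in> carrier G" "comult x = tensor x (scalar 1) + tensor (grp a) x"
      using prim by blast
    have "antipode x = - (grp (inv a) \<star> x)" using antipode_skew_primitive[OF _ a] x X by auto
    moreover have "- (grp (inv a) \<star> x) \<in> ?I"
      using x XI a(1) by (intro ideal_neg[OF I] ideal_skewD(4)[OF I]) auto
    ultimately show "x \<in> {f \<in> carrier \<H>. antipode f \<in> ?I}" using x Xc by auto
  qed
  ultimately have 2: "?I \<subseteq> {f \<in> carrier \<H>. antipode f \<in> ?I}"
    by (rule H.genideal_minimal)
  show "hopf_ideal ?I"
    unfolding hopf_ideal_alt using I 1 2 dec counit_decomposables by auto
qed

lemma genideal_var_mult:
  "genideal \<H> {var i \<star> var j | i j. i \<in> {1..n} \<and> j \<in> {1..n}} = decomposables" (is "genideal \<H> ?X = _")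
proof
  have X: "?X \<subseteq> decomposables"
    by (auto simp: decomposables_def word_def chi_one)
  show "genideal \<H> ?X \<subseteq> decomposables"
    by (rule H.genideal_minimal[OF ideal_decomposables X])
  have I: "ideal (genideal \<H> ?X) \<H>"
    using X by (intro H.genideal_ideal) (auto simp: decomposables_def)
  show "decomposables \<subseteq> genideal \<H> ?X"
  proof
    fix f assume f: "f \<in> decomposables"
    have *: "single b 1 \<in> genideal \<H> ?X" if key: "b \<in> keys f" for b
    proof -
      obtain a i j u where b: "b = (a, i # j # u)" "a \<in> carrier G" "i \<in> {1..n}" "j \<in> {1..n}" "u \<in> letters"
      proof -
        obtain a w where aw: "b = (a, w)" by (cases b)
        then have "2 \<le> length w" "a \<in> carrier G" "w \<in> letters"
          using key f keysD[of a w f] by (auto simp: decomposables_def)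
        moreover then obtain i j u where "w = i # j # u"
          by (cases w; cases "tl w") auto
        ultimately show thesis using aw that[of a i j u] by auto
      qed
      have "var i \<star> var j \<in> genideal \<H> ?X"
        using b by (intro subsetD[OF H.genideal_self[of ?X]]) auto
      then have "grp a \<star> (var i \<star> var j) \<star> word u \<in> genideal \<H> ?X"
        using b by (intro ideal_skewD(5)[OF I ideal_skewD(4)[OF I]]) auto
      then show ?thesis using b by (simp add: grp_def word_def chi_one chi_word_one)
    qed
    have "lin_ext (\<lambda>b. single b 1) f \<in> genideal \<H> ?X"
      by (rule klin_subspace_induct[where P = "\<lambda>f. f \<in> genideal \<H> ?X"])
        (simp_all only: * ideal_skewD(2,3)[OF I] ideal_scale[OF I])
    then show "f \<in> genideal \<H> ?X" by (simp add: lin_ext_single_self)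
  qed
qed

lemma tensor_ideal_mono: "I \<subseteq> J \<Longrightarrow> tensor_ideal I \<subseteq> tensor_ideal J"
  by (rule pm.span_mono) auto

text \<open>\<open>GREATEST\<close> is meaningful only once a greatest candidate exists. It is the
  sum of all candidates, since being an ideal, the coideal condition and stability under the
  antipode all pass to sums.\<close>

lemma Lambda_ideal:
  "hopf_ideal Lambda_ideal" "Lambda_ideal \<subseteq> decomposables"
  "hopf_ideal J \<Longrightarrow> J \<subseteq> decomposables \<Longrightarrow> J \<subseteq> Lambda_ideal"
proof -
  define F where "F = {I. hopf_ideal I \<and> I \<subseteq> decomposables}"
  define L where "L = pm.span (\<Union>F)"
  have sub: "I \<subseteq> L" if "I \<in> F" for I
    using that pm.span_superset[of "\<Union>F"] unfolding L_def by auto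
  have idF: "ideal I \<H>" if "I \<in> F" for I using that by (auto simp: F_def hopf_ideal_alt)
  have subL: "pm.subspace L" unfolding L_def by (rule pm.subspace_span)
  \<comment> \<open>Each property to be checked says that a linear map sends \<open>L\<close> into a
    subspace, so it can be tested on the candidates.\<close>
  have LA: "H f \<in> A" if "klin H" "pm.subspace A" "f \<in> L" "\<And>I f. I \<in> F \<Longrightarrow> f \<in> I \<Longrightarrow> H f \<in> A"
    for H :: "('g, 'k) skew \<Rightarrow> ('z \<Rightarrow>\<^sub>0 'k)" and A f
    by (rule klin_span[OF that(1,2), of f "\<Union>F"]) (use that in \<open>auto simp: L_def\<close>)
  have Ldec: "L \<subseteq> decomposables"
  proof
    fix f assume "f \<in> L"
    then show "f \<in> decomposables"
      by (rule LA[OF klin_id subspace_ideal[OF ideal_decomposables]]) (auto simp: F_def)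
  qed
  have "ideal L \<H>"
  proof (rule ideal_skewI)
    show "L \<subseteq> carrier \<H>" using Ldec by (auto simp: decomposables_def)
    fix f h assume f: "f \<in> L" and h: "h \<in> carrier \<H>"
    show "h \<star> f \<in> L"
      by (rule LA[OF _ subL f]) (use h in \<open>auto intro!: klin_intros intro: subsetD[OF sub] ideal_skewD(4)[OF idF]\<close>)
    show "f \<star> h \<in> L"
      by (rule LA[OF _ subL f]) (use h in \<open>auto intro!: klin_intros intro: subsetD[OF sub] ideal_skewD(5)[OF idF]\<close>)
  qed (rule subL)
  moreover have "comult f \<in> tensor_ideal L" if "f \<in> L" for f
    by (rule LA[OF klin_comult pm.subspace_span that])
      (use tensor_ideal_mono[OF sub] in \<open>auto simp: F_def hopf_ideal_alt\<close>)
  moreover have "antipode f \<in> L" if "f \<in> L" for f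
    by (rule LA[OF klin_antipode subL that]) (auto simp: F_def hopf_ideal_alt intro: subsetD[OF sub[unfolded F_def hopf_ideal_alt]])
  ultimately have L: "hopf_ideal L"
    unfolding hopf_ideal_alt using Ldec counit_decomposables by auto
  have "Lambda_ideal = L"
    unfolding Lambda_ideal_def genideal_var_mult
    by (rule Greatest_equality) (use L Ldec sub in \<open>auto simp: F_def\<close>)
  then show "hopf_ideal Lambda_ideal" "Lambda_ideal \<subseteq> decomposables"
    "hopf_ideal J \<Longrightarrow> J \<subseteq> decomposables \<Longrightarrow> J \<subseteq> Lambda_ideal"
    using L Ldec sub by (auto simp: F_def)
qed

section \<open>Homogeneous elements\<close>

lemma chi_word_mset: "mset u = mset v \<Longrightarrow> chi_word u h = chi_word v h"
  unfolding chi_word_def by (metis mset_map prod_mset_prod_list)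

lemma letters_mset: "mset u = mset v \<Longrightarrow> u \<in> letters \<longleftrightarrow> v \<in> letters"
  by (metis in_lists_conv_set set_mset_mset)

lemma g_word_mset: "mset u = mset v \<Longrightarrow> u \<in> letters \<Longrightarrow> g_word u = g_word v"
proof (induction u arbitrary: v)
  case (Cons i u)
  then have "i \<in> set v" by (metis list.set_intros(1) set_mset_mset)
  then obtain v1 v2 where v: "v = v1 @ i # v2" by (meson split_list)
  have vl: "v \<in> letters" using Cons.prems letters_mset by blast
  have "mset u = mset (v1 @ v2)" using Cons.prems v by simp
  then have "g_word u = g_word (v1 @ v2)" using Cons by simp
  then show ?case using v vl by (simp add: g_word_append g_word_simps m_lcomm)
qed simp

text \<open>The group component is fixed along with the multidegree; \<open>w\<close> only
  represents the latter, and rearranging it gives the same set. On this set conjugation is a scalar,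
  and the scalar in \<open>bracket\<close> is constant.\<close>

definition homog :: "'g \<Rightarrow> nat list \<Rightarrow> ('g, 'k) skew set" where
  "homog a w = {f \<in> carrier \<H>. \<forall>p\<in>keys f. fst p = a \<and> mset (snd p) = mset w}"

lemma homog_carrier: "f \<in> homog a w \<Longrightarrow> f \<in> carrier \<H>"
  by (simp add: homog_def)

lemma subspace_homog: "pm.subspace (homog a w)"
proof -
  have "homog a w = carrier \<H> \<inter> {f. \<forall>p\<in>keys f. fst p = a \<and> mset (snd p) = mset w}"
    by (auto simp: homog_def)
  then show ?thesis using pm.subspace_inter[OF subspace_carrier subspace_keys] by simp
qed

lemmas homog_diff = pm.subspace_diff[OF subspace_homog]
lemmas homog_scale = pm.subspace_scale[OF subspace_homog]

lemma homog_cong: "mset u = mset w \<Longrightarrow> f \<in> homog a u \<Longrightarrow> f \<in> homog a w"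
  by (simp add: homog_def)

lemma homog_single: "a \<in> carrier G \<Longrightarrow> u \<in> letters \<Longrightarrow> single (a, u) c \<in> homog a u"
  by (auto simp: homog_def)

text \<open>The additional equations in the last premise let \<open>u\<close> be replaced by
  \<open>w\<close> wherever only characters or group elements are evaluated.\<close>

lemma homog_eqI:
  assumes "klin F" "klin F'" "f \<in> homog a w"
    and "\<And>u. a \<in> carrier G \<Longrightarrow> u \<in> letters \<Longrightarrow> mset u = mset w \<Longrightarrow>
      chi_word u = chi_word w \<Longrightarrow> g_word u = g_word w \<Longrightarrow> F (sgl a u) = F' (sgl a u)"
  shows "F f = F' f"
proof (rule klin_eqI[OF assms(1,2)])
  show "keys f \<subseteq> {(a, u) | u. a \<in> carrier G \<and> u \<in> letters \<and> mset u = mset w}"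
  proof
    fix p assume "p \<in> keys f"
    then show "p \<in> {(a, u) | u. a \<in> carrier G \<and> u \<in> letters \<and> mset u = mset w}"
      using assms(3) keysD[of "fst p" "snd p" f] by (cases p) (auto simp: homog_def)
  qed
next
  fix b assume "b \<in> {(a, u) | u. a \<in> carrier G \<and> u \<in> letters \<and> mset u = mset w}"
  then obtain u where u: "b = (a, u)" "a \<in> carrier G" "u \<in> letters" "mset u = mset w" by blast
  show "F (single b 1) = F' (single b 1)"
    unfolding u(1) using u chi_word_mset[OF u(4)] g_word_mset[OF u(4,3)] by (intro assms(4)) auto
qed

lemma homog_mult:
  assumes "f \<in> homog a u" "h \<in> homog b v"
  shows "f \<star> h \<in> homog (a \<otimes> b) (u @ v)"
  using assms unfolding homog_def by (fastforce elim!: keys_mul)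

lemma homog_grp_mult:
  assumes "f \<in> homog b u" "a \<in> carrier G"
  shows "grp a \<star> f \<in> homog (a \<otimes> b) u"
  using homog_mult[OF homog_single[of a "[]" 1] assms(1)] assms(2) by (simp add: grp_def)

lemma conjugate_homog:
  assumes "f \<in> homog a w" "b \<in> carrier G"
  shows "conjugate b f = scale_pm (chi_word w b) f"
  by (rule homog_eqI[OF _ _ assms(1), where F = "conjugate b" and F' = "scale_pm (chi_word w b)"])
    (use assms(2) in \<open>auto intro!: klin_intros klin_scale[OF klin_id] klin_conj[OF klin_id]
      simp: conjugate_single\<close>)

lemma homog_mult_grp:
  assumes "f \<in> homog a w" "b \<in> carrier G"
  shows "f \<star> grp b = scale_pm (chi_word w b) (grp b \<star> f)"
  by (rule homog_eqI[OF _ _ assms(1), where F = "\<lambda>f. f \<star> grp b" and F' = "\<lambda>f. scale_pm (chi_word w b) (grp b \<star> f)"])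
    (use assms(2) in \<open>auto intro!: klin_intros simp: grp_def m_comm\<close>)

lemma bracket_homog:
  assumes f: "f \<in> homog \<one> v" and h: "h \<in> homog \<one> w"
  shows "bracket f h = f \<star> h - scale_pm (chi_word v (g_word w)) (h \<star> f)"
proof (rule homog_eqI[OF _ _ f, where F = "\<lambda>f. bracket f h" and F' = "\<lambda>f. f \<star> h - scale_pm (chi_word v (g_word w)) (h \<star> f)"])
  fix u assume u: "u \<in> letters" "chi_word u = chi_word v"
  show "bracket (sgl \<one> u) h = sgl \<one> u \<star> h - scale_pm (chi_word v (g_word w)) (h \<star> sgl \<one> u)"
    by (rule homog_eqI[OF _ _ h, where F = "\<lambda>h. bracket (sgl \<one> u) h"
          and F' = "\<lambda>h. sgl \<one> u \<star> h - scale_pm (chi_word v (g_word w)) (h \<star> sgl \<one> u)"])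
      (use u in \<open>auto intro!: klin_intros simp: bracket_def\<close>)
qed (auto intro!: klin_intros simp: bracket_def)

lemma bracket_in_homog:
  assumes f: "f \<in> homog \<one> v" and h: "h \<in> homog \<one> w"
  shows "bracket f h \<in> homog \<one> (v @ w)"
  unfolding bracket_homog[OF assms]
  using homog_mult[OF f h] homog_cong[OF _ homog_mult[OF h f], of "v @ w"]
  by (intro homog_diff homog_scale) auto

lemma var_homog [simp]: "i \<in> {1..n} \<Longrightarrow> var i \<in> homog \<one> [i]"
  unfolding word_def by (rule homog_single) auto

lemma gr_var_homog: "i \<in> {1..n} \<Longrightarrow> gr_var i \<in> homog (inv (g i)) [i]"
  unfolding gr_var_eq using homog_single[of "inv (g i) \<otimes> \<one>" "[i]" 1] by simp

lemma ad_var_homog: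
  assumes "f \<in> homog a w" "i \<in> {1..n}" "a \<in> carrier G"
  shows "ad_var i f \<in> homog (inv (g i) \<otimes> a) (i # w)"
proof -
  have "f \<star> gr_var i \<in> homog (inv (g i) \<otimes> a) (i # w)"
    using homog_cong[where w = "i # w", OF _ homog_mult[OF assms(1) gr_var_homog[OF assms(2)]]] assms by (simp add: m_comm)
  moreover have "gr_var i \<star> f \<in> homog (inv (g i) \<otimes> a) (i # w)"
    using homog_mult[OF gr_var_homog[OF assms(2)] assms(1)] by simp
  ultimately show ?thesis
    using assms unfolding ad_var_def by (simp add: conjugate_homog mul_linear homog_diff homog_scale)
qed

lemma ad_word_homog:
  assumes "f \<in> homog a w" "u \<in> letters" "a \<in> carrier G"
  shows "\<exists>b\<in>carrier G. ad_word u f \<in> homog b (u @ w)"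
  using assms
proof (induction u arbitrary: f a w)
  case (Cons i u)
  then have i: "i \<in> {1..n}" "u \<in> letters" by auto
  obtain b where b: "b \<in> carrier G" "ad_word u (ad_var i f) \<in> homog b (u @ i # w)"
    using Cons.IH[OF ad_var_homog[OF Cons.prems(1) i(1) Cons.prems(3)] i(2)] i(1) Cons.prems(3) by auto
  have "ad_word u (ad_var i f) \<in> homog b ((i # u) @ w)"
    by (rule homog_cong[OF _ b(2)]) simp
  then show ?case using b(1) by (intro bexI[of _ b]) simp_all
qed auto

text \<open>Moving \<open>x_i\<close> past the group element in front of \<open>P\<close> costs
  \<open>inverse (\<chi> i (g_word w))\<close>. Once this is factored out,
  \<open>P x_i - x_i P\<close> turns into the negative of the bracket.\<close>

lemma homog_scalar_ad_var:
  assumes P: "P \<in> homog \<one> w" and w: "w \<in> letters" and i: "i \<in> {1..n}"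
  shows "ad_var i (grp (inv (g_word w)) \<star> P) =
    scale_pm (- inverse (\<chi> i (g_word w))) (grp (inv (g_word (i # w))) \<star> bracket (var i) P)"
proof -
  let ?\<gamma> = "grp (inv (g_word w))"
  have Pc: "P \<in> carrier \<H>" using P by (rule homog_carrier)
  have c: "\<chi> i (g_word w) \<noteq> 0" using chi_simps(1) w i by simp
  have x: "var i \<star> ?\<gamma> = scale_pm (inverse (\<chi> i (g_word w))) (?\<gamma> \<star> var i)"
    using homog_mult_grp[OF var_homog[OF i], of "inv (g_word w)"] w i by (simp add: chi_inv)
  have gg: "grp (inv (g_word (i # w))) = grp (inv (g i)) \<star> ?\<gamma>"
    using w i by (simp add: grp_def g_word_simps inv_mult)
  have "var i \<star> (?\<gamma> \<star> P) = scale_pm (inverse (\<chi> i (g_word w))) (?\<gamma> \<star> (var i \<star> P))"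
    using x w i Pc by (simp add: mul_linear H.m_assoc flip: H.m_assoc[of "var i" ?\<gamma> P])
  then show ?thesis
    using w i Pc c by (simp add: ad_var_eq bracket_homog[OF var_homog[OF i] P] gg mul_linear H.m_assoc
        pm.scale_right_diff_distrib)
qed

end

section \<open>Subalgebras of the quotient\<close>

locale skew_hopf_quotient = skew_hopf_algebra n G g \<chi>
  for n :: nat and G :: "('g, 'm) monoid_scheme" (structure) and g :: "nat \<Rightarrow> 'g"
    and \<chi> :: "nat \<Rightarrow> 'g \<Rightarrow> 'k::field" +
  fixes I :: "('g, 'k) skew set"
  assumes hopf: "hopf_ideal I" and I_dec: "I \<subseteq> decomposables"
begin

lemma I_ideal: "ideal I \<H>"
  and I_comult: "f \<in> I \<Longrightarrow> comult f \<in> tensor_ideal I"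
  and I_antipode: "f \<in> I \<Longrightarrow> antipode f \<in> I"
  using hopf unfolding hopf_ideal_alt by blast+

lemmas I_carrier = ideal_skewD(1)[OF I_ideal]
lemmas I_zero = ideal_skewD(2)[OF I_ideal]
lemmas I_add = ideal_skewD(3)[OF I_ideal]
lemmas I_mult_left = ideal_skewD(4)[OF I_ideal]
lemmas I_mult_right = ideal_skewD(5)[OF I_ideal]
lemmas I_scale = ideal_scale[OF I_ideal]
lemmas I_neg = ideal_neg[OF I_ideal]
lemmas I_diff = ideal_diff[OF I_ideal]

lemma I_conj: "f \<in> I \<Longrightarrow> b \<in> carrier G \<Longrightarrow> conjugate b f \<in> I"
  by (simp add: conjugate_def I_mult_left I_mult_right)

lemma I_ad_var: "f \<in> I \<Longrightarrow> i \<in> {1..n} \<Longrightarrow> ad_var i f \<in> I"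
  by (simp add: ad_var_def I_mult_left I_mult_right I_conj I_diff)

lemma I_ad_word: "f \<in> I \<Longrightarrow> u \<in> letters \<Longrightarrow> ad_word u f \<in> I"
  by (induction u arbitrary: f) (simp_all add: I_ad_var)

lemma ad_r_I_right:
  assumes "f \<in> I" "a \<in> carrier \<H>"
  shows "ad_r a f \<in> I"
  by (rule skew_map_subspace[OF klin_ad_r subspace_ideal[OF I_ideal] assms(2)])
    (simp add: ad_r_single I_carrier assms(1) I_ad_word I_conj)

text \<open>By the coideal property \<open>comult f\<close> is a combination of pure tensors with
  one factor in \<open>I\<close>, and each contributes
  \<open>antipode a \<star> h \<star> b\<close>. This makes the action on the quotient well defined,
  and it turns every relation in \<open>I\<close> into a relation between the operators
  \<open>ad_var\<close>.\<close>

lemma ad_r_I_left: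
  assumes f: "f \<in> I" and h: "h \<in> carrier \<H>"
  shows "ad_r f h \<in> I"
  unfolding ad_r_def
proof (rule tensor_ideal_map[OF klin_lin_ext subspace_ideal[OF I_ideal]])
  show "comult f \<in> tensor_ideal I" using f by (rule I_comult)
  fix a b assume ab: "a \<in> carrier \<H>" "b \<in> carrier \<H>" "a \<in> I \<or> b \<in> I"
  have "antipode a \<in> I" if "a \<in> I" using that by (rule I_antipode)
  then show "lin_ext (\<lambda>(p, p'). antipode (single p 1) \<star> h \<star> single p' 1) (tensor a b) \<in> I"
    using ab h unfolding ad_r_tensor[OF ab(1,2) h] by (auto intro: I_mult_left I_mult_right)
qed

lemma proj_hom: "ring_hom_ring \<H> (quotient I) (proj I)"
proof -
  have "proj I = (+>\<^bsub>\<H>\<^esub>) I" by (auto simp: proj_def)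
  then show ?thesis unfolding quotient_def using ideal.rcos_ring_hom_ring[OF I_ideal] by simp
qed

lemma carrier_quotient: "carrier (quotient I) = proj I ` carrier \<H>"
  by (auto simp: quotient_def FactRing_def A_RCOSETS_def' proj_def)

lemma proj_mem: "f \<in> carrier \<H> \<Longrightarrow> h \<in> proj I f \<longleftrightarrow> h \<in> carrier \<H> \<and> h - f \<in> I"
proof -
  assume f: "f \<in> carrier \<H>"
  have "proj I f = {i + f | i. i \<in> I}" by (auto simp: proj_def a_r_coset_def')
  then show ?thesis using f I_carrier by (auto intro: exI[of _ "h - f"])
qed

lemma proj_eq_iff: "f \<in> carrier \<H> \<Longrightarrow> h \<in> carrier \<H> \<Longrightarrow> proj I f = proj I h \<longleftrightarrow> f - h \<in> I"
proof
  assume f: "f \<in> carrier \<H>" and h: "h \<in> carrier \<H>"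
  show "f - h \<in> I" if "proj I f = proj I h"
    using proj_mem[OF h, of f] proj_mem[OF f, of f] f I_zero that by simp
  assume fh: "f - h \<in> I"
  have "l - f \<in> I \<longleftrightarrow> l - h \<in> I" for l
    using I_add[OF _ fh, of "l - f"] I_diff[OF _ fh, of "l - h"] by auto
  then show "proj I f = proj I h" using proj_mem f h by blast
qed

lemma ad_r_quotient_proj:
  assumes a: "a \<in> carrier \<H>" and b: "b \<in> carrier \<H>"
  shows "ad_r_quotient I (proj I a) (proj I b) = proj I (ad_r a b)"
proof -
  have "proj I (ad_r a' b') = proj I (ad_r a b)" if "a' \<in> proj I a" "b' \<in> proj I b" for a' b'
  proof -
    have a': "a' \<in> carrier \<H>" "a' - a \<in> I" and b': "b' \<in> carrier \<H>" "b' - b \<in> I"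
      using that a b by (auto simp: proj_mem)
    have "ad_r a' b' - ad_r a b = ad_r (a' - a) b' + ad_r a (b' - b)"
      by (simp add: klin_simps[OF klin_ad_r] klin_simps[OF klin_ad_r2])
    then have "ad_r a' b' - ad_r a b \<in> I"
      using I_add[OF ad_r_I_left[OF a'(2) b'(1)] ad_r_I_right[OF b'(2) a]] by simp
    then show ?thesis using proj_eq_iff ad_r_closed a b a' b' by simp
  qed
  moreover have "a \<in> proj I a" "b \<in> proj I b" using a b I_zero by (simp_all add: proj_mem)
  ultimately show ?thesis unfolding ad_r_quotient_def by blast
qed

section \<open>Generated subalgebras, lifted to \<open>G\<langle>X\<rangle>\<close>\<close>

definition alg :: "('g, 'k) skew set \<Rightarrow> ('g, 'k) skew set" where
  "alg S = generate_ring \<H> (range scalar \<union> S)"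

text \<open>Elements of the quotient are replaced by their representatives in \<open>G\<langle>X\<rangle>\<close>: this is the preimage of
  the subalgebra of the quotient generated by the cosets of \<open>S\<close>.\<close>

definition Alg :: "('g, 'k) skew set \<Rightarrow> ('g, 'k) skew set" where
  "Alg S = {f \<in> carrier \<H>. \<exists>h\<in>alg S. f - h \<in> I}"

lemma alg_carrier: "S \<subseteq> carrier \<H> \<Longrightarrow> alg S \<subseteq> carrier \<H>"
  unfolding alg_def by (rule H.generate_ring_incl) auto

lemma alg_closed:
  assumes S: "S \<subseteq> carrier \<H>"
  shows "scalar c \<in> alg S" "s \<in> S \<Longrightarrow> s \<in> alg S"
    "f \<in> alg S \<Longrightarrow> h \<in> alg S \<Longrightarrow> f + h \<in> alg S" "f \<in> alg S \<Longrightarrow> h \<in> alg S \<Longrightarrow> f \<star> h \<in> alg S"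
    "f \<in> alg S \<Longrightarrow> - f \<in> alg S" "f \<in> alg S \<Longrightarrow> scale_pm c f \<in> alg S"
proof -
  show *: "scalar c \<in> alg S" for c unfolding alg_def by (intro generate_ring.incl) auto
  show "s \<in> S \<Longrightarrow> s \<in> alg S" unfolding alg_def by (intro generate_ring.incl) auto
  show "f \<in> alg S \<Longrightarrow> h \<in> alg S \<Longrightarrow> f + h \<in> alg S"
    using generate_ring.eng_add[of f \<H> _ h] unfolding alg_def by simp
  show m: "f \<in> alg S \<Longrightarrow> h \<in> alg S \<Longrightarrow> f \<star> h \<in> alg S" for f h
    using generate_ring.eng_mult[of f \<H> _ h] unfolding alg_def by simp
  show "f \<in> alg S \<Longrightarrow> scale_pm c f \<in> alg S" for c
    using m[OF *[of c], of f] alg_carrier[OF S] by auto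
  from this[of "- 1"] show "f \<in> alg S \<Longrightarrow> - f \<in> alg S" by simp
qed

text \<open>The cases of the unit and of additive inverses are absorbed by the scalars.\<close>

lemma alg_induct [consumes 2, case_names scalar gen add mult]:
  assumes f: "f \<in> alg S" and S: "S \<subseteq> carrier \<H>"
    and scalar: "\<And>c. P (scalar c)" and gen: "\<And>s. s \<in> S \<Longrightarrow> P s"
    and add: "\<And>f h. f \<in> alg S \<Longrightarrow> h \<in> alg S \<Longrightarrow> P f \<Longrightarrow> P h \<Longrightarrow> P (f + h)"
    and mult: "\<And>f h. f \<in> alg S \<Longrightarrow> h \<in> alg S \<Longrightarrow> P f \<Longrightarrow> P h \<Longrightarrow> P (f \<star> h)"
  shows "P f"
  using f unfolding alg_def
proof (induction rule: generate_ring.induct)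
  case one
  then show ?case using scalar[of 1] by (simp add: one_skew scalar_def)
next
  case (a_inv h)
  then have h: "h \<in> alg S" "h \<in> carrier \<H>" using alg_carrier[OF S] by (auto simp: alg_def)
  then have "\<ominus>\<^bsub>\<H>\<^esub> h = scalar (- 1) \<star> h" by (simp add: uminus_skew)
  then show ?case using mult[OF alg_closed(1)[OF S] h(1) scalar[of "- 1"] a_inv.IH] by simp
next
  case (eng_add h1 h2)
  then show ?case using add[of h1 h2] by (simp add: alg_def)
next
  case (eng_mult h1 h2)
  then show ?case using mult[of h1 h2] by (simp add: alg_def)
qed (use scalar gen in auto)

lemma subalgebra_gen_proj:
  assumes S: "S \<subseteq> carrier \<H>"
  shows "subalgebra_gen I (proj I ` S) = proj I ` alg S"
proof -
  interpret P: ring_hom_ring \<H> "quotient I" "proj I" by (rule proj_hom)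
  let ?X = "range scalar \<union> S"
  have gen: "subalgebra_gen I (proj I ` S) = generate_ring (quotient I) (proj I ` ?X)"
    unfolding subalgebra_gen_def by (simp add: image_Un image_image)
  have X: "?X \<subseteq> carrier \<H>" using S by auto
  have c: "f \<in> alg S \<Longrightarrow> f \<in> carrier \<H>" for f using alg_carrier[OF S] by blast
  have "proj I h \<in> generate_ring (quotient I) (proj I ` ?X)" if "h \<in> alg S" for h
    using that S
  proof (induction rule: alg_induct)
    case (add f h)
    then show ?case using generate_ring.eng_add[OF add.IH] P.hom_add[of f h] c by simp
  next
    case (mult f h)
    then show ?case using generate_ring.eng_mult[OF mult.IH] c by simp
  qed (auto intro: generate_ring.incl)
  moreover have "generate_ring (quotient I) (proj I ` ?X) \<subseteq> proj I ` alg S"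
    unfolding alg_def
    by (rule P.S.generate_ring_min_subring1)
      (use X H.generate_ring_is_subring[OF X] in \<open>auto intro: P.img_is_subring generate_ring.incl\<close>)
  ultimately show ?thesis unfolding gen by auto
qed

lemma
  assumes S: "S \<subseteq> carrier \<H>"
  shows Alg_carrier: "f \<in> Alg S \<Longrightarrow> f \<in> carrier \<H>"
    and Alg_alg: "f \<in> alg S \<Longrightarrow> f \<in> Alg S"
    and Alg_gen: "s \<in> S \<Longrightarrow> s \<in> Alg S"
    and Alg_I: "f \<in> I \<Longrightarrow> f \<in> Alg S"
    and Alg_add: "f \<in> Alg S \<Longrightarrow> h \<in> Alg S \<Longrightarrow> f + h \<in> Alg S"
    and Alg_scale: "f \<in> Alg S \<Longrightarrow> scale_pm c f \<in> Alg S"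
    and Alg_diff: "f \<in> Alg S \<Longrightarrow> h \<in> Alg S \<Longrightarrow> f - h \<in> Alg S"
    and Alg_mult: "f \<in> Alg S \<Longrightarrow> h \<in> Alg S \<Longrightarrow> f \<star> h \<in> Alg S"
    and Alg_cong: "f - h \<in> I \<Longrightarrow> h \<in> Alg S \<Longrightarrow> f \<in> Alg S"
proof -
  show c: "f \<in> Alg S \<Longrightarrow> f \<in> carrier \<H>" for f by (simp add: Alg_def)
  show a: "f \<in> alg S \<Longrightarrow> f \<in> Alg S" for f
    using alg_carrier[OF S] I_zero by (auto simp: Alg_def intro!: bexI[of _ f])
  show "s \<in> S \<Longrightarrow> s \<in> Alg S" using a alg_closed(2)[OF S] by blast
  have z: "0 \<in> alg S" using alg_closed(1)[OF S, of 0] by (simp add: scalar_def)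
  show i: "f \<in> I \<Longrightarrow> f \<in> Alg S" for f
    using z I_carrier by (auto simp: Alg_def intro!: bexI[of _ 0])
  show add: "f + h \<in> Alg S" if fh: "f \<in> Alg S" "h \<in> Alg S" for f h
  proof -
    obtain f' h' where *: "f' \<in> alg S" "f - f' \<in> I" "h' \<in> alg S" "h - h' \<in> I"
      using fh by (auto simp: Alg_def)
    have "f + h - (f' + h') \<in> I" using I_add[OF *(2,4)] by (simp add: algebra_simps)
    then show ?thesis using c fh alg_closed(3)[OF S *(1,3)] by (auto simp: Alg_def)
  qed
  show mult: "f \<star> h \<in> Alg S" if fh: "f \<in> Alg S" "h \<in> Alg S" for f h
  proof -
    obtain f' h' where *: "f' \<in> alg S" "f - f' \<in> I" "h' \<in> alg S" "h - h' \<in> I"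
      using fh by (auto simp: Alg_def)
    have f': "f' \<in> carrier \<H>" using * alg_carrier[OF S] by auto
    have "(f - f') \<star> h + f' \<star> (h - h') \<in> I"
      using c fh f' * by (intro I_add I_mult_left I_mult_right) auto
    then have "f \<star> h - f' \<star> h' \<in> I" by (simp add: mul_linear)
    then show ?thesis using c fh alg_closed(4)[OF S *(1,3)] by (auto simp: Alg_def)
  qed
  show s: "f \<in> Alg S \<Longrightarrow> scale_pm c f \<in> Alg S" for f c
    using mult[OF a[OF alg_closed(1)[OF S, of c]], of f] c by simp
  from s[of _ "- 1"] have n: "f \<in> Alg S \<Longrightarrow> - f \<in> Alg S" for f by simp
  show "f \<in> Alg S \<Longrightarrow> h \<in> Alg S \<Longrightarrow> f - h \<in> Alg S" using add[of f "- h"] n[of h] by simp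
  show "f - h \<in> I \<Longrightarrow> h \<in> Alg S \<Longrightarrow> f \<in> Alg S" using add[OF i, of "f - h" h] by simp
qed

lemma proj_mem_subalgebra:
  assumes S: "S \<subseteq> carrier \<H>" and f: "f \<in> carrier \<H>"
  shows "proj I f \<in> subalgebra_gen I (proj I ` S) \<longleftrightarrow> f \<in> Alg S"
  unfolding subalgebra_gen_proj[OF S] Alg_def
  using alg_carrier[OF S] f proj_eq_iff by (auto simp: image_iff subset_iff)

lemma subalgebra_gen_proj_Alg:
  assumes S: "S \<subseteq> carrier \<H>"
  shows "subalgebra_gen I (proj I ` S) = proj I ` Alg S"
proof
  show "subalgebra_gen I (proj I ` S) \<subseteq> proj I ` Alg S"
    unfolding subalgebra_gen_proj[OF S] using Alg_alg[OF S] by auto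
  show "proj I ` Alg S \<subseteq> subalgebra_gen I (proj I ` S)"
    using proj_mem_subalgebra[OF S] Alg_carrier[OF S] by auto
qed

lemma Alg_mono:
  assumes S: "S \<subseteq> carrier \<H>" and S': "S' \<subseteq> Alg S"
  shows "Alg S' \<subseteq> Alg S"
proof
  have S'c: "S' \<subseteq> carrier \<H>" using S' Alg_carrier[OF S] by auto
  fix f assume "f \<in> Alg S'"
  then obtain h where h: "h \<in> alg S'" "f - h \<in> I" by (auto simp: Alg_def)
  from h(1) S'c have "h \<in> Alg S"
    by (induction rule: alg_induct)
      (use S' Alg_alg[OF S alg_closed(1)[OF S]] Alg_add[OF S] Alg_mult[OF S] in auto)
  then show "f \<in> Alg S" using Alg_cong[OF S h(2)] by simp
qed

lemma subalgebra_gen_eqI: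
  assumes "S \<subseteq> carrier \<H>" "S' \<subseteq> carrier \<H>" "S \<subseteq> Alg S'" "S' \<subseteq> Alg S"
  shows "subalgebra_gen I (proj I ` S) = subalgebra_gen I (proj I ` S')"
  using assms Alg_mono[of S S'] Alg_mono[of S' S] by (simp add: subalgebra_gen_proj_Alg)

lemma Alg_conj:
  assumes S: "S \<subseteq> carrier \<H>" and eigen: "\<And>s. s \<in> S \<Longrightarrow> \<exists>a w. s \<in> homog a w"
    and b: "b \<in> carrier G" and f: "f \<in> Alg S"
  shows "conjugate b f \<in> Alg S"
proof -
  obtain h where h: "h \<in> alg S" "f - h \<in> I" using f by (auto simp: Alg_def)
  from h(1) S have "conjugate b h \<in> Alg S"
  proof (induction rule: alg_induct)
    case (scalar c)
    then show ?case using Alg_alg[OF S alg_closed(1)[OF S, of c]] b by (simp add: scalar_def conjugate_single)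
  next
    case (gen s)
    then obtain a w where "s \<in> homog a w" using eigen by blast
    then show ?case using conjugate_homog[of s a w b] b Alg_scale[OF S Alg_gen[OF S gen]] by simp
  next
    case (mult f h)
    then show ?case using alg_carrier[OF S] b Alg_mult[OF S] conjugate_mult[of b f h] by (auto simp: subset_iff)
  qed (simp add: conjugate_linear Alg_add[OF S])
  moreover have "conjugate b f - conjugate b h \<in> I" using I_conj[OF h(2) b] by (simp add: conjugate_linear)
  ultimately show ?thesis using Alg_cong[OF S] by blast
qed

section \<open>Stability of subalgebras under the adjoint action\<close>

lemma ad_var_mult:
  assumes "i \<in> {1..n}" "f \<in> carrier \<H>" "h \<in> carrier \<H>"
  shows "ad_var i (f \<star> h) = conjugate (g i) f \<star> ad_var i h + ad_var i f \<star> h"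
  using assms by (simp add: ad_var_def conjugate_mult mul_linear H.m_assoc)

text \<open>The skew Leibniz rule reduces stability to the generators, but it conjugates one factor
  by \<open>g i\<close>. Homogeneous generators are only rescaled by this, so the conjugated factor
  stays in the subalgebra.\<close>

lemma Alg_ad_var:
  assumes S: "S \<subseteq> carrier \<H>" and eigen: "\<And>s. s \<in> S \<Longrightarrow> \<exists>a w. s \<in> homog a w"
    and i: "i \<in> {1..n}" and ad: "\<And>s. s \<in> S \<Longrightarrow> ad_var i s \<in> Alg S" and f: "f \<in> Alg S"
  shows "ad_var i f \<in> Alg S"
proof -
  obtain h where h: "h \<in> alg S" "f - h \<in> I" using f by (auto simp: Alg_def)
  from h(1) S have "ad_var i h \<in> Alg S"
  proof (induction rule: alg_induct)
    case (scalar c)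
    then show ?case using i Alg_I[OF S I_zero] by (simp add: ad_var_eq mul_linear)
  next
    case (mult f h)
    then have "f \<in> carrier \<H>" "h \<in> carrier \<H>" "f \<in> Alg S" "h \<in> Alg S"
      using alg_carrier[OF S] Alg_alg[OF S] by auto
    then show ?case
      using mult.IH i Alg_conj[OF S eigen] by (simp add: ad_var_mult Alg_add[OF S] Alg_mult[OF S])
  qed (use ad in \<open>simp_all add: ad_var_linear Alg_add[OF S]\<close>)
  moreover have "ad_var i f - ad_var i h \<in> I" using I_ad_var[OF h(2) i] by (simp add: ad_var_linear)
  ultimately show ?thesis using Alg_cong[OF S] by blast
qed

abbreviation ad_stable where "ad_stable S \<equiv> \<forall>i\<in>{1..n}. \<forall>f\<in>Alg S. ad_var i f \<in> Alg S"

text \<open>Every \<open>ad_r a\<close> is a combination of conjugations followed by words in the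
  \<open>ad_var i\<close>. Homogeneity of the generators takes care of the conjugations, which
  leaves the single letters.\<close>

lemma ad_r_invariant_iff:
  assumes S: "S \<subseteq> carrier \<H>" and eigen: "\<And>s. s \<in> S \<Longrightarrow> \<exists>a w. s \<in> homog a w"
  shows "ad_r_invariant I (subalgebra_gen I (proj I ` S)) \<longleftrightarrow> ad_stable S"
proof -
  have "ad_r_invariant I (subalgebra_gen I (proj I ` S)) \<longleftrightarrow>
      (\<forall>a\<in>carrier \<H>. \<forall>f\<in>Alg S. ad_r a f \<in> Alg S)"
    unfolding ad_r_invariant_def carrier_quotient subalgebra_gen_proj_Alg[OF S] ball_simps(9)
    using Alg_carrier[OF S] proj_mem_subalgebra[OF S ad_r_closed]
    by (simp add: ad_r_quotient_proj subalgebra_gen_proj_Alg[OF S])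
  also have "\<dots> \<longleftrightarrow> ad_stable S"
  proof (intro iffI ballI)
    fix i f assume *: "\<forall>a\<in>carrier \<H>. \<forall>f\<in>Alg S. ad_r a f \<in> Alg S" "i \<in> {1..n}" "f \<in> Alg S"
    have f: "f \<in> carrier \<H>" using Alg_carrier[OF S] * by blast
    have "conjugate \<one> f = f" using f by (simp add: conjugate_def grp_def flip: one_skew)
    then have "ad_r (sgl \<one> [i]) f = ad_var i f" using * f by (simp add: ad_r_single)
    then show "ad_var i f \<in> Alg S" using * by (metis single_closed one_closed lists.Cons lists.Nil)
  next
    fix a f assume *: "ad_stable S" and a: "a \<in> carrier \<H>" and f: "f \<in> Alg S"
    have w: "ad_word u h \<in> Alg S" if "u \<in> letters" "h \<in> Alg S" for u h
      using that * by (induction u arbitrary: h) auto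
    have "pm.subspace (Alg S)"
      unfolding pm.subspace_def using Alg_I[OF S I_zero] Alg_add[OF S] Alg_scale[OF S] by simp
    from klin_ad_r this a show "ad_r a f \<in> Alg S"
      by (rule skew_map_subspace) (simp add: ad_r_single Alg_carrier[OF S f] w Alg_conj[OF S eigen _ f])
  qed
  finally show ?thesis .
qed

section \<open>The subalgebras \<open>K(\<pi>)\<close>\<close>

definition K_gens :: "nat set \<Rightarrow> ('g, 'k) skew set" where
  "K_gens \<pi> = {ad_word w (gr_var j) | w j. w \<in> lists ({1..n} - \<pi>) \<and> j \<in> \<pi>}"

lemma letters_diff: "w \<in> lists ({1..n} - \<pi>) \<Longrightarrow> w \<in> letters"
  by auto

lemma K_gensE:
  assumes "\<pi> \<subseteq> {1..n}" "s \<in> K_gens \<pi>"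
  obtains w j where "w \<in> lists ({1..n} - \<pi>)" "w \<in> letters" "j \<in> \<pi>" "j \<in> {1..n}" "s = ad_word w (gr_var j)"
  using assms letters_diff unfolding K_gens_def mem_Collect_eq by (metis subsetD)

lemma K_gens_carrier: "\<pi> \<subseteq> {1..n} \<Longrightarrow> K_gens \<pi> \<subseteq> carrier \<H>"
  by (rule subsetI, erule (1) K_gensE) simp

lemma K_gens_homog: "\<pi> \<subseteq> {1..n} \<Longrightarrow> s \<in> K_gens \<pi> \<Longrightarrow> \<exists>a w. s \<in> homog a w"
  by (erule (1) K_gensE) (use ad_word_homog[OF gr_var_homog] in fastforce)

lemma K_subalgebra_eq:
  assumes \<pi>: "\<pi> \<subseteq> {1..n}"
  shows "K_subalgebra I \<pi> = subalgebra_gen I (proj I ` K_gens \<pi>)"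
proof -
  have *: "ad_r_quotient I (proj I (word w)) (proj I (grp (inv (g j)) \<star> var j)) = proj I (ad_word w (gr_var j))"
    if "w \<in> lists ({1..n} - \<pi>)" "j \<in> \<pi>" for w j
  proof -
    have wj: "w \<in> letters" "j \<in> {1..n}" using letters_diff[OF that(1)] that(2) \<pi> by blast+
    then have "conjugate \<one> (gr_var j) = gr_var j"
      by (simp add: conjugate_def grp_def flip: one_skew)
    then show ?thesis
      using wj by (simp add: ad_r_quotient_proj ad_r_single word_def[of w] flip: gr_var_def)
  qed
  have "K_subalgebra I \<pi> = subalgebra_gen I {proj I (ad_word w (gr_var j)) | w j.
      w \<in> lists ({1..n} - \<pi>) \<and> j \<in> \<pi>}"
    unfolding K_subalgebra_def
    by (rule arg_cong[where f = "subalgebra_gen I"], rule Collect_cong, rule iff_exI, rule iff_exI)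
      (use * in \<open>auto simp only:\<close>)
  also have "{proj I (ad_word w (gr_var j)) | w j. w \<in> lists ({1..n} - \<pi>) \<and> j \<in> \<pi>} = proj I ` K_gens \<pi>"
    unfolding K_gens_def by blast
  finally show ?thesis .
qed

lemma K_subalgebra_invariant:
  assumes \<pi>: "\<pi> \<subseteq> {1..n}"
  shows "ad_stable (K_gens \<pi>)"
proof (intro ballI)
  note S = K_gens_carrier[OF \<pi>] and eigen = K_gens_homog[OF \<pi>]
  fix i f assume i: "i \<in> {1..n}" and f: "f \<in> Alg (K_gens \<pi>)"
  show "ad_var i f \<in> Alg (K_gens \<pi>)"
  proof (cases "i \<in> \<pi>")
    case True
    then have "gr_var i \<in> K_gens \<pi>" unfolding K_gens_def by (force intro: exI[of _ "[]"])
    then show ?thesis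
      using Alg_conj[OF S eigen _ f] f i Alg_gen[OF S]
      unfolding ad_var_def by (intro Alg_diff[OF S] Alg_mult[OF S]) auto
  next
    case False
    show ?thesis
    proof (rule Alg_ad_var[OF S eigen i _ f])
      fix s assume "s \<in> K_gens \<pi>"
      then obtain w j where w: "w \<in> lists ({1..n} - \<pi>)" "j \<in> \<pi>" "s = ad_word w (gr_var j)"
        by (auto simp: K_gens_def)
      then have "ad_var i s = ad_word (w @ [i]) (gr_var j)" "w @ [i] \<in> lists ({1..n} - \<pi>)"
        using False i by auto
      then have "ad_var i s \<in> K_gens \<pi>" using w unfolding K_gens_def by blast
      then show "ad_var i s \<in> Alg (K_gens \<pi>)" by (rule Alg_gen[OF S])
    qed
  qed
qed

end

section \<open>Skew derivatives\<close>

context skew_hopf_algebra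
begin

text \<open>The map \<open>id \<otimes> \<Phi>\<close> for the functional \<open>\<Phi>\<close> that
  sends \<open>b v\<close> to \<open>\<phi> v\<close>, whatever the group element \<open>b\<close>;
  \<open>slice_l\<close> evaluates the left factor instead.\<close>

definition slice_r :: "(nat list \<Rightarrow> 'k) \<Rightarrow> (('g \<times> nat list) \<times> ('g \<times> nat list) \<Rightarrow>\<^sub>0 'k) \<Rightarrow> ('g, 'k) skew" where
  "slice_r \<phi> = lin_ext (\<lambda>(p, p'). scale_pm (\<phi> (snd p')) (single p 1))"

definition slice_l :: "(nat list \<Rightarrow> 'k) \<Rightarrow> (('g \<times> nat list) \<times> ('g \<times> nat list) \<Rightarrow>\<^sub>0 'k) \<Rightarrow> ('g, 'k) skew" where
  "slice_l \<phi> = lin_ext (\<lambda>(p, p'). scale_pm (\<phi> (snd p)) (single p' 1))"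

lemma klin_slice_r [klin_intros]: "klin F \<Longrightarrow> klin (\<lambda>f. slice_r \<phi> (F f))"
  and klin_slice_l [klin_intros]: "klin F \<Longrightarrow> klin (\<lambda>f. slice_l \<phi> (F f))"
  unfolding slice_r_def slice_l_def by (intro klin_intros; assumption)+

lemma slice_single [simp]:
  "slice_r \<phi> (single (p, (b, v)) c) = single p (c * \<phi> v)"
  "slice_l \<phi> (single ((a, u), p') c) = single p' (c * \<phi> u)"
  by (simp_all add: slice_r_def slice_l_def)

lemma slice_r_mult_var:
  assumes "t \<in> carrier tensor_algebra" "l \<in> {1..n}"
  shows "slice_r \<phi> (t \<star>\<star> comult_var l) = slice_r \<phi> t \<star> var l + slice_r (\<lambda>v. \<phi> (v @ [l])) t \<star> grp (g l)"
  by (rule tensor_eqI[where F = "\<lambda>t. slice_r \<phi> (t \<star>\<star> comult_var l)"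
        and F' = "\<lambda>t. slice_r \<phi> t \<star> var l + slice_r (\<lambda>v. \<phi> (v @ [l])) t \<star> grp (g l)"])
    (use assms in \<open>auto intro!: klin_intros simp: comult_var_eq tmul_linear klin_simps[OF klin_slice_r[OF klin_id]]
      chi_word_one word_def grp_def mult.commute\<close>)

lemma slice_l_mult_var:
  assumes "t \<in> carrier tensor_algebra" "l \<in> {1..n}"
  shows "slice_l \<phi> (t \<star>\<star> comult_var l) =
    slice_l (\<lambda>u. \<phi> (u @ [l])) t + slice_l (\<lambda>u. \<phi> u * chi_word u (g l)) t \<star> var l"
  by (rule tensor_eqI[where F = "\<lambda>t. slice_l \<phi> (t \<star>\<star> comult_var l)"
        and F' = "\<lambda>t. slice_l (\<lambda>u. \<phi> (u @ [l])) t + slice_l (\<lambda>u. \<phi> u * chi_word u (g l)) t \<star> var l"])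
    (use assms in \<open>auto intro!: klin_intros simp: comult_var_eq tmul_linear klin_simps[OF klin_slice_l[OF klin_id]]
      chi_word_one word_def grp_def mult.commute\<close>)

text \<open>A skew partial derivative. \<open>der_r i\<close> replaces an occurrence of
  \<open>x_i\<close> by \<open>g_i\<close>; its counterpart \<open>der_l i\<close> deletes one, at
  the cost of a factor \<open>\<chi> i (g l)\<close> for each letter \<open>l\<close> to the
  right.\<close>

definition der_r :: "nat \<Rightarrow> ('g, 'k) skew \<Rightarrow> ('g, 'k) skew" where
  "der_r i f = slice_r (\<lambda>u. if u = [i] then 1 else 0) (comult f)"

definition der_l :: "nat \<Rightarrow> ('g, 'k) skew \<Rightarrow> ('g, 'k) skew" where
  "der_l i f = slice_l (\<lambda>u. if u = [i] then 1 else 0) (comult f)"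

lemma klin_der_r [klin_intros]: "klin F \<Longrightarrow> klin (\<lambda>f. der_r i (F f))"
  and klin_der_l [klin_intros]: "klin F \<Longrightarrow> klin (\<lambda>f. der_l i (F f))"
  unfolding der_r_def der_l_def by (intro klin_intros; assumption)+

lemmas der_r_linear = klin_simps[OF klin_der_r[OF klin_id]]
lemmas der_l_linear = klin_simps[OF klin_der_l[OF klin_id]]

lemma slice_zero: "slice_r (\<lambda>_. 0) t = 0" "slice_l (\<lambda>_. 0) t = 0"
  by (simp_all add: slice_r_def slice_l_def lin_ext_def case_prod_beta)

text \<open>These are the counit axioms: the functional that tests for the empty word is
  \<open>counit\<close>.\<close>

lemma slice_counit:
  assumes "f \<in> carrier \<H>"
  shows "slice_r (\<lambda>u. if u = [] then 1 else 0) (comult f) = f"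
    and "slice_l (\<lambda>u. if u = [] then 1 else 0) (comult f) = f"
proof -
  have *: "slice_r (\<lambda>u. if u = [] then 1 else 0) (comult (sgl a u)) = sgl a u"
    "slice_l (\<lambda>u. if u = [] then 1 else 0) (comult (sgl a u)) = sgl a u"
    if "a \<in> carrier G" "u \<in> letters" for a u
  proof -
    have 1: "(\<lambda>u. (if u = [] then 1 else (0::'k)) * chi_word u (g l)) = (\<lambda>u. if u = [] then 1 else 0)" for l
      by auto
    from that(2) show "slice_r (\<lambda>u. if u = [] then 1 else 0) (comult (sgl a u)) = sgl a u"
      "slice_l (\<lambda>u. if u = [] then 1 else 0) (comult (sgl a u)) = sgl a u"
      using that(1) by (induction u rule: rev_induct)
        (simp_all add: comult_Nil comult_snoc slice_r_mult_var slice_l_mult_var slice_zero 1 mul_linear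
          word_def chi_word_one)
  qed
  show "slice_r (\<lambda>u. if u = [] then 1 else 0) (comult f) = f"
    by (rule skew_eqI[where F' = "\<lambda>f. f"]) (use assms * in \<open>auto intro!: klin_intros klin_comult\<close>)
  show "slice_l (\<lambda>u. if u = [] then 1 else 0) (comult f) = f"
    by (rule skew_eqI[where F' = "\<lambda>f. f"]) (use assms * in \<open>auto intro!: klin_intros klin_comult\<close>)
qed

lemma comult_var: "i \<in> {1..n} \<Longrightarrow> comult (var i) = comult_var i"
  using comult_snoc[of \<one> "[]" i] by (simp add: comult_Nil comult_var_eq tmul_linear chi_one word_def)

lemma der_r_mult_var:
  assumes "f \<in> carrier \<H>" "l \<in> {1..n}"
  shows "der_r i (f \<star> var l) = der_r i f \<star> var l + (if l = i then f \<star> grp (g i) else 0)"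
proof -
  have "(\<lambda>v. if v @ [l] = [i] then 1 else (0::'k)) = (if l = i then (\<lambda>v. if v = [] then 1 else 0) else (\<lambda>_. 0))"
    by auto
  then show ?thesis
    using assms by (simp add: der_r_def comult_mult comult_var slice_r_mult_var slice_counit slice_zero mul_linear)
qed

lemma der_l_mult_var:
  assumes "f \<in> carrier \<H>" "l \<in> {1..n}"
  shows "der_l i (f \<star> var l) = (if l = i then f else 0) + scale_pm (\<chi> i (g l)) (der_l i f \<star> var l)"
proof -
  have 1: "(\<lambda>v. if v @ [l] = [i] then 1 else (0::'k)) = (if l = i then (\<lambda>v. if v = [] then 1 else 0) else (\<lambda>_. 0))"
    by auto
  have 2: "slice_l (\<lambda>u. (if u = [i] then 1 else 0) * chi_word u (g l)) t =
      scale_pm (\<chi> i (g l)) (slice_l (\<lambda>u. if u = [i] then 1 else 0) t)" for t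
    unfolding slice_l_def
    by (subst klin_lin_ext_comm[where F = "scale_pm (\<chi> i (g l))"])
      (auto intro!: klin_scale[OF klin_id] lin_ext_cong simp: case_prod_beta)
  show ?thesis
    using assms by (simp add: der_l_def comult_mult comult_var slice_l_mult_var slice_counit slice_zero mul_linear 1 2)
qed

lemma der_Nil: "der_r i (sgl a []) = 0" "der_l i (sgl a []) = 0"
  by (simp_all add: der_r_def der_l_def comult_Nil)

lemma sgl_snoc: "a \<in> carrier G \<Longrightarrow> u \<in> letters \<Longrightarrow> sgl a (u @ [l]) = sgl a u \<star> var l"
  by (simp add: word_def chi_word_one)

lemma keys_der_single:
  assumes "a \<in> carrier G" "u \<in> letters"
  shows "keys (der_r i (sgl a u)) \<subseteq> {p \<in> skew_basis. add_mset i (mset (snd p)) = mset u}" (is "?A u")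
    and "keys (der_l i (sgl a u)) \<subseteq> {p \<in> skew_basis. add_mset i (mset (snd p)) = mset u}" (is "?B u")
proof -
  have "?A u \<and> ?B u"
    using assms(2)
  proof (induction u rule: rev_induct)
    case Nil
    show ?case by (simp add: der_Nil)
  next
    case (snoc l u)
    then have l: "l \<in> {1..n}" "u \<in> letters" by auto
    let ?C = "\<lambda>u. {f :: ('g, 'k) skew. \<forall>p\<in>keys f. p \<in> skew_basis \<and> add_mset i (mset (snd p)) = mset u}"
    have sub: "pm.subspace (?C (u @ [l]))" by (rule subspace_keys)
    have ext: "f \<star> var l \<in> ?C (u @ [l])" if f: "f \<in> ?C u" for f
      using l f by (auto elim!: keys_mul simp: word_def split: if_splits)
    have end_r: "(if l = i then sgl a u \<star> grp (g i) else 0) \<in> ?C (u @ [l])"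
      using l assms(1) by (auto simp: grp_def)
    have end_l: "(if l = i then sgl a u else 0) \<in> ?C (u @ [l])"
      using l assms(1) by auto
    have "der_r i (sgl a (u @ [l])) \<in> ?C (u @ [l])"
      unfolding sgl_snoc[OF assms(1) l(2)] der_r_mult_var[OF single_closed[OF assms(1) l(2)] l(1)]
      using snoc.IH l by (intro pm.subspace_add[OF sub] ext end_r) auto
    moreover have "der_l i (sgl a (u @ [l])) \<in> ?C (u @ [l])"
      unfolding sgl_snoc[OF assms(1) l(2)] der_l_mult_var[OF single_closed[OF assms(1) l(2)] l(1)]
      using snoc.IH l by (intro pm.subspace_add[OF sub] pm.subspace_scale[OF sub] ext end_l) auto
    ultimately show ?case by auto
  qed
  then show "?A u" "?B u" by auto
qed

lemma keys_der:
  assumes f: "f \<in> carrier \<H>"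
  shows "p \<in> keys (der_r i f) \<Longrightarrow> p \<in> skew_basis \<and> (\<exists>p'\<in>keys f. mset (snd p') = add_mset i (mset (snd p)))"
    and "p \<in> keys (der_l i f) \<Longrightarrow> p \<in> skew_basis \<and> (\<exists>p'\<in>keys f. mset (snd p') = add_mset i (mset (snd p)))"
proof -
  let ?A = "{h :: ('g, 'k) skew. \<forall>p\<in>keys h. p \<in> skew_basis \<and>
      (\<exists>p'\<in>keys f. mset (snd p') = add_mset i (mset (snd p)))}"
  have in_A: "h \<in> ?A" if "(a, u) \<in> keys f" "keys h \<subseteq> {p \<in> skew_basis. add_mset i (mset (snd p)) = mset u}" for a u h
    using that by (fastforce intro: bexI[OF _ that(1)])
  have "der_r i f \<in> ?A"
    by (rule skew_map_subspace[OF klin_der_r[OF klin_id] subspace_keys f]) (rule in_A[OF _ keys_der_single(1)])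
  moreover have "der_l i f \<in> ?A"
    by (rule skew_map_subspace[OF klin_der_l[OF klin_id] subspace_keys f]) (rule in_A[OF _ keys_der_single(2)])
  ultimately show "p \<in> keys (der_r i f) \<Longrightarrow> p \<in> skew_basis \<and> (\<exists>p'\<in>keys f. mset (snd p') = add_mset i (mset (snd p)))"
    "p \<in> keys (der_l i f) \<Longrightarrow> p \<in> skew_basis \<and> (\<exists>p'\<in>keys f. mset (snd p') = add_mset i (mset (snd p)))"
    by blast+
qed

lemma der_closed [simp]:
  assumes "f \<in> carrier \<H>"
  shows "der_r i f \<in> carrier \<H>" "der_l i f \<in> carrier \<H>"
  unfolding carrier_skew by (auto dest: keys_der[OF assms] simp del: skew_basis_iff)

lemma der_absent:
  assumes "f \<in> homog a w" "i \<notin> set w"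
  shows "der_r i f = 0" "der_l i f = 0"
proof -
  have "\<not> (\<exists>p'\<in>keys f. mset (snd p') = add_mset i (mset v))" for v
  proof
    assume "\<exists>p'\<in>keys f. mset (snd p') = add_mset i (mset v)"
    then have "mset w = add_mset i (mset v)" using assms(1) by (auto simp: homog_def)
    then have "i \<in># mset w" by simp
    then show False using assms(2) by simp
  qed
  then have "keys (der_r i f) = {}" "keys (der_l i f) = {}"
    using keys_der[OF homog_carrier[OF assms(1)]] by blast+
  then show "der_r i f = 0" "der_l i f = 0" by simp_all
qed

lemma word_snoc: "u \<in> letters \<Longrightarrow> word (u @ [l]) = word u \<star> var l"
  by (simp add: word_def chi_word_one)

lemma der_r_mult_word:
  assumes "f \<in> carrier \<H>" "u \<in> letters"
  shows "der_r i (f \<star> word u) = der_r i f \<star> word u + f \<star> der_r i (word u)"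
  using assms(2)
proof (induction u rule: rev_induct)
  case Nil
  have "h \<star> word [] = h" if "h \<in> carrier \<H>" for h
    using that unfolding word_def one_skew[symmetric] by simp
  moreover have "der_r i (word []) = 0" unfolding word_def by (rule der_Nil)
  ultimately show ?case using assms(1) by (simp add: mul_linear)
next
  case (snoc l u)
  then have l: "l \<in> {1..n}" "u \<in> letters" by auto
  have "der_r i (f \<star> word (u @ [l])) = der_r i (f \<star> word u \<star> var l)"
    using assms(1) l by (simp add: word_snoc H.m_assoc)
  also have "\<dots> = der_r i (f \<star> word u) \<star> var l + (if l = i then f \<star> word u \<star> grp (g i) else 0)"
    using assms(1) l by (intro der_r_mult_var) auto
  finally show ?case
    using assms(1) l snoc.IH by (simp add: word_snoc der_r_mult_var mul_linear H.m_assoc)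
qed

text \<open>The plain Leibniz rule reflects the trivial group component of \<open>h\<close>: a group
  element \<open>b\<close> on the right would bring in the factor \<open>\<chi> i b\<close>.\<close>

lemma der_r_mult:
  assumes "f \<in> carrier \<H>" "h \<in> homog \<one> w"
  shows "der_r i (f \<star> h) = der_r i f \<star> h + f \<star> der_r i h"
  by (rule homog_eqI[OF _ _ assms(2), where F = "\<lambda>h. der_r i (f \<star> h)" and F' = "\<lambda>h. der_r i f \<star> h + f \<star> der_r i h"])
    (use assms(1) der_r_mult_word in \<open>auto intro!: klin_intros simp: word_def\<close>)

lemma der_l_var_word:
  assumes "i \<in> {1..n}" "u \<in> letters" "i \<notin> set u"
  shows "der_l i (var i \<star> word u) = scale_pm (\<chi> i (g_word u)) (word u)"
  using assms(2,3)
proof (induction u rule: rev_induct)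
  case Nil
  have "var i = word [] \<star> var i" by (simp add: word_def chi_one)
  then have "der_l i (var i) = word []"
    using der_l_mult_var[of "word []" i i] assms(1) der_Nil(2)[of i \<one>] by (simp add: word_def mul_linear)
  moreover have "var i \<star> word [] = var i" using assms(1) by (simp add: word_def chi_one)
  ultimately show ?case using assms(1) by (simp add: g_word_simps chi_one)
next
  case (snoc l u)
  then have l: "l \<in> {1..n}" "u \<in> letters" "l \<noteq> i" "i \<notin> set u" by auto
  have "der_l i (var i \<star> word (u @ [l])) = der_l i (var i \<star> word u \<star> var l)"
    using assms(1) l by (simp add: word_snoc H.m_assoc)
  also have "\<dots> = scale_pm (\<chi> i (g l) * \<chi> i (g_word u)) (word u \<star> var l)"
    using assms(1) l snoc.IH by (simp add: der_l_mult_var mul_linear)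
  finally show ?case
    using assms(1) l by (simp add: word_snoc g_word_append g_word_simps chi_mult mult.commute)
qed

text \<open>Only the outer \<open>x_i\<close> is differentiated, and it leaves \<open>g_i\<close>
  behind. In the second summand \<open>g_i\<close> stands to the right of \<open>A\<close>, and
  moving it to the front costs \<open>chi_word v (g i)\<close>. The scalar is one minus the
  symmetrised pairing of \<open>i\<close> with the degree of \<open>A\<close>.\<close>

lemma der_r_bracket_var:
  assumes A: "A \<in> homog \<one> v" and v: "v \<in> letters" and i: "i \<in> {1..n}" "i \<notin> set v"
  shows "der_r i (bracket (var i) A) =
    scale_pm (1 - \<chi> i (g_word v) * chi_word v (g i)) (grp (g i) \<star> A)"
proof -
  note Ac = homog_carrier[OF A]
  have "der_r i (var i) = grp (g i)"
    using der_r_mult_var[of "word []" i i] i der_Nil(1)[of i \<one>] by (simp add: word_def mul_linear chi_one grp_def)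
  then show ?thesis
    using i Ac A by (simp add: bracket_homog[OF var_homog[OF i(1)] A] der_r_linear der_r_mult_var der_r_mult[of _ A v]
        der_absent[OF A] mul_linear homog_mult_grp[OF A] pm.scale_left_diff_distrib)
qed

text \<open>The mirror image: deleting \<open>x_i\<close> at the right end is free, and at the left
  end it costs \<open>\<chi> i (g_word v)\<close>.\<close>

lemma der_l_bracket_var:
  assumes A: "A \<in> homog \<one> v" and v: "v \<in> letters" and i: "i \<in> {1..n}" "i \<notin> set v"
  shows "der_l i (bracket A (var i)) = scale_pm (1 - \<chi> i (g_word v) * chi_word v (g i)) A"
proof -
  note Ac = homog_carrier[OF A]
  have "der_l i (var i \<star> A) = scale_pm (\<chi> i (g_word v)) A"
  proof (rule homog_eqI[OF _ _ A, where F = "\<lambda>A. der_l i (var i \<star> A)" and F' = "scale_pm (\<chi> i (g_word v))"])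
    fix u assume u: "u \<in> letters" "mset u = mset v" "g_word u = g_word v"
    then have "i \<notin> set u" using i(2) by (metis set_mset_mset)
    then show "der_l i (var i \<star> sgl \<one> u) = scale_pm (\<chi> i (g_word v)) (sgl \<one> u)"
      using der_l_var_word[OF i(1) u(1)] u(3) by (simp add: word_def)
  qed (auto intro!: klin_intros klin_scale[OF klin_id])
  then show ?thesis
    using i Ac by (simp add: bracket_homog[OF A var_homog[OF i(1)]] der_l_linear der_l_mult_var
        der_absent[OF A] mul_linear g_word_simps pm.scale_left_diff_distrib mult.commute)
qed

text \<open>In \<open>A \<star> B\<close> the new \<open>g_i\<close> has to pass \<open>A\<close>,
  which costs \<open>chi_word v (g i)\<close>. In the opposite product the same factor comes from
  the bracket scalar, because \<open>B\<close> has one letter \<open>i\<close> more than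
  \<open>B'\<close>. So the derivative acts inside the bracket up to a unit.\<close>

lemma der_r_bracket:
  assumes A: "A \<in> homog \<one> v" and v: "v \<in> letters" and B: "B \<in> homog \<one> (i # w)" and w: "w \<in> letters"
    and B': "B' \<in> homog \<one> w" and i: "i \<in> {1..n}" "i \<notin> set v"
    and d: "der_r i B = scale_pm c (grp (g i) \<star> B')"
  shows "der_r i (bracket A B) = scale_pm (c * chi_word v (g i)) (grp (g i) \<star> bracket A B')"
proof -
  note cs = homog_carrier[OF A] homog_carrier[OF B] homog_carrier[OF B']
  have "A \<star> (grp (g i) \<star> B') = scale_pm (chi_word v (g i)) (grp (g i) \<star> (A \<star> B'))"
    using cs i by (simp add: homog_mult_grp[OF A] mul_linear H.m_assoc flip: H.m_assoc[of A "grp (g i)" B'])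
  then show ?thesis
    using i w v cs
    by (simp add: bracket_homog[OF A B] bracket_homog[OF A B'] der_r_linear der_r_mult[OF _ B] der_r_mult[OF _ A]
        der_absent[OF A] d mul_linear g_word_simps chi_word_mult H.m_assoc pm.scale_right_diff_distrib mult.assoc)
qed

end

context skew_hopf_quotient
begin

section \<open>Derivatives and detecting functionals on the quotient\<close>

lemma slice_tensor:
  "slice_r \<phi> (tensor a b) = scale_pm (\<Sum>p\<in>keys b. lookup b p * \<phi> (snd p)) a"
  "slice_l \<phi> (tensor a b) = scale_pm (\<Sum>p\<in>keys a. lookup a p * \<phi> (snd p)) b"
proof -
  have *: "lin_ext (\<lambda>p. scale_pm c (single p 1)) a = scale_pm c a" for c and a :: "'b \<Rightarrow>\<^sub>0 'k"
    by (simp only: klin_lin_ext_comm[OF klin_scale[OF klin_id], symmetric] lin_ext_single_self)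
  have L: "lin_ext (\<lambda>p'. scale_pm (\<phi> (snd p')) f) b =
      scale_pm (\<Sum>p\<in>keys b. lookup b p * \<phi> (snd p)) f" for b f :: "('g, 'k) skew"
    by (simp add: lin_ext_def pm.scale_sum_left)
  show "slice_r \<phi> (tensor a b) = scale_pm (\<Sum>p\<in>keys b. lookup b p * \<phi> (snd p)) a"
    "slice_l \<phi> (tensor a b) = scale_pm (\<Sum>p\<in>keys a. lookup a p * \<phi> (snd p)) b"
    by (simp_all only: slice_r_def slice_l_def lin_ext_tensor prod.case L *)
qed

text \<open>Elements of \<open>I\<close> have no words of length one, so the slicing functional is
  zero on \<open>I\<close>. In a pure tensor with a factor in \<open>I\<close>, either that factor
  is evaluated to zero or it survives and keeps the result in \<open>I\<close>.\<close>

lemma I_der: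
  assumes "f \<in> I"
  shows "der_r i f \<in> I" "der_l i f \<in> I"
proof -
  have 0: "(\<Sum>p\<in>keys b. lookup b p * (if snd p = [i] then 1 else 0)) = 0"
    if "b \<in> I" for b
    using that I_dec by (intro sum.neutral) (fastforce simp: decomposables_def)
  have kl: "klin (slice_r \<phi>)" "klin (slice_l \<phi>)" for \<phi>
    using klin_slice_r[OF klin_id] klin_slice_l[OF klin_id] by auto
  show "der_r i f \<in> I" unfolding der_r_def
    by (rule tensor_ideal_map[OF kl(1) subspace_ideal[OF I_ideal] I_comult[OF assms]])
      (auto simp: slice_tensor 0 I_zero I_scale)
  show "der_l i f \<in> I" unfolding der_l_def
    by (rule tensor_ideal_map[OF kl(2) subspace_ideal[OF I_ideal] I_comult[OF assms]])
      (auto simp: slice_tensor 0 I_zero I_scale)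
qed

text \<open>\<open>f\<close> is nonzero in the quotient, even modulo all elements without a component of degree \<open>w\<close>.\<close>

definition detects :: "nat list \<Rightarrow> ('g, 'k) skew \<Rightarrow> bool" where
  "detects w f \<longleftrightarrow> (\<exists>F. module_hom scale_pm (*) F \<and> (\<forall>h\<in>I. F h = 0) \<and>
     (\<forall>h\<in>carrier \<H>. (\<forall>p\<in>keys h. mset (snd p) \<noteq> mset w) \<longrightarrow> F h = 0) \<and> F f \<noteq> 0)"

lemma detects_var:
  assumes "i \<in> {1..n}"
  shows "detects [i] (var i)"
proof -
  let ?F = "\<lambda>h :: ('g, 'k) skew. lookup h (\<one>, [i])"
  have "module_hom scale_pm (*) ?F"
    by (auto simp: module_hom_iff pm.module_axioms lookup_add lookup_scale_pm Modules.module_def algebra_simps)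
  moreover have "?F h = 0" if "h \<in> I" for h
  proof (rule ccontr)
    assume "?F h \<noteq> 0"
    then have "(\<one>, [i]) \<in> keys h" by (simp add: in_keys_iff)
    moreover have "h \<in> decomposables" using that I_dec by blast
    ultimately show False unfolding decomposables_def by fastforce
  qed
  moreover have "?F h = 0" if "\<forall>p\<in>keys h. mset (snd p) \<noteq> mset [i]" for h
  proof (rule ccontr)
    assume "?F h \<noteq> 0"
    then have "(\<one>, [i]) \<in> keys h" by (simp add: in_keys_iff)
    then show False using that by fastforce
  qed
  moreover have "?F (var i) \<noteq> 0" by (simp add: word_def)
  ultimately show ?thesis unfolding detects_def by (intro exI[of _ ?F]) blast
qed

text \<open>The functional for \<open>f'\<close> is pulled back along \<open>D\<close>. The premise
  \<open>keys\<close> ensures that a component of degree \<open>w'\<close> in \<open>D h\<close> can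
  only come from one of degree \<open>w\<close> in \<open>h\<close>.\<close>

lemma detects_map:
  assumes D: "klin D" "\<And>h. h \<in> I \<Longrightarrow> D h \<in> I" "\<And>h. h \<in> carrier \<H> \<Longrightarrow> D h \<in> carrier \<H>"
    and keys: "\<And>h p. h \<in> carrier \<H> \<Longrightarrow> p \<in> keys (D h) \<Longrightarrow> mset (snd p) = mset w' \<Longrightarrow>
      \<exists>p'\<in>keys h. mset (snd p') = mset w"
    and eq: "D f = scale_pm c f'" "c \<noteq> 0" and f': "detects w' f'"
  shows "detects w f"
proof -
  obtain l where l: "module_hom scale_pm (*) l" "\<And>h. h \<in> I \<Longrightarrow> l h = 0"
    "\<And>h. h \<in> carrier \<H> \<Longrightarrow> (\<forall>p\<in>keys h. mset (snd p) \<noteq> mset w') \<Longrightarrow> l h = 0" "l f' \<noteq> 0"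
    using f' unfolding detects_def by auto
  have "module_hom scale_pm (*) (\<lambda>h. l (D h))"
    using module_hom_compose[OF D(1) l(1)] by (simp add: o_def)
  moreover have "l (D h) = 0" if "h \<in> carrier \<H>" "\<forall>p\<in>keys h. mset (snd p) \<noteq> mset w" for h
    using l(3)[OF D(3)[OF that(1)]] keys[OF that(1)] that(2) by blast
  moreover have "l (D f) \<noteq> 0" using eq l(4) module_hom.scale[OF l(1)] by simp
  ultimately show ?thesis
    unfolding detects_def using D(2) l(2) by (intro exI[of _ "\<lambda>h. l (D h)"]) auto
qed

lemma detects_grp:
  assumes f: "detects w f" "f \<in> carrier \<H>" and a: "a \<in> carrier G"
  shows "detects w (grp a \<star> f)"
proof (rule detects_map[where D = "\<lambda>h. grp (inv a) \<star> h" and c = 1, OF _ _ _ _ _ _ f(1)])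
  have "grp (inv a) \<star> grp a = \<one>\<^bsub>\<H>\<^esub>" using a by (simp add: grp_def one_skew)
  then show "grp (inv a) \<star> (grp a \<star> f) = scale_pm 1 f"
    using f(2) a by (simp flip: H.m_assoc)
  show "\<exists>p'\<in>keys h. mset (snd p') = mset w"
    if "p \<in> keys (grp (inv a) \<star> h)" "mset (snd p) = mset w" for h p
    using that by (auto elim!: keys_mul simp: grp_def) force
qed (use a in \<open>auto intro!: klin_intros I_mult_left\<close>)

lemma detects_scale:
  assumes "detects w f" "c \<noteq> 0"
  shows "detects w (scale_pm c f)"
  by (rule detects_map[where D = "\<lambda>h. h", OF _ _ _ _ _ assms(2,1)]) (auto intro: klin_id)

lemma detects_der_r:
  assumes "der_r i f = scale_pm c (grp a \<star> f')" "c \<noteq> 0" "a \<in> carrier G" "f' \<in> carrier \<H>" "detects w f'"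
  shows "detects (i # w) f"
proof (rule detects_map[where D = "der_r i", OF _ _ _ _ assms(1,2)])
  show "detects w (grp a \<star> f')" by (rule detects_grp[OF assms(5,4,3)])
  show "\<exists>p'\<in>keys h. mset (snd p') = mset (i # w)"
    if "h \<in> carrier \<H>" "p \<in> keys (der_r i h)" "mset (snd p) = mset w" for h p
    using keys_der(1)[OF that(1,2)] that(3) by simp
qed (auto intro: klin_der_r[OF klin_id] I_der)

lemma detects_der_l:
  assumes "der_l i f = scale_pm c f'" "c \<noteq> 0" "detects w f'"
  shows "detects (i # w) f"
proof (rule detects_map[where D = "der_l i", OF _ _ _ _ assms])
  show "\<exists>p'\<in>keys h. mset (snd p') = mset (i # w)"
    if "h \<in> carrier \<H>" "p \<in> keys (der_l i h)" "mset (snd p) = mset w" for h p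
    using keys_der(2)[OF that(1,2)] that(3) by simp
qed (auto intro: klin_der_l[OF klin_id] I_der)

end

section \<open>The quantum Serre relations\<close>

locale quantum_sl = skew_hopf_algebra n G g \<chi>
  for n :: nat and G :: "('g, 'm) monoid_scheme" (structure) and g :: "nat \<Rightarrow> 'g"
    and \<chi> :: "nat \<Rightarrow> 'g \<Rightarrow> 'k::field" +
  fixes q :: 'k
  assumes q_nonzero: "q \<noteq> 0" and q_neq_one: "q \<noteq> 1" and q_neq_minus_one: "q \<noteq> - 1"
    and chi_diag: "\<forall>i\<in>{1..n}. \<chi> i (g i) = q"
    and chi_next: "\<forall>i. 1 \<le> i \<and> i < n \<longrightarrow> \<chi> i (g (i + 1)) * \<chi> (i + 1) (g i) = inverse q"
    and chi_far: "\<forall>i\<in>{1..n}. \<forall>j\<in>{1..n}. \<bar>int i - int j\<bar> > 1 \<longrightarrow> \<chi> i (g j) * \<chi> j (g i) = 1"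
begin

lemma chi_adjacent:
  assumes "i \<in> {1..n}" "j \<in> {1..n}" "\<bar>int i - int j\<bar> = 1"
  shows "\<chi> i (g j) * \<chi> j (g i) = inverse q"
proof -
  consider "j = i + 1" | "i = j + 1" using assms(3) by linarith
  then show ?thesis
  proof cases
    case 1
    then show ?thesis using chi_next assms by simp
  next
    case 2
    then show ?thesis using chi_next[rule_format, of j] assms by (simp add: mult.commute)
  qed
qed

text \<open>The expansion of \<open>[x_i, [x_i, x_j]]\<close>. Both kinds of cubic relations are
  multiples of it, with \<open>i\<close> and \<open>j\<close> in either order.\<close>

definition serre :: "nat \<Rightarrow> nat \<Rightarrow> ('g, 'k) skew" where
  "serre i j = single (\<one>, [i, i, j]) 1
     - single (\<one>, [i, j, i]) ((1 + q) * \<chi> i (g j))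
     + single (\<one>, [j, i, i]) (q * (\<chi> i (g j))\<^sup>2)"

definition commutator :: "nat \<Rightarrow> nat \<Rightarrow> ('g, 'k) skew" where
  "commutator i j = single (\<one>, [i, j]) 1 - single (\<one>, [j, i]) (\<chi> i (g j))"

lemma bracket_var_var:
  assumes "i \<in> {1..n}" "j \<in> {1..n}"
  shows "bracket (var i) (var j) = commutator i j"
  using assms
  by (subst bracket_homog[OF var_homog var_homog]) (simp_all add: commutator_def word_def chi_one g_word_simps)

lemma commutator_homog: "i \<in> {1..n} \<Longrightarrow> j \<in> {1..n} \<Longrightarrow> commutator i j \<in> homog \<one> [i, j]"
  unfolding commutator_def by (intro homog_diff homog_single homog_cong[OF _ homog_single]) auto

lemmas lookup_simps = lookup_add lookup_minus lookup_single when_def lookup_scale_pm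

lemma bracket_var_bracket:
  assumes "i \<in> {1..n}" "j \<in> {1..n}" "i \<noteq> j"
  shows "bracket (var i) (bracket (var i) (var j)) = serre i j"
proof (rule poly_mapping_eqI)
  fix k
  show "lookup (bracket (var i) (bracket (var i) (var j))) k = lookup (serre i j) k"
    unfolding bracket_var_var[OF assms(1,2)] bracket_homog[OF var_homog[OF assms(1)] commutator_homog[OF assms(1,2)]]
    using assms chi_diag chi_mult[of i "g i" "g j"]
    by (auto simp: commutator_def serre_def word_def chi_one g_word_simps mul_linear lookup_simps algebra_simps power2_eq_square)
qed

text \<open>Both sides have the same three words. The scalar normalises the word
  \<open>[i, j, j]\<close>, and \<open>\<chi> i (g j) * \<chi> j (g i) * q = 1\<close> makes the
  remaining coefficients agree.\<close>

lemma bracket_bracket_var: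
  assumes "i \<in> {1..n}" "j \<in> {1..n}" "\<bar>int i - int j\<bar> = 1"
  shows "bracket (bracket (var i) (var j)) (var j) = scale_pm (q * (\<chi> i (g j))\<^sup>2) (serre j i)"
proof (rule poly_mapping_eqI)
  fix k
  have pp: "\<chi> i (g j) * \<chi> j (g i) * q = 1" using chi_adjacent[OF assms] q_nonzero by simp
  have e: "q * a\<^sup>2 * ((1 + q) * b) = (1 + q) * a * (a * b * q)" "q * a\<^sup>2 * (q * b\<^sup>2) = (a * b * q)\<^sup>2" for a b
    by (simp_all add: power2_eq_square algebra_simps)
  have 1: "q * (\<chi> i (g j))\<^sup>2 * ((1 + q) * \<chi> j (g i)) = (1 + q) * \<chi> i (g j)"
    "q * (\<chi> i (g j))\<^sup>2 * (q * (\<chi> j (g i))\<^sup>2) = 1"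
    by (simp_all only: e pp mult_1_right power_one)
  have "i \<noteq> j" using assms by auto
  then show "lookup (bracket (bracket (var i) (var j)) (var j)) k =
      lookup (scale_pm (q * (\<chi> i (g j))\<^sup>2) (serre j i)) k"
    unfolding bracket_var_var[OF assms(1,2)] bracket_homog[OF commutator_homog[OF assms(1,2)] var_homog[OF assms(2)]]
      serre_def pm.scale_right_distrib pm.scale_right_diff_distrib scale_pm_single 1
    using assms chi_diag
    by (auto simp: commutator_def word_def chi_one g_word_simps mul_linear lookup_simps algebra_simps power2_eq_square)
qed

section \<open>Skew primitivity of the relations and the Serre ideal\<close>

abbreviation tsgl where "tsgl a u b v \<equiv> single ((a, u), (b, v))"

lemma comult_word2:
  assumes "a \<in> {1..n}" "b \<in> {1..n}"
  shows "comult (sgl \<one> [a, b]) = tsgl \<one> [a, b] \<one> [] 1 + tsgl (g b) [a] \<one> [b] (\<chi> a (g b))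
    + tsgl (g a) [b] \<one> [a] 1 + tsgl (g a \<otimes> g b) [] \<one> [a, b] 1"
  using comult_snoc[of \<one> "[a]" b] comult_snoc[of \<one> "[]" a] assms
  by (simp add: comult_Nil comult_var_eq tmul_linear chi_one)

lemma comult_word3:
  assumes "a \<in> {1..n}" "b \<in> {1..n}" "c \<in> {1..n}"
  shows "comult (sgl \<one> [a, b, c]) =
      tsgl \<one> [a, b, c] \<one> [] 1 + tsgl (g c) [a, b] \<one> [c] (\<chi> a (g c) * \<chi> b (g c))
    + tsgl (g b) [a, c] \<one> [b] (\<chi> a (g b)) + tsgl (g b \<otimes> g c) [a] \<one> [b, c] (\<chi> a (g b) * \<chi> a (g c))
    + tsgl (g a) [b, c] \<one> [a] 1 + tsgl (g a \<otimes> g c) [b] \<one> [a, c] (\<chi> b (g c))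
    + tsgl (g a \<otimes> g b) [c] \<one> [a, b] 1 + tsgl (g a \<otimes> g b \<otimes> g c) [] \<one> [a, b, c] 1"
  using comult_snoc[of \<one> "[a, b]" c] assms
  by (simp add: comult_word2 comult_var_eq tmul_linear chi_one)

lemma comult_serre:
  assumes "i \<in> {1..n}" "j \<in> {1..n}" "\<bar>int i - int j\<bar> = 1"
  shows "comult (serre i j) = tensor (serre i j) (scalar 1) + tensor (grp (g i \<otimes> g i \<otimes> g j)) (serre i j)"
proof -
  define p p' where "p = \<chi> i (g j)" and "p' = \<chi> j (g i)"
  have serre': "serre i j = sgl \<one> [i, i, j] - scale_pm ((1 + q) * p) (sgl \<one> [i, j, i])
      + scale_pm (q * p\<^sup>2) (sgl \<one> [j, i, i])"
    by (simp add: serre_def p_def)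
  have d: "\<chi> i (g i) = q" "\<chi> j (g j) = q" "\<chi> i (g j) = p" "\<chi> j (g i) = p'"
    using assms chi_diag by (auto simp: p_def p'_def)
  have [simp]: "g i \<in> carrier G" "g j \<in> carrier G" using assms by auto
  have m: "g j \<otimes> g i = g i \<otimes> g j" "g i \<otimes> g j \<otimes> g i = g i \<otimes> g i \<otimes> g j"
    by (simp_all add: m_ac)
  have pp: "p * p' * q = 1" using chi_adjacent[OF assms] q_nonzero by (simp add: p_def p'_def)
  let ?G = "g i \<otimes> g i \<otimes> g j"
  \<comment> \<open>Of the six mixed terms three cancel identically. The others contain the factor
    \<open>1 - p * p' * q\<close>, up to sign, which is zero for neighbouring letters.\<close>
  have "comult (serre i j) = tensor (serre i j) (scalar 1) + tensor (grp ?G) (serre i j)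
    + tsgl (g j) [i, i] \<one> [j] (p * p - (1 + q) * p * p + q * p\<^sup>2)
    + tsgl (g i) [i, j] \<one> [i] (q + 1 - (1 + q) * p * (q * p'))
    + tsgl (g i \<otimes> g j) [i] \<one> [i, j] (q * p + p - (1 + q) * p)
    + tsgl (g i \<otimes> g i) [j] \<one> [i, i] (1 - (1 + q) * p * p' + q * p\<^sup>2 * (p' * p'))
    + tsgl (g i \<otimes> g j) [i] \<one> [j, i] (q * p\<^sup>2 * (q + 1) - (1 + q) * p * (p * q))
    + tsgl (g i) [j, i] \<one> [i] (q * p\<^sup>2 * (p' * q + p') - (1 + q) * p)"
    unfolding serre' klin_simps[OF klin_comult] tensor_simps1 tensor_simps2
    by (simp add: comult_word3[OF assms(1,1,2)] comult_word3[OF assms(1,2,1)] comult_word3[OF assms(2,1,1)] scalar_def grp_def d m pm.scale_right_distrib single_add single_diff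
        algebra_simps power2_eq_square)
  also have "p * p - (1 + q) * p * p + q * p\<^sup>2 = 0" by (simp add: algebra_simps power2_eq_square)
  also have "q * p + p - (1 + q) * p = 0" by (simp add: algebra_simps)
  also have "q * p\<^sup>2 * (q + 1) - (1 + q) * p * (p * q) = 0" by (simp add: algebra_simps power2_eq_square)
  also have "q + 1 - (1 + q) * p * (q * p') = (1 + q) * (1 - p * p' * q)" by (simp add: algebra_simps)
  also have "1 - (1 + q) * p * p' + q * p\<^sup>2 * (p' * p') = (1 - p * p' * q) * (1 - p * p')"
    by (simp add: algebra_simps power2_eq_square)
  also have "q * p\<^sup>2 * (p' * q + p') - (1 + q) * p = (1 + q) * p * (p * p' * q - 1)"
    by (simp add: algebra_simps power2_eq_square)
  finally show ?thesis by (simp add: pp)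
qed

lemma comult_commutator:
  assumes "i \<in> {1..n}" "j \<in> {1..n}" "\<bar>int i - int j\<bar> > 1"
  shows "comult (commutator i j) = tensor (commutator i j) (scalar 1) + tensor (grp (g i \<otimes> g j)) (commutator i j)"
proof -
  define p p' where "p = \<chi> i (g j)" and "p' = \<chi> j (g i)"
  have commutator': "commutator i j = sgl \<one> [i, j] - scale_pm p (sgl \<one> [j, i])"
    by (simp add: commutator_def p_def)
  have d: "\<chi> i (g j) = p" "\<chi> j (g i) = p'"
    using assms by (auto simp: p_def p'_def)
  have [simp]: "g i \<in> carrier G" "g j \<in> carrier G" using assms by auto
  have pp: "p * p' = 1" using chi_far assms by (simp add: p_def p'_def)
  have "comult (commutator i j) = tensor (commutator i j) (scalar 1) + tensor (grp (g i \<otimes> g j)) (commutator i j)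
    + tsgl (g j) [i] \<one> [j] (p - p) + tsgl (g i) [j] \<one> [i] (1 - p * p')"
    unfolding commutator' klin_simps[OF klin_comult] tensor_simps1 tensor_simps2
    by (simp add: comult_word2[OF assms(1,2)] comult_word2[OF assms(2,1)] scalar_def grp_def d m_comm[of "g j" "g i"] pm.scale_right_distrib
        single_diff algebra_simps)
  then show ?thesis by (simp add: pp)
qed

definition serre_gens :: "('g, 'k) skew set" where
  "serre_gens = {bracket (bracket (var i) (var (i + 1))) (var (i + 1)) | i. 1 \<le> i \<and> i < n} \<union>
      {bracket (var i) (bracket (var i) (var (i + 1))) | i. 1 \<le> i \<and> i < n} \<union>
      {bracket (var i) (var j) | i j. i \<in> {1..n} \<and> j \<in> {1..n} \<and> \<bar>int i - int j\<bar> > 1}"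

lemma serre_decomposable: "i \<in> {1..n} \<Longrightarrow> j \<in> {1..n} \<Longrightarrow> serre i j \<in> decomposables"
  and commutator_decomposable: "i \<in> {1..n} \<Longrightarrow> j \<in> {1..n} \<Longrightarrow> commutator i j \<in> decomposables"
proof -
  have "single (\<one>, u) c \<in> decomposables" if "u \<in> letters" "2 \<le> length u" for u c
    using that unfolding decomposables_def by auto
  then show "i \<in> {1..n} \<Longrightarrow> j \<in> {1..n} \<Longrightarrow> serre i j \<in> decomposables"
    "i \<in> {1..n} \<Longrightarrow> j \<in> {1..n} \<Longrightarrow> commutator i j \<in> decomposables"
    unfolding serre_def commutator_def
    by (intro ideal_skewD(3)[OF ideal_decomposables] ideal_diff[OF ideal_decomposables]; simp)+
qed

lemma serre_gens_cases:
  assumes "x \<in> serre_gens"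
  obtains (serre) i j c where "i \<in> {1..n}" "j \<in> {1..n}" "\<bar>int i - int j\<bar> = 1" "x = scale_pm c (serre i j)"
  | (commutator) i j where "i \<in> {1..n}" "j \<in> {1..n}" "\<bar>int i - int j\<bar> > 1" "x = commutator i j"
proof -
  from assms consider
      (1) i where "1 \<le> i" "i < n" "x = bracket (bracket (var i) (var (i + 1))) (var (i + 1))"
    | (2) i where "1 \<le> i" "i < n" "x = bracket (var i) (bracket (var i) (var (i + 1)))"
    | (3) i j where "i \<in> {1..n}" "j \<in> {1..n}" "\<bar>int i - int j\<bar> > 1" "x = bracket (var i) (var j)"
    unfolding serre_gens_def by blast
  then show thesis
  proof cases
    case 1
    then show thesis using serre[of "i + 1" i "q * (\<chi> i (g (i + 1)))\<^sup>2"] bracket_bracket_var[of i "i + 1"] by simp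
  next
    case 2
    then show thesis using serre[of i "i + 1" 1] bracket_var_bracket[of i "i + 1"] by simp
  next
    case 3
    then show thesis using commutator[of i j] bracket_var_var[of i j] by simp
  qed
qed

text \<open>Every generator is a multiple of some \<open>serre i j\<close> or a
  \<open>commutator\<close>, hence skew primitive, and \<open>hopf_ideal_genideal\<close> applies.
  For \<open>serre i j\<close> with \<open>i = j + 1\<close> the relation in the other bracketing is
  used, with its unit \<open>c\<close> divided out.\<close>

lemma serre_ideal: "hopf_ideal serre_ideal" "serre_ideal \<subseteq> decomposables"
  "\<And>i j. i \<in> {1..n} \<Longrightarrow> j \<in> {1..n} \<Longrightarrow> \<bar>int i - int j\<bar> = 1 \<Longrightarrow> serre i j \<in> serre_ideal"
  "\<And>i j. i \<in> {1..n} \<Longrightarrow> j \<in> {1..n} \<Longrightarrow> \<bar>int i - int j\<bar> > 1 \<Longrightarrow> commutator i j \<in> serre_ideal"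
proof -
  have eq: "serre_ideal = genideal \<H> serre_gens"
    unfolding serre_ideal_def serre_gens_def ..
  have dec: "serre_gens \<subseteq> decomposables"
  proof
    fix x assume "x \<in> serre_gens"
    then show "x \<in> decomposables"
      by (cases rule: serre_gens_cases)
        (simp_all add: ideal_scale[OF ideal_decomposables] serre_decomposable commutator_decomposable)
  qed
  have prim: "\<exists>a\<in>carrier G. comult x = tensor x (scalar 1) + tensor (grp a) x" if "x \<in> serre_gens" for x
    using that
  proof (cases rule: serre_gens_cases)
    case (serre i j c)
    then show ?thesis
      by (intro bexI[of _ "g i \<otimes> g i \<otimes> g j"])
        (simp_all add: klin_simps[OF klin_comult] tensor_simps1 tensor_simps2 comult_serre pm.scale_right_distrib)
  next
    case (commutator i j)
    then show ?thesis
      by (intro bexI[of _ "g i \<otimes> g j"]) (simp_all add: comult_commutator)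
  qed
  show "hopf_ideal serre_ideal" "serre_ideal \<subseteq> decomposables"
    unfolding eq by (rule hopf_ideal_genideal[OF dec prim]; assumption)+
  have I: "ideal serre_ideal \<H>"
    unfolding eq using dec by (intro H.genideal_ideal) (auto simp: decomposables_def)
  have self: "x \<in> serre_ideal" if "x \<in> serre_gens" for x
    unfolding eq using dec that by (intro subsetD[OF H.genideal_self]) (auto simp: decomposables_def)
  fix i j assume ij: "i \<in> {1..n}" "j \<in> {1..n}"
  show "serre i j \<in> serre_ideal" if adj: "\<bar>int i - int j\<bar> = 1"
  proof -
    consider "j = i + 1" | "i = j + 1" using adj by linarith
    then show ?thesis
    proof cases
      case 1
      then show ?thesis
        using ij by (intro self) (auto simp: serre_gens_def bracket_var_bracket[symmetric])
    next
      case 2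
      define c where "c = q * (\<chi> j (g i))\<^sup>2"
      have c: "c \<noteq> 0" using q_nonzero chi_simps(1)[OF ij(2)] ij by (simp add: c_def)
      have "1 \<le> j \<and> j < n" using ij 2 by simp
      then have "bracket (bracket (var j) (var i)) (var i) \<in> serre_gens"
        unfolding serre_gens_def 2 by blast
      then have "scale_pm c (serre i j) \<in> serre_gens"
        using ij adj by (simp add: bracket_bracket_var c_def)
      then have "scale_pm (inverse c) (scale_pm c (serre i j)) \<in> serre_ideal"
        by (intro ideal_scale[OF I] self)
      then show ?thesis using c by simp
    qed
  qed
  show "commutator i j \<in> serre_ideal" if "\<bar>int i - int j\<bar> > 1"
    using ij that by (intro self) (auto simp: serre_gens_def bracket_var_var[symmetric])
qed

end

section \<open>Invariant subalgebras have interval root sets\<close>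

declare upt_Suc [simp del] mset_upt [simp del]

lemma upt_singleton [simp]: "[m..<Suc m] = [m]"
  by (simp add: upt_Suc)

locale quantum_sl_quotient = quantum_sl n G g \<chi> q + skew_hopf_quotient n G g \<chi> I
  for n :: nat and G :: "('g, 'm) monoid_scheme" (structure) and g :: "nat \<Rightarrow> 'g"
    and \<chi> :: "nat \<Rightarrow> 'g \<Rightarrow> 'k::field" and q :: 'k and I +
  assumes serre_I: "serre_ideal \<subseteq> I"
begin

section \<open>The symmetrised pairing of a letter with a degree\<close>

lemma pairing_Cons:
  assumes "i \<in> {1..n}" "j \<in> {1..n}" "v \<in> letters"
  shows "\<chi> i (g_word (j # v)) * chi_word (j # v) (g i) =
    (\<chi> i (g j) * \<chi> j (g i)) * (\<chi> i (g_word v) * chi_word v (g i))"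
  using assms by (simp add: g_word_simps chi_mult)

lemma pairing_far:
  assumes "i \<in> {1..n}" "v \<in> letters" "\<And>j. j \<in> set v \<Longrightarrow> \<bar>int i - int j\<bar> > 1"
  shows "\<chi> i (g_word v) * chi_word v (g i) = 1"
  using assms(2,3)
proof (induction v)
  case Nil
  then show ?case using assms(1) by (simp add: g_word_simps chi_one)
next
  case (Cons j v)
  note j = Cons.hyps
  have "\<bar>int i - int j\<bar> > 1" using Cons.prems[of j] by simp
  then have "\<chi> i (g j) * \<chi> j (g i) = 1" using chi_far assms(1) j by blast
  moreover have "\<chi> i (g_word v) * chi_word v (g i) = 1" using Cons.IH Cons.prems by simp
  ultimately show ?case unfolding pairing_Cons[OF assms(1) j(1,2)] by simp
qed

lemma interval_letters [simp]: "1 \<le> k \<Longrightarrow> m \<le> n \<Longrightarrow> [k..<Suc m] \<in> letters"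
  by auto

lemma upt_Cons: "k \<le> m \<Longrightarrow> [k..<Suc m] = k # [Suc k..<Suc m]"
  by (rule upt_conv_Cons) simp

lemma upt_split: "k \<le> s \<Longrightarrow> s < m \<Longrightarrow> [k..<Suc m] = [k..<Suc s] @ [Suc s..<Suc m]"
  using upt_add_eq_append[of k "Suc s" "m - s"] by simp

text \<open>The pairing is multiplicative in the degree and trivial for distant letters, so only
  \<open>k + 1\<close> contributes.\<close>

lemma pairing_below:
  assumes "1 \<le> k" "Suc k \<le> m" "m \<le> n"
  shows "\<chi> k (g_word [Suc k..<Suc m]) * chi_word [Suc k..<Suc m] (g k) = inverse q"
proof -
  have far: "\<chi> k (g_word [Suc (Suc k)..<Suc m]) * chi_word [Suc (Suc k)..<Suc m] (g k) = 1"
    using assms by (intro pairing_far interval_letters) auto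
  show ?thesis
    unfolding upt_Cons[OF assms(2)]
    using assms far chi_adjacent[of k "Suc k"] by (subst pairing_Cons) auto
qed

text \<open>Here only the last letter \<open>m\<close> contributes. As the pairing depends on the
  degree alone, the word is rearranged to begin with \<open>m\<close>.\<close>

lemma pairing_above:
  assumes "1 \<le> k" "k \<le> m" "Suc m \<le> n"
  shows "\<chi> (Suc m) (g_word [k..<Suc m]) * chi_word [k..<Suc m] (g (Suc m)) = inverse q"
proof -
  have far: "\<chi> (Suc m) (g_word [k..<m]) * chi_word [k..<m] (g (Suc m)) = 1"
    using assms by (intro pairing_far) auto
  have eq: "mset (m # [k..<m]) = mset [k..<Suc m]" using assms(2) by (simp add: upt_Suc)
  have "m # [k..<m] \<in> letters" using assms by auto
  then have "g_word [k..<Suc m] = g_word (m # [k..<m])" "chi_word [k..<Suc m] = chi_word (m # [k..<m])"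
    using g_word_mset[OF eq] chi_word_mset[OF eq] by auto
  moreover have "Suc m \<in> {1..n}" "m \<in> {1..n}" "[k..<m] \<in> letters" using assms by auto
  ultimately show ?thesis
    using far chi_adjacent[of "Suc m" m] pairing_Cons[of "Suc m" m "[k..<m]"] by simp
qed

lemma one_minus_inverse_q: "1 - inverse q \<noteq> 0"
  using q_neq_one by simp

section \<open>Nonvanishing of the elements \<open>Psi\<close>\<close>

lemma u_elem_single [simp]: "u_elem k k = var k"
  by (subst u_elem.simps) simp

lemma u_elem_step: "k < m \<Longrightarrow> u_elem k m = bracket (var k) (u_elem (Suc k) m)"
  by (subst u_elem.simps) simp

lemma u_elem_homog: "1 \<le> k \<Longrightarrow> k \<le> m \<Longrightarrow> m \<le> n \<Longrightarrow> u_elem k m \<in> homog \<one> [k..<Suc m]"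
proof (induction "m - k" arbitrary: k)
  case 0
  then show ?case by simp
next
  case (Suc d)
  then have "k < m" by simp
  then have "bracket (var k) (u_elem (Suc k) m) \<in> homog \<one> ([k] @ [Suc k..<Suc m])"
    using Suc by (intro bracket_in_homog var_homog) auto
  then show ?case using \<open>k < m\<close> by (simp add: u_elem_step upt_Cons)
qed

lemma Psi_list_homog:
  assumes "1 \<le> k" "k \<le> m" "m \<le> n" "sorted_wrt (<) ss" "set ss \<subseteq> {k..<m}"
  shows "Psi_list k m ss \<in> homog \<one> [k..<Suc m]"
  using assms
proof (induction ss arbitrary: k)
  case Nil
  then show ?case by (simp add: u_elem_homog)
next
  case (Cons s ss)
  have s: "k \<le> s" "s < m" using Cons.prems by auto
  have "set ss \<subseteq> {Suc s..<m}" using Cons.prems by fastforce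
  then have A: "Psi_list (Suc s) m ss \<in> homog \<one> [Suc s..<Suc m]"
    using Cons.IH[of "Suc s"] Cons.prems s by simp
  have B: "u_elem k s \<in> homog \<one> [k..<Suc s]" using u_elem_homog Cons.prems s by simp
  show ?case
    using homog_cong[OF _ bracket_in_homog[OF A B], of "[k..<Suc m]"]
    by (simp add: upt_split[OF s])
qed

text \<open>\<open>x_i\<close> is stripped by \<open>der_r\<close> when it is the left argument and
  by \<open>der_l\<close> when it is the right one. Both leave \<open>A\<close> with the factor
  \<open>1 - inverse q\<close>, the first also with a group element in front.\<close>

lemma detects_bracket_var:
  assumes A: "A \<in> homog \<one> v" "v \<in> letters" "detects v A" and i: "i \<in> {1..n}" "i \<notin> set v"
    and p: "\<chi> i (g_word v) * chi_word v (g i) = inverse q"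
  shows "detects (i # v) (bracket (var i) A)" "detects (i # v) (bracket A (var i))"
proof -
  show "detects (i # v) (bracket (var i) A)"
    using detects_der_r[OF der_r_bracket_var[OF A(1,2) i]] p one_minus_inverse_q A homog_carrier[OF A(1)] i by simp
  show "detects (i # v) (bracket A (var i))"
    using detects_der_l[OF der_l_bracket_var[OF A(1,2) i]] p one_minus_inverse_q A by simp
qed

text \<open>The letter stripped is always the lowest, \<open>k\<close>, which occurs once. Without
  cuts it is the outermost left argument; if the first cut is \<open>k\<close>, it is the outermost
  right argument; otherwise it sits inside \<open>u_elem k s\<close>, where
  \<open>der_r_bracket\<close> reaches it. What remains is an element of the same kind on
  \<open>[k + 1, m]\<close>, with a cut at \<open>k\<close> dropped.\<close>

lemma Psi_list_detects:
  assumes "1 \<le> k" "k \<le> m" "m \<le> n" "sorted_wrt (<) ss" "set ss \<subseteq> {k..<m}"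
  shows "detects [k..<Suc m] (Psi_list k m ss)"
  using assms
proof (induction "m - k" arbitrary: k ss)
  case 0
  then have "k = m" "ss = []" by auto
  then show ?case using detects_var[of m] 0 by simp
next
  case (Suc d)
  have km: "k < m" "Suc k \<le> m" and k: "k \<in> {1..n}" using Suc.hyps Suc.prems by auto
  have IH: "detects [Suc k..<Suc m] (Psi_list (Suc k) m ss')"
    if "sorted_wrt (<) ss'" "set ss' \<subseteq> {Suc k..<m}" for ss'
    using Suc.hyps(1)[of "Suc k" ss'] Suc.hyps(2) Suc.prems km that by simp
  have upt: "[k..<Suc m] = k # [Suc k..<Suc m]" using km by (intro upt_Cons) simp
  note pair = pairing_below[OF Suc.prems(1) km(2) Suc.prems(3)]
  show ?case
  proof (cases ss)
    case Nil
    then show ?thesis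
      using detects_bracket_var(1)[OF u_elem_homog interval_letters _ k _ pair] IH[of "[]"] Suc.prems km
      by (simp add: u_elem_step upt)
  next
    case (Cons s ss')
    have s: "k \<le> s" "s < m" and ss': "sorted_wrt (<) ss'" "set ss' \<subseteq> {Suc s..<m}"
      using Suc.prems Cons by fastforce+
    show ?thesis
    proof (cases "s = k")
      case True
      have "Psi_list (Suc k) m ss' \<in> homog \<one> [Suc k..<Suc m]"
        using Suc.prems km ss' True by (intro Psi_list_homog) auto
      then have "detects (k # [Suc k..<Suc m]) (bracket (Psi_list (Suc k) m ss') (var k))"
        using ss' True Suc.prems km by (intro detects_bracket_var(2) interval_letters IH k pair) auto
      then show ?thesis using Cons True by (simp add: upt)
    next
      case False
      then have ks: "k < s" "Suc k \<le> s" using s by auto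
      have A: "Psi_list (Suc s) m ss' \<in> homog \<one> [Suc s..<Suc m]"
        using Suc.prems s ss' by (intro Psi_list_homog) auto
      have B: "u_elem k s \<in> homog \<one> (k # [Suc k..<Suc s])"
        using u_elem_homog[of k s] upt_Cons[OF s(1)] Suc.prems s by simp
      have B': "u_elem (Suc k) s \<in> homog \<one> [Suc k..<Suc s]"
        using Suc.prems s ks by (intro u_elem_homog) auto
      have l: "[Suc s..<Suc m] \<in> letters" "[Suc k..<Suc s] \<in> letters" "k \<notin> set [Suc s..<Suc m]" "k \<notin> set [Suc k..<Suc s]"
        using Suc.prems s by auto
      have "der_r k (u_elem k s) = scale_pm (1 - inverse q) (grp (g k) \<star> u_elem (Suc k) s)"
        unfolding u_elem_step[OF ks(1)] der_r_bracket_var[OF B' l(2) k l(4)]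
        using pairing_below[of k s] Suc.prems ks s by simp
      then have "der_r k (bracket (Psi_list (Suc s) m ss') (u_elem k s)) =
          scale_pm ((1 - inverse q) * chi_word [Suc s..<Suc m] (g k))
            (grp (g k) \<star> bracket (Psi_list (Suc s) m ss') (u_elem (Suc k) s))"
        by (rule der_r_bracket[OF A l(1) B l(2) B' k l(3)])
      moreover have "(1 - inverse q) * chi_word [Suc s..<Suc m] (g k) \<noteq> 0"
        using one_minus_inverse_q chi_word_nonzero[OF l(1), of "g k"] k by simp
      moreover have "detects [Suc k..<Suc m] (bracket (Psi_list (Suc s) m ss') (u_elem (Suc k) s))"
        using IH[of "s # ss'"] Cons Suc.prems ks by fastforce
      moreover have "bracket (Psi_list (Suc s) m ss') (u_elem (Suc k) s) \<in> carrier \<H>"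
        using bracket_in_homog[OF A B'] by (rule homog_carrier)
      ultimately have "detects (k # [Suc k..<Suc m]) (bracket (Psi_list (Suc s) m ss') (u_elem k s))"
        using k by (intro detects_der_r[of k _ _ "g k"]) auto
      then show ?thesis using Cons by (simp add: upt)
    qed
  qed
qed

end

locale quantum_sl_theta = quantum_sl_quotient n G g \<chi> q I + theta_sequence n \<theta>
  for n :: nat and G :: "('g, 'm) monoid_scheme" (structure) and g :: "nat \<Rightarrow> 'g"
    and \<chi> :: "nat \<Rightarrow> 'g \<Rightarrow> 'k::field" and q :: 'k and I and \<theta> :: "nat \<Rightarrow> nat"
begin

section \<open>The generators of \<open>U\<close> and the degrees that occur in it\<close>

abbreviation gen where "gen k m \<equiv> grp (inv (g_word [k..<Suc m])) \<star> Psi (T k) k m"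

definition U_gens :: "('g, 'k) skew set" where
  "U_gens = {gen k m | k m. 1 \<le> k \<and> k \<le> m \<and> m \<le> n \<and> m \<in> T k}"

lemma U1_eq: "U1 I \<theta> = subalgebra_gen I (proj I ` U_gens)"
proof -
  have "{proj I (grp (inv (g_word [k..<m + 1])) \<star> Psi (T_set n \<theta> k) k m) | k m.
      1 \<le> k \<and> k \<le> m \<and> m \<le> n \<and> m \<in> T_set n \<theta> k} = proj I ` U_gens"
    unfolding U_gens_def by auto
  then show ?thesis unfolding U1_def by simp
qed

lemma Psi_homog: "1 \<le> k \<Longrightarrow> k \<le> m \<Longrightarrow> m \<le> n \<Longrightarrow> Psi S k m \<in> homog \<one> [k..<Suc m]"
  unfolding Psi_def by (intro Psi_list_homog) auto

lemma Psi_detects: "1 \<le> k \<Longrightarrow> k \<le> m \<Longrightarrow> m \<le> n \<Longrightarrow> detects [k..<Suc m] (Psi S k m)"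
  unfolding Psi_def by (intro Psi_list_detects) auto

lemma U_gensE:
  assumes "s \<in> U_gens"
  obtains k m where "1 \<le> k" "k \<le> m" "m \<le> n" "m \<in> T k" "s = gen k m"
    "s \<in> homog (inv (g_word [k..<Suc m])) [k..<Suc m]"
proof -
  from assms obtain k m where *: "1 \<le> k" "k \<le> m" "m \<le> n" "m \<in> T k" "s = gen k m"
    unfolding U_gens_def by blast
  have a: "inv (g_word [k..<Suc m]) \<in> carrier G"
    using * by (intro inv_closed g_word_closed interval_letters)
  have "gen k m \<in> homog (inv (g_word [k..<Suc m]) \<otimes> \<one>) [k..<Suc m]"
    using * a by (intro homog_grp_mult Psi_homog)
  then show thesis using * that a by simp
qed

lemma U_gens_carrier: "U_gens \<subseteq> carrier \<H>"
  by (rule subsetI, erule U_gensE) (rule homog_carrier)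

lemma U_gens_homog: "s \<in> U_gens \<Longrightarrow> \<exists>a w. s \<in> homog a w"
  by (erule U_gensE) blast

text \<open>Sums of roots, with overlaps and repetitions allowed, as a product of generators may
  have any of these as its degree.\<close>

inductive_set tilings :: "nat multiset set" where
  empty: "{#} \<in> tilings"
| add: "X \<in> tilings \<Longrightarrow> 1 \<le> k \<Longrightarrow> m \<in> T k \<Longrightarrow> mset [k..<Suc m] + X \<in> tilings"

lemma tilings_add: "X \<in> tilings \<Longrightarrow> Y \<in> tilings \<Longrightarrow> X + Y \<in> tilings"
  by (induction X rule: tilings.induct) (auto simp: add.assoc simp del: upt_Suc intro: tilings.add)

text \<open>The sum of roots is commutative, so a root covering the prescribed letter can be taken
  out first.\<close>

lemma tilings_remove:
  assumes "X \<in> tilings" "i \<in># X"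
  shows "\<exists>k m Y. 1 \<le> k \<and> k \<le> i \<and> i \<le> m \<and> m \<in> T k \<and> Y \<in> tilings \<and> X = mset [k..<Suc m] + Y"
  using assms
proof (induction X rule: tilings.induct)
  case (add X k m)
  show ?case
  proof (cases "i \<in># mset [k..<Suc m]")
    case True
    then have "k \<le> i" "i \<le> m" by auto
    then show ?thesis using add.hyps by blast
  next
    case False
    then have "i \<in># X" using add.prems by auto
    then obtain k' m' Y where *: "1 \<le> k'" "k' \<le> i" "i \<le> m'" "m' \<in> T k'" "Y \<in> tilings" "X = mset [k'..<Suc m'] + Y"
      using add.IH by blast
    have "mset [k..<Suc m] + X = mset [k'..<Suc m'] + (mset [k..<Suc m] + Y)"
      unfolding *(6) by (simp only: ac_simps)
    then show ?thesis using * tilings.add[OF *(5) add.hyps(2,3)] by blast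
  qed
qed simp

text \<open>This is where the closedness of the set of roots \<open>[k, m]\<close>, \<open>m \<in> T\<^sub>k\<close>, enters.\<close>

lemma tilings_interval: "1 \<le> k \<Longrightarrow> k \<le> l \<Longrightarrow> mset [k..<Suc l] \<in> tilings \<Longrightarrow> l \<in> T k"
proof (induction "l - k" arbitrary: k rule: less_induct)
  case less
  \<comment> \<open>The root that covers the smallest letter \<open>k\<close> must start there. If
    it ends at \<open>m < l\<close>, what remains is the interval from \<open>m + 1\<close> to
    \<open>l\<close>, and closedness joins the two.\<close>
  have "k \<in># mset [k..<Suc l]" using less.prems by simp
  then obtain k' m Y where *: "1 \<le> k'" "k' \<le> k" "k \<le> m" "m \<in> T k'" "Y \<in> tilings"
    "mset [k..<Suc l] = mset [k'..<Suc m] + Y"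
    using tilings_remove[OF less.prems(3)] by blast
  have sub: "set [k'..<Suc m] \<subseteq> set [k..<Suc l]"
    using arg_cong[OF *(6), of set_mset] by simp
  have "k' \<in> set [k'..<Suc m]" "m \<in> set [k'..<Suc m]" using *(2,3) by auto
  then have "k' \<in> set [k..<Suc l]" "m \<in> set [k..<Suc l]" using sub by blast+
  then have k': "k' = k" and m: "m \<le> l" using *(2) by auto
  show ?case
  proof (cases "m = l")
    case True
    then show ?thesis using * k' by simp
  next
    case False
    then have "mset [k..<Suc l] = mset [k..<Suc m] + mset [Suc m..<Suc l]"
      using upt_split[of k m l] *(3) m by simp
    then have "Y = mset [Suc m..<Suc l]" using *(6) k' by simp
    then have "l \<in> T (Suc m)" using less.hyps[of "Suc m"] *(3,5) m False by auto
    then show ?thesis using T_closed[of k m l] * k' by simp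
  qed
qed

lemma alg_U_keys: "f \<in> alg U_gens \<Longrightarrow> p \<in> keys f \<Longrightarrow> mset (snd p) \<in> tilings"
proof -
  assume f: "f \<in> alg U_gens"
  have "\<forall>p\<in>keys f. mset (snd p) \<in> tilings"
    using f U_gens_carrier
  proof (induction rule: alg_induct)
    case (scalar c)
    then show ?case by (simp add: scalar_def tilings.empty)
  next
    case (gen s)
    then obtain k m where "1 \<le> k" "m \<in> T k" "s \<in> homog (inv (g_word [k..<Suc m])) [k..<Suc m]"
      by (rule U_gensE)
    then show ?case using tilings.add[OF tilings.empty, of k m] by (simp add: homog_def)
  next
    case (add f h)
    then show ?case using Poly_Mapping.keys_add[of f h] by blast
  next
    case (mult f h)
    then show ?case by (fastforce elim!: keys_mul intro: tilings_add)
  qed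
  then show "p \<in> keys f \<Longrightarrow> mset (snd p) \<in> tilings" by blast
qed

text \<open>Modulo \<open>I\<close>, \<open>f\<close> is represented by an element all of whose
  degrees are tilings. For \<open>w\<close> outside \<open>tilings\<close> the functional would
  vanish on this representative and on the difference.\<close>

lemma detects_Alg_U:
  assumes "detects w f" "f \<in> Alg U_gens"
  shows "mset w \<in> tilings"
proof (rule ccontr)
  assume w: "mset w \<notin> tilings"
  obtain h where h: "h \<in> alg U_gens" "f - h \<in> I" using assms(2) by (auto simp: Alg_def)
  obtain F where F: "module_hom scale_pm (*) F" "\<And>h. h \<in> I \<Longrightarrow> F h = 0"
    "\<And>h. h \<in> carrier \<H> \<Longrightarrow> (\<forall>p\<in>keys h. mset (snd p) \<noteq> mset w) \<Longrightarrow> F h = 0" "F f \<noteq> 0"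
    using assms(1) unfolding detects_def by auto
  have "\<forall>p\<in>keys h. mset (snd p) \<noteq> mset w"
    using alg_U_keys[OF h(1)] w by metis
  then have "F h = 0"
    using alg_carrier[OF U_gens_carrier] h(1) by (intro F(3)) auto
  moreover have "F (f - h) = 0" using F(2) h(2) by blast
  ultimately show False using F(4) module_hom.diff[OF F(1), of f h] by simp
qed

text \<open>Treats both ends of the interval at once: the premise \<open>p\<close> holds for the
  letter just above it as well as for the one just below.\<close>

lemma invariant_step:
  assumes inv: "ad_stable U_gens"
    and k: "1 \<le> k" "k \<le> m" "m \<le> n" "m \<in> T k" and i: "i \<in> {1..n}" "i \<notin> set [k..<Suc m]"
    and p: "\<chi> i (g_word [k..<Suc m]) * chi_word [k..<Suc m] (g i) = inverse q"
  shows "mset (i # [k..<Suc m]) \<in> tilings"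
proof (rule detects_Alg_U)
  let ?w = "[k..<Suc m]"
  have w: "?w \<in> letters" "i # ?w \<in> letters" using k i by auto
  note P = Psi_homog[OF k(1-3), of "T k"]
  have "gen k m \<in> U_gens" using k unfolding U_gens_def by blast
  then have "gen k m \<in> Alg U_gens" by (rule Alg_gen[OF U_gens_carrier])
  then show "ad_var i (gen k m) \<in> Alg U_gens" using inv i by blast
  have "bracket (var i) (Psi (T k) k m) \<in> carrier \<H>"
    using bracket_in_homog[OF var_homog[OF i(1)] P] by (rule homog_carrier)
  then show "detects (i # ?w) (ad_var i (gen k m))"
    unfolding homog_scalar_ad_var[OF P w(1) i(1)]
    using w chi_simps(1)[OF i(1) g_word_closed[OF w(1)]] detects_bracket_var(1)[OF P w(1) Psi_detects[OF k(1-3)] i p]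
    by (intro detects_scale detects_grp) auto
qed

lemma invariant_imp_intervals:
  assumes inv: "ad_stable U_gens"
  shows intervals
proof (rule intervalsI)
  fix k m assume k: "1 \<le> k" "m \<in> T k" "m < n"
  have km: "k \<le> m" using T_bounds k by blast
  have "mset (Suc m # [k..<Suc m]) \<in> tilings"
    using k km by (intro invariant_step[OF inv] pairing_above) auto
  moreover have "mset (Suc m # [k..<Suc m]) = mset [k..<Suc (Suc m)]" using km by (simp add: upt_Suc)
  ultimately show "m + 1 \<in> T k" using tilings_interval[of k "Suc m"] k km by simp
next
  fix k m assume k: "1 < k" "m \<in> T k"
  have km: "k \<le> m" "m \<le> n" using T_bounds[of k m] k by auto
  obtain k' where k': "k = Suc k'" "1 \<le> k'" using k(1) by (cases k) auto
  have "mset (k' # [Suc k'..<Suc m]) \<in> tilings"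
    using k k' km by (intro invariant_step[OF inv] pairing_below) auto
  then have "m \<in> T k'" using tilings_interval[of k' m] upt_Cons[of k' m] k' km by simp
  then show "m \<in> T (k - 1)" using k' by simp
qed

end

section \<open>Interval root sets give invariant subalgebras\<close>

context quantum_sl_quotient
begin

lemma serre_in_I: "i \<in> {1..n} \<Longrightarrow> j \<in> {1..n} \<Longrightarrow> \<bar>int i - int j\<bar> = 1 \<Longrightarrow> serre i j \<in> I"
  and commutator_in_I: "i \<in> {1..n} \<Longrightarrow> j \<in> {1..n} \<Longrightarrow> \<bar>int i - int j\<bar> > 1 \<Longrightarrow> commutator i j \<in> I"
  using serre_I serre_ideal(3,4) by blast+

lemma conjugate_one: "f \<in> carrier \<H> \<Longrightarrow> conjugate \<one> f = f"
  by (simp add: conjugate_def grp_def flip: one_skew)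

lemma ad_r_word:
  assumes "u \<in> letters" "f \<in> carrier \<H>"
  shows "ad_r (single (\<one>, u) c) f = scale_pm c (ad_word u f)"
  using klin_simps(5)[OF klin_ad_r, of c "sgl \<one> u" f] assms by (simp add: ad_r_single conjugate_one)

section \<open>Relations between the operators\<close>

lemma ad_word_serre:
  assumes "i \<in> {1..n}" "j \<in> {1..n}" "\<bar>int i - int j\<bar> = 1" "f \<in> carrier \<H>"
  shows "ad_word [i, i, j] f - scale_pm ((1 + q) * \<chi> i (g j)) (ad_word [i, j, i] f)
    + scale_pm (q * (\<chi> i (g j))\<^sup>2) (ad_word [j, i, i] f) \<in> I"
proof -
  have "ad_r (serre i j) f = ad_word [i, i, j] f - scale_pm ((1 + q) * \<chi> i (g j)) (ad_word [i, j, i] f)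
    + scale_pm (q * (\<chi> i (g j))\<^sup>2) (ad_word [j, i, i] f)"
    using assms unfolding serre_def klin_simps[OF klin_ad_r] by (subst (1 2 3) ad_r_word) auto
  then show ?thesis using ad_r_I_left[OF serre_in_I[OF assms(1-3)] assms(4)] by simp
qed

lemma ad_word_commutator:
  assumes "i \<in> {1..n}" "j \<in> {1..n}" "\<bar>int i - int j\<bar> > 1" "f \<in> carrier \<H>"
  shows "ad_word [i, j] f - scale_pm (\<chi> i (g j)) (ad_word [j, i] f) \<in> I"
proof -
  have "ad_r (commutator i j) f = ad_word [i, j] f - scale_pm (\<chi> i (g j)) (ad_word [j, i] f)"
    using assms unfolding commutator_def klin_simps[OF klin_ad_r] by (subst (1 2) ad_r_word) auto
  then show ?thesis using ad_r_I_left[OF commutator_in_I[OF assms(1-3)] assms(4)] by simp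
qed

lemma I_scale_iff: "c \<noteq> 0 \<Longrightarrow> scale_pm c f \<in> I \<longleftrightarrow> f \<in> I"
  using I_scale[of f c] I_scale[of "scale_pm c f" "inverse c"] by (metis pm.scale_left_imp_eq pm.scale_one pm.scale_scale left_inverse)

lemma I_cong:
  assumes "f - h \<in> I"
  shows "f \<in> I \<longleftrightarrow> h \<in> I"
proof
  show "h \<in> I" if "f \<in> I" using I_diff[OF that assms] by simp
  show "f \<in> I" if "h \<in> I" using I_add[OF assms that] by simp
qed

definition annihilates :: "nat list \<Rightarrow> ('g, 'k) skew \<Rightarrow> bool" where
  "annihilates w f \<longleftrightarrow> ad_word w f \<in> I"

lemma annihilates_append: "annihilates w f \<Longrightarrow> v \<in> letters \<Longrightarrow> annihilates (w @ v) f"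
  unfolding annihilates_def by (simp add: I_ad_word)

text \<open>One outer term of the Serre relation lies in \<open>I\<close> by assumption, and the
  other two have nonzero coefficients, the middle one because \<open>1 + q\<close> is
  nonzero.\<close>

lemma annihilates_serre:
  assumes "i \<in> {1..n}" "j \<in> {1..n}" "\<bar>int i - int j\<bar> = 1" "w \<in> letters" "f \<in> carrier \<H>"
    and "annihilates (w @ [i]) f \<or> annihilates (w @ [i, i, j]) f"
  shows "annihilates (w @ [i, j, i]) f \<longleftrightarrow> annihilates (w @ [j, i, i]) f"
proof -
  have p: "(1 + q) * \<chi> i (g j) \<noteq> 0" "q * (\<chi> i (g j))\<^sup>2 \<noteq> 0"
    using q_nonzero q_neq_minus_one chi_simps(1)[of i "g j"] assms(1,2)
    by (auto simp: add_eq_0_iff minus_equation_iff)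
  have 0: "ad_word (w @ [i, i, j]) f \<in> I"
    using assms(6) annihilates_append[of "w @ [i]" f "[i, j]"] assms(1,2) by (auto simp: annihilates_def)
  have e: "x - y + z - x = z - y" for x y z :: "('g, 'k) skew" by simp
  have "ad_word (w @ [i, i, j]) f - scale_pm ((1 + q) * \<chi> i (g j)) (ad_word (w @ [i, j, i]) f)
    + scale_pm (q * (\<chi> i (g j))\<^sup>2) (ad_word (w @ [j, i, i]) f) \<in> I"
    using ad_word_serre[OF assms(1-3), of "ad_word w f"] assms(4,5) by simp
  then have "scale_pm (q * (\<chi> i (g j))\<^sup>2) (ad_word (w @ [j, i, i]) f) -
      scale_pm ((1 + q) * \<chi> i (g j)) (ad_word (w @ [i, j, i]) f) \<in> I"
    using I_diff[of _ "ad_word (w @ [i, i, j]) f"] 0 e by metis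
  from I_cong[OF this] show ?thesis
    unfolding annihilates_def I_scale_iff[OF p(1)] I_scale_iff[OF p(2)] by simp
qed

text \<open>Operators with distant indices commute up to a unit; \<open>c\<close> is the product of
  the units \<open>\<chi> j (g i)\<close> over the letters \<open>j\<close> of
  \<open>v\<close>.\<close>

lemma ad_word_move:
  assumes "i \<in> {1..n}" "v \<in> letters" "\<And>j. j \<in> set v \<Longrightarrow> \<bar>int i - int j\<bar> > 1" "f \<in> carrier \<H>"
  shows "\<exists>c. c \<noteq> 0 \<and> ad_word (v @ [i]) f - scale_pm c (ad_word (i # v) f) \<in> I"
  using assms(2-4)
proof (induction v arbitrary: f rule: list.induct)
  case Nil
  show ?case using I_zero by (intro exI[of _ 1]) simp
next
  case (Cons j v)
  have j: "j \<in> {1..n}" "v \<in> letters" "\<bar>int j - int i\<bar> > 1" using Cons.prems(1) Cons.prems(2)[of j] by auto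
  obtain c where c: "c \<noteq> 0" "ad_word (v @ [i]) (ad_var j f) - scale_pm c (ad_word (i # v) (ad_var j f)) \<in> I"
    using Cons.IH[of "ad_var j f"] Cons.prems j by auto
  have "ad_word v (ad_word [j, i] f - scale_pm (\<chi> j (g i)) (ad_word [i, j] f)) \<in> I"
    using assms(1) j Cons.prems by (intro I_ad_word ad_word_commutator) auto
  then have "scale_pm c (ad_word v (ad_word [j, i] f) - scale_pm (\<chi> j (g i)) (ad_word v (ad_word [i, j] f))) \<in> I"
    by (intro I_scale) (simp add: ad_word_linear)
  with c(2) have "ad_word (v @ [i]) (ad_var j f) - scale_pm c (ad_word (i # v) (ad_var j f)) +
      scale_pm c (ad_word v (ad_word [j, i] f) - scale_pm (\<chi> j (g i)) (ad_word v (ad_word [i, j] f))) \<in> I"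
    by (rule I_add)
  then have "ad_word ((j # v) @ [i]) f - scale_pm (c * \<chi> j (g i)) (ad_word (i # j # v) f) \<in> I"
    by (simp add: pm.scale_right_diff_distrib)
  moreover have "c * \<chi> j (g i) \<noteq> 0" using c(1) chi_simps(1)[OF j(1), of "g i"] assms(1) by auto
  ultimately show ?case by blast
qed

lemma annihilates_move:
  assumes "i \<in> {1..n}" "v \<in> letters" "\<And>j. j \<in> set v \<Longrightarrow> \<bar>int i - int j\<bar> > 1" "w \<in> letters" "z \<in> letters"
    and "f \<in> carrier \<H>"
  shows "annihilates (w @ v @ [i] @ z) f \<longleftrightarrow> annihilates (w @ [i] @ v @ z) f"
proof -
  have wf: "ad_word w f \<in> carrier \<H>" using assms by simp
  obtain c where c: "c \<noteq> 0" "ad_word (v @ [i]) (ad_word w f) - scale_pm c (ad_word (i # v) (ad_word w f)) \<in> I"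
    using ad_word_move[OF assms(1-3) wf] by blast
  have "ad_word z (ad_word (v @ [i]) (ad_word w f) - scale_pm c (ad_word (i # v) (ad_word w f))) \<in> I"
    using c(2) assms(5) by (rule I_ad_word)
  then have "ad_word (w @ v @ [i] @ z) f - scale_pm c (ad_word (w @ [i] @ v @ z) f) \<in> I"
    by (simp add: ad_word_linear)
  from I_cong[OF this] show ?thesis unfolding annihilates_def I_scale_iff[OF c(1)] .
qed

lemma annihilates_blocks:
  assumes "u \<in> letters" "v \<in> letters" "\<And>i j. i \<in> set u \<Longrightarrow> j \<in> set v \<Longrightarrow> \<bar>int i - int j\<bar> > 1"
    and "w \<in> letters" "z \<in> letters" "f \<in> carrier \<H>"
  shows "annihilates (w @ u @ v @ z) f \<longleftrightarrow> annihilates (w @ v @ u @ z) f"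
  using assms(1,3,4)
proof (induction u arbitrary: w rule: list.induct)
  case (Cons i u)
  have i: "i \<in> {1..n}" "u \<in> letters" using Cons.prems(1) by auto
  have "annihilates ((w @ [i]) @ u @ v @ z) f \<longleftrightarrow> annihilates ((w @ [i]) @ v @ u @ z) f"
    using Cons.prems i by (intro Cons.IH) auto
  also have "\<dots> \<longleftrightarrow> annihilates (w @ v @ [i] @ (u @ z)) f"
    using annihilates_move[of i v w "u @ z" f] Cons.prems i assms(2,5,6) by simp
  finally show ?case by simp
qed simp

section \<open>Operator words that annihilate \<open>gr_var j\<close>\<close>

lemma gr_var_grp: "j \<in> {1..n} \<Longrightarrow> gr_var j = grp (inv (g_word [j])) \<star> var j"
  by (simp add: gr_var_def g_word_simps)

lemma I_grp_scale: "f \<in> I \<Longrightarrow> a \<in> carrier G \<Longrightarrow> scale_pm c (grp a \<star> f) \<in> I"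
  by (intro I_scale I_mult_left) auto

lemma annihilates_far:
  assumes "i \<in> {1..n}" "j \<in> {1..n}" "\<bar>int i - int j\<bar> > 1"
  shows "annihilates [i] (gr_var j)"
  using assms commutator_in_I[OF assms]
  by (simp add: annihilates_def gr_var_grp homog_scalar_ad_var[where w = "[j]"] bracket_var_var I_neg I_grp_scale)

text \<open>Two applications of the operator turn \<open>gr_var j\<close>, up to units, into
  \<open>[x_i, [x_i, x_j]]\<close>.\<close>

lemma annihilates_adjacent:
  assumes "i \<in> {1..n}" "j \<in> {1..n}" "\<bar>int i - int j\<bar> = 1"
  shows "annihilates [i, i] (gr_var j)"
proof -
  have P: "commutator i j \<in> homog \<one> [i, j]" using assms by (intro commutator_homog)
  have "bracket (var i) (commutator i j) \<in> I"
    using serre_in_I[OF assms] bracket_var_bracket[of i j] bracket_var_var[of i j] assms by auto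
  then have "ad_var i (grp (inv (g_word [i, j])) \<star> commutator i j) \<in> I"
    using assms by (subst homog_scalar_ad_var[OF P]) (auto intro!: I_neg I_grp_scale)
  then show ?thesis
    using assms
    by (simp add: annihilates_def gr_var_grp homog_scalar_ad_var[where w = "[j]"] bracket_var_var ad_var_linear I_neg I_scale)
qed

text \<open>A path in the Dynkin diagram that starts at \<open>j = h 0\<close>. Both arms of the diagram at \<open>j\<close> have this form.\<close>

lemma annihilates_path:
  assumes h: "\<And>s. s \<le> r \<Longrightarrow> h s \<in> {1..n}"
    and adj: "\<And>s. Suc s \<le> r \<Longrightarrow> \<bar>int (h s) - int (h (Suc s))\<bar> = 1"
    and far: "\<And>s t. s \<le> r \<Longrightarrow> t \<le> r \<Longrightarrow> \<bar>int s - int t\<bar> > 1 \<Longrightarrow> \<bar>int (h s) - int (h t)\<bar> > 1"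
    and t: "1 \<le> t" "t \<le> r"
  shows "annihilates (map h [1..<Suc r] @ [h t]) (gr_var (h 0))"
proof -
  let ?y = "gr_var (h 0)"
  have y: "?y \<in> carrier \<H>" using h[of 0] by simp
  have L: "map h [a..<Suc b] \<in> letters" if "b \<le> r" for a b using h that by auto
  \<comment> \<open>The letter \<open>h b\<close> is distant from all of \<open>h 0\<close>, ...,
    \<open>h a\<close>; moved to the front, it already annihilates
    \<open>gr_var (h 0)\<close>.\<close>
  have far_path: "annihilates (map h [1..<Suc a] @ [h b]) ?y" if "a + 1 < b" "b \<le> r" for a b
  proof -
    have "annihilates [h b] ?y" using that h far[of b 0] by (intro annihilates_far) auto
    then have "annihilates ([] @ [h b] @ map h [1..<Suc a] @ []) ?y"
      using annihilates_append[of "[h b]" ?y "map h [1..<Suc a]"] L[of a 1] that by simp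
    then have "annihilates ([] @ map h [1..<Suc a] @ [h b] @ []) ?y"
      by (subst annihilates_move) (use h far L[of a 1] y that in auto)
    then show ?thesis by simp
  qed
  \<comment> \<open>A repetition at the end of the path: with \<open>i = h t\<close>,
    \<open>j = h (t - 1)\<close> and \<open>w\<close> the letters before them, \<open>w i\<close>
    annihilates by \<open>far_path\<close>, hence so does \<open>w i j i\<close>, and the Serre
    relation turns this into \<open>w j i i\<close>.\<close>
  have last: "annihilates (map h [1..<Suc t] @ [h t]) ?y" if t: "1 \<le> t" "t \<le> r" for t
  proof (cases "t = 1")
    case True
    then show ?thesis using annihilates_adjacent[of "h 1" "h 0"] h[of 0] h[of 1] adj[of 0] t by simp
  next
    case False
    then obtain s where s: "t = Suc (Suc s)" using t by (cases t; cases "t - 1") auto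
    have "annihilates (map h [1..<Suc s] @ [h t]) ?y" using far_path[of s t] t s by simp
    moreover from this have "annihilates (map h [1..<Suc s] @ [h t, h (Suc s), h t]) ?y"
      using annihilates_append[of "map h [1..<Suc s] @ [h t]" ?y "[h (Suc s), h t]"] h t s by simp
    ultimately have "annihilates (map h [1..<Suc s] @ [h (Suc s), h t, h t]) ?y"
      using annihilates_serre[of "h t" "h (Suc s)" "map h [1..<Suc s]" ?y] h[of t] h[of "Suc s"] adj[of "Suc s"] L[of s 1] t s y
      by simp
    then show ?thesis using s by (simp add: upt_Suc)
  qed
  show ?thesis
  proof (cases "t = r")
    case True
    then show ?thesis using last t by simp
  next
    case False
    \<comment> \<open>A repetition of an inner letter \<open>i = h t\<close>, followed by
      \<open>j = h (t + 1)\<close>: \<open>w i i j\<close> annihilates by \<open>last\<close> and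
      \<open>w j i i\<close> by \<open>far_path\<close>, so the Serre relation gives
      \<open>w i j i\<close>. The second \<open>i\<close> is then moved behind the distant letters
      of \<open>rest\<close>.\<close>
    define w where "w = map h [1..<t]"
    define rest where "rest = map h [Suc (Suc t)..<Suc r]"
    have tr: "Suc t \<le> r" using False t by simp
    have w: "w \<in> letters" and rest: "rest \<in> letters" using h t by (auto simp: w_def rest_def)
    have ij: "h t \<in> {1..n}" "h (Suc t) \<in> {1..n}" using h t tr by auto
    have split_t: "map h [1..<Suc t] = w @ [h t]" using t by (simp add: w_def upt_Suc)
    have split: "map h [1..<Suc r] = w @ [h t, h (Suc t)] @ rest"
      using t tr upt_split[of 1 "Suc t" r]
      by (cases "Suc t = r") (auto simp: w_def rest_def upt_Suc[of 1 "Suc t"] upt_Suc[of 1 t] upt_Suc)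
    have "annihilates (w @ [h t, h t]) ?y" using last[OF t] unfolding split_t by simp
    then have "annihilates (w @ [h t, h t, h (Suc t)]) ?y"
      using annihilates_append[of "w @ [h t, h t]" ?y "[h (Suc t)]"] ij by simp
    moreover have "annihilates (w @ [h (Suc t), h t, h t]) ?y"
      using far_path[of "t - 1" "Suc t"] annihilates_append[of "w @ [h (Suc t)]" ?y "[h t, h t]"] t tr ij
      by (simp add: w_def)
    ultimately have "annihilates (w @ [h t, h (Suc t), h t]) ?y"
      using annihilates_serre[of "h t" "h (Suc t)" w ?y] ij w y adj[OF tr] by simp
    then have "annihilates ((w @ [h t, h (Suc t)]) @ [h t] @ rest @ []) ?y"
      using annihilates_append[of "w @ [h t, h (Suc t), h t]" ?y rest] rest by simp
    moreover have "\<bar>int (h t) - int x\<bar> > 1" if "x \<in> set rest" for x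
      using that far[of t] t by (auto simp: rest_def)
    ultimately have "annihilates ((w @ [h t, h (Suc t)]) @ rest @ [h t] @ []) ?y"
      by (subst annihilates_move) (use ij w rest y in auto)
    then show ?thesis unfolding split by simp
  qed
qed

section \<open>Brackets with a single letter modulo \<open>I\<close>\<close>

lemma bracket_I:
  assumes "A \<in> homog \<one> v" "A' \<in> homog \<one> v" "B \<in> homog \<one> w" "A - A' \<in> I"
  shows "bracket A B - bracket A' B \<in> I"
proof -
  have "(A - A') \<star> B - scale_pm (chi_word v (g_word w)) (B \<star> (A - A')) \<in> I"
    using I_mult_left[OF assms(4)] I_mult_right[OF assms(4)] homog_carrier[OF assms(3)] by (intro I_diff I_scale)
  then show ?thesis
    by (simp add: bracket_homog[OF assms(1,3)] bracket_homog[OF assms(2,3)] mul_linear pm.scale_right_diff_distrib)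
      (simp add: algebra_simps)
qed

text \<open>The first identity lets \<open>x_i\<close> act on a bracket as a skew derivation.
  Rearranged it becomes the second, a braided Jacobi identity, whose correction terms lie in
  \<open>I\<close> as soon as \<open>bracket (var i) B\<close> does.\<close>

lemma bracket_var_bracket_eq:
  assumes A: "A \<in> homog \<one> v" "v \<in> letters" and B: "B \<in> homog \<one> w" "w \<in> letters" and i: "i \<in> {1..n}"
  shows "bracket (var i) (bracket A B) = bracket (var i) A \<star> B + scale_pm (\<chi> i (g_word v)) (A \<star> bracket (var i) B)
    - scale_pm (chi_word v (g_word w)) (bracket (var i) B \<star> A + scale_pm (\<chi> i (g_word w)) (B \<star> bracket (var i) A))"
    and "bracket (bracket (var i) A) B = bracket (var i) (bracket A B)
      - scale_pm (\<chi> i (g_word v)) (A \<star> bracket (var i) B) + scale_pm (chi_word v (g_word w)) (bracket (var i) B \<star> A)"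
proof -
  note x = var_homog[OF i]
  note c = homog_carrier[OF A(1)] homog_carrier[OF B(1)]
  have eqs: "bracket (var i) A = var i \<star> A - scale_pm (\<chi> i (g_word v)) (A \<star> var i)"
    "bracket (var i) B = var i \<star> B - scale_pm (\<chi> i (g_word w)) (B \<star> var i)"
    "bracket A B = A \<star> B - scale_pm (chi_word v (g_word w)) (B \<star> A)"
    using bracket_homog[OF x A(1)] bracket_homog[OF x B(1)] bracket_homog[OF A(1) B(1)] by simp_all
  have l: "bracket (var i) (bracket A B) = var i \<star> bracket A B
      - scale_pm (\<chi> i (g_word v) * \<chi> i (g_word w)) (bracket A B \<star> var i)"
    using bracket_homog[OF x bracket_in_homog[OF A(1) B(1)]] A(2) B(2) i by (simp add: g_word_append chi_mult)
  have r: "bracket (bracket (var i) A) B = bracket (var i) A \<star> B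
      - scale_pm (\<chi> i (g_word w) * chi_word v (g_word w)) (B \<star> bracket (var i) A)"
    using bracket_homog[OF bracket_in_homog[OF x A(1)] B(1)] by simp
  show 1: "bracket (var i) (bracket A B) = bracket (var i) A \<star> B + scale_pm (\<chi> i (g_word v)) (A \<star> bracket (var i) B)
    - scale_pm (chi_word v (g_word w)) (bracket (var i) B \<star> A + scale_pm (\<chi> i (g_word w)) (B \<star> bracket (var i) A))"
    unfolding l unfolding eqs using c i
    by (simp add: mul_linear H.m_assoc pm.scale_right_diff_distrib pm.scale_right_distrib algebra_simps)
  show "bracket (bracket (var i) A) B = bracket (var i) (bracket A B)
      - scale_pm (\<chi> i (g_word v)) (A \<star> bracket (var i) B) + scale_pm (chi_word v (g_word w)) (bracket (var i) B \<star> A)"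
    unfolding r 1 by (simp add: pm.scale_right_distrib algebra_simps)
qed

text \<open>Bracketing with \<open>x_i\<close> is a skew derivation that sends every letter of the
  interval into \<open>I\<close>.\<close>

lemma bracket_u_elem_far:
  assumes "i \<in> {1..n}" "1 \<le> k" "k \<le> s" "s \<le> n" "\<And>j. k \<le> j \<Longrightarrow> j \<le> s \<Longrightarrow> \<bar>int i - int j\<bar> > 1"
  shows "bracket (var i) (u_elem k s) \<in> I"
  using assms(2-5)
proof (induction "s - k" arbitrary: k)
  case 0
  then show ?case using assms(1) commutator_in_I[of i k] by (simp add: bracket_var_var)
next
  case (Suc d)
  then have ks: "k < s" and k: "k \<in> {1..n}" by auto
  have B: "u_elem (Suc k) s \<in> homog \<one> [Suc k..<Suc s]" "[Suc k..<Suc s] \<in> letters"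
    using ks Suc.prems u_elem_homog[of "Suc k" s] by auto
  have A: "var k \<in> homog \<one> [k]" "[k] \<in> letters" using k by auto
  have "bracket (var i) (u_elem (Suc k) s) \<in> I" using Suc.hyps(1)[of "Suc k"] Suc.hyps(2) Suc.prems ks by simp
  moreover have "bracket (var i) (var k) \<in> I"
    using assms(1) k Suc.prems(4)[of k] ks commutator_in_I[of i k] by (simp add: bracket_var_var)
  moreover have "u_elem (Suc k) s \<in> carrier \<H>" "var k \<in> carrier \<H>" using B A homog_carrier by blast+
  ultimately show ?case
    unfolding u_elem_step[OF ks] bracket_var_bracket_eq(1)[OF A B assms(1)]
    by (intro I_diff I_add I_scale I_mult_left I_mult_right)
qed

text \<open>Without earlier cuts both sides are literally equal. In general the letter
  \<open>m + 1\<close> is distant from the block \<open>u_elem k s\<close> of the first cut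
  \<open>s < m\<close>, so by the braided Jacobi identity the bracket with it can be pulled out of
  the innermost position.\<close>

lemma Psi_list_extend:
  assumes "1 \<le> k" "k \<le> m" "m < n" "sorted_wrt (<) ss" "set ss \<subseteq> {k..<m}"
  shows "Psi_list k (Suc m) (ss @ [m]) - bracket (var (Suc m)) (Psi_list k m ss) \<in> I"
  using assms
proof (induction ss arbitrary: k)
  case Nil
  then show ?case by (simp add: I_zero)
next
  case (Cons s ss)
  have s: "k \<le> s" "s < m" and ss: "sorted_wrt (<) ss" "set ss \<subseteq> {Suc s..<m}" using Cons.prems by fastforce+
  let ?x = "var (Suc m)"
  let ?A = "Psi_list (Suc s) m ss" and ?B = "u_elem k s"
  have m: "Suc m \<in> {1..n}" using Cons.prems by simp
  have A: "?A \<in> homog \<one> [Suc s..<Suc m]" "[Suc s..<Suc m] \<in> letters"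
    using s ss Cons.prems Psi_list_homog[of "Suc s" m ss] by auto
  have B: "?B \<in> homog \<one> [k..<Suc s]" "[k..<Suc s] \<in> letters"
    using s Cons.prems u_elem_homog[of k s] by auto
  have far: "bracket ?x ?B \<in> I" using s Cons.prems by (intro bracket_u_elem_far) auto
  have IH: "Psi_list (Suc s) (Suc m) (ss @ [m]) - bracket ?x ?A \<in> I"
    using Cons.IH[of "Suc s"] s ss Cons.prems by simp
  have A': "Psi_list (Suc s) (Suc m) (ss @ [m]) \<in> homog \<one> [Suc s..<Suc (Suc m)]"
    using s ss Cons.prems by (intro Psi_list_homog) (auto simp: sorted_wrt_append)
  have "mset (Suc m # [Suc s..<Suc m]) = mset [Suc s..<Suc (Suc m)]" using s by (simp add: upt_Suc)
  then have xA: "bracket ?x ?A \<in> homog \<one> [Suc s..<Suc (Suc m)]"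
    using homog_cong[OF _ bracket_in_homog[OF var_homog[OF m] A(1)]] by simp
  have "bracket (Psi_list (Suc s) (Suc m) (ss @ [m])) ?B - bracket (bracket ?x ?A) ?B \<in> I"
    by (rule bracket_I[OF A' xA B(1) IH])
  moreover have "bracket (bracket ?x ?A) ?B - bracket ?x (bracket ?A ?B) \<in> I"
  proof -
    have "scale_pm (chi_word [Suc s..<Suc m] (g_word [k..<Suc s])) (bracket ?x ?B \<star> ?A)
       - scale_pm (\<chi> (Suc m) (g_word [Suc s..<Suc m])) (?A \<star> bracket ?x ?B) \<in> I"
      using far homog_carrier[OF A(1)] by (intro I_diff I_scale I_mult_left I_mult_right)
    then show ?thesis unfolding bracket_var_bracket_eq(2)[OF A B m] by (simp add: algebra_simps)
  qed
  ultimately have "bracket (Psi_list (Suc s) (Suc m) (ss @ [m])) ?B - bracket (bracket ?x ?A) ?B +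
     (bracket (bracket ?x ?A) ?B - bracket ?x (bracket ?A ?B)) \<in> I" by (rule I_add)
  then show ?case by simp
qed

section \<open>The generators as words of operators along two arms\<close>

lemma gen_left_arm:
  assumes "1 \<le> k" "k \<le> j" "j \<le> n"
  shows "\<exists>c. c \<noteq> 0 \<and> grp (inv (g_word [k..<Suc j])) \<star> u_elem k j = scale_pm c (ad_word (rev [k..<j]) (gr_var j))"
  using assms
proof (induction "j - k" arbitrary: k)
  case 0
  then show ?case using gr_var_grp[of j] by (intro exI[of _ 1]) simp
next
  case (Suc d)
  then have kj: "k < j" and k: "k \<in> {1..n}" by auto
  let ?w = "[Suc k..<Suc j]"
  have w: "?w \<in> letters" using Suc.prems by (intro interval_letters) auto
  have P: "u_elem (Suc k) j \<in> homog \<one> ?w" using Suc.prems kj by (intro u_elem_homog) auto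
  have d: "d = j - Suc k" using Suc.hyps(2) by linarith
  obtain c where c: "c \<noteq> 0" "grp (inv (g_word ?w)) \<star> u_elem (Suc k) j = scale_pm c (ad_word (rev [Suc k..<j]) (gr_var j))"
    using Suc.hyps(1)[of "Suc k"] d Suc.prems kj by auto
  have nz: "\<chi> k (g_word ?w) \<noteq> 0" using chi_simps(1)[OF k g_word_closed[OF w]] .
  have "scale_pm c (ad_word (rev [k..<j]) (gr_var j)) = ad_var k (grp (inv (g_word ?w)) \<star> u_elem (Suc k) j)"
    unfolding c(2) using kj by (simp add: upt_conv_Cons ad_var_linear)
  also have "\<dots> = scale_pm (- inverse (\<chi> k (g_word ?w))) (grp (inv (g_word [k..<Suc j])) \<star> u_elem k j)"
    unfolding homog_scalar_ad_var[OF P w k] using kj by (simp add: u_elem_step upt_Cons)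
  finally have "scale_pm (- \<chi> k (g_word ?w)) (scale_pm c (ad_word (rev [k..<j]) (gr_var j))) =
      scale_pm (- \<chi> k (g_word ?w)) (scale_pm (- inverse (\<chi> k (g_word ?w))) (grp (inv (g_word [k..<Suc j])) \<star> u_elem k j))"
    by simp
  then have "grp (inv (g_word [k..<Suc j])) \<star> u_elem k j = scale_pm (- \<chi> k (g_word ?w) * c) (ad_word (rev [k..<j]) (gr_var j))"
    using nz by simp
  then show ?case using nz c(1) by (intro exI[of _ "- \<chi> k (g_word ?w) * c"]) simp
qed

abbreviation arms where "arms k j m \<equiv> ad_word (rev [k..<j] @ [Suc j..<Suc m]) (gr_var j)"

text \<open>\<open>[j..<m]\<close> is the list of cuts when \<open>T k = {j..n}\<close>. There is no
  cut below \<open>j\<close>, which is the case of \<open>gen_left_arm\<close>; from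
  \<open>j\<close> on every index is a cut and adds one operator by \<open>Psi_list_extend\<close>.
  The units collect in \<open>c\<close>.\<close>

lemma gen_arms:
  assumes "1 \<le> k" "k \<le> j" "j \<le> m" "m \<le> n"
  shows "\<exists>c. c \<noteq> 0 \<and> grp (inv (g_word [k..<Suc m])) \<star> Psi_list k m [j..<m]
    - scale_pm c (arms k j m) \<in> I"
  using assms(3,4)
proof (induction m rule: dec_induct)
  case base
  then obtain c where "c \<noteq> 0" "grp (inv (g_word [k..<Suc j])) \<star> u_elem k j = scale_pm c (ad_word (rev [k..<j]) (gr_var j))"
    using gen_left_arm[of k j] assms by auto
  then show ?case using I_zero by (intro exI[of _ c]) simp
next
  case (step m)
  let ?w = "[k..<Suc m]" and ?y = "arms k j m"
  let ?x = "var (Suc m)" and ?P = "Psi_list k m [j..<m]" and ?\<gamma> = "grp (inv (g_word [k..<Suc (Suc m)]))"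
  have m: "Suc m \<in> {1..n}" and km: "k \<le> m" using step assms by auto
  have w: "?w \<in> letters" "[k..<Suc (Suc m)] \<in> letters" using step assms by (auto intro!: interval_letters)
  have P: "?P \<in> homog \<one> ?w" using step assms by (intro Psi_list_homog) (auto simp: strict_sorted_iff)
  obtain c where c: "c \<noteq> 0" "grp (inv (g_word ?w)) \<star> ?P - scale_pm c ?y \<in> I"
    using step by auto
  \<comment> \<open>The unit of \<open>homog_scalar_ad_var\<close>, by which the operator of the
    letter \<open>m + 1\<close> differs from the bracket with it.\<close>
  define b where "b = - inverse (\<chi> (Suc m) (g_word ?w))"
  have b: "b \<noteq> 0" using chi_simps(1)[OF m g_word_closed[OF w(1)]] by (simp add: b_def)
  have "mset (Suc m # ?w) = mset [k..<Suc (Suc m)]" using km by (simp add: upt_Suc)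
  then have gw: "g_word (Suc m # ?w) = g_word [k..<Suc (Suc m)]" using w m by (intro g_word_mset) auto
  have "ad_var (Suc m) (grp (inv (g_word ?w)) \<star> ?P - scale_pm c ?y) \<in> I" by (rule I_ad_var[OF c(2) m])
  then have 1: "scale_pm b (?\<gamma> \<star> bracket ?x ?P) - scale_pm c (ad_var (Suc m) ?y) \<in> I"
    unfolding ad_var_linear homog_scalar_ad_var[OF P w(1) m] gw b_def[symmetric] by simp
  have "Psi_list k (Suc m) ([j..<m] @ [m]) - bracket ?x ?P \<in> I"
    using step assms by (intro Psi_list_extend) (auto simp: strict_sorted_iff)
  then have "scale_pm b (?\<gamma> \<star> (Psi_list k (Suc m) [j..<Suc m] - bracket ?x ?P)) \<in> I"
    using step w by (intro I_grp_scale) (auto simp: upt_Suc)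
  from I_add[OF this 1] have "scale_pm b (?\<gamma> \<star> Psi_list k (Suc m) [j..<Suc m]) - scale_pm c (ad_var (Suc m) ?y) \<in> I"
    by (simp add: mul_linear pm.scale_right_diff_distrib)
  then have "scale_pm (inverse b) (scale_pm b (?\<gamma> \<star> Psi_list k (Suc m) [j..<Suc m]) - scale_pm c (ad_var (Suc m) ?y)) \<in> I"
    by (rule I_scale)
  then have "?\<gamma> \<star> Psi_list k (Suc m) [j..<Suc m] -
      scale_pm (inverse b * c) (arms k j (Suc m)) \<in> I"
    using b step by (simp add: pm.scale_right_diff_distrib upt_Suc[of "Suc j" "Suc m"])
  then show ?case using b c(1) by (intro exI[of _ "inverse b * c"]) simp
qed

end

context quantum_sl_theta
begin

text \<open>The set \<open>\<pi>\<close> that realises (iii); \<open>j(k)\<close> is its least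
  element from \<open>k\<close> on.\<close>

definition fixed_points :: "nat set" where
  "fixed_points = {j \<in> {1..n}. j \<in> T j}"

lemma intervals_T:
  assumes intervals and k: "1 \<le> k" "k \<le> j" "j \<in> T j" and no: "\<And>i. k \<le> i \<Longrightarrow> i < j \<Longrightarrow> i \<notin> T i"
  shows "T k = {j..n}"
proof -
  have "j \<le> n" using T_bounds(2)[of j j] k by simp
  then have "k \<in> {1..n}" using k by simp
  moreover have "(LEAST i. k \<le> i \<and> i \<in> T i) = j"
    using k no by (intro Least_equality) (auto simp: not_less[symmetric])
  moreover have "\<exists>i. k \<le> i \<and> i \<in> T i" using k by blast
  ultimately show ?thesis using \<open>intervals\<close> unfolding intervals_def by simp
qed

lemma intervals_start:
  assumes intervals and k: "1 \<le> k" "m \<in> T k"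
  obtains j where "k \<le> j" "j \<le> m" "j \<in> T j" "\<And>i. k \<le> i \<Longrightarrow> i < j \<Longrightarrow> i \<notin> T i" "T k = {j..n}"
proof -
  have "k \<in> {1..n}" using T_bounds[of k m] k by simp
  then have *: "T k = (if \<exists>j. k \<le> j \<and> j \<in> T j then {(LEAST j. k \<le> j \<and> j \<in> T j)..n} else {})"
    using \<open>intervals\<close> unfolding intervals_def by blast
  then have ex: "\<exists>j. k \<le> j \<and> j \<in> T j" using k(2) by (metis empty_iff)
  define j where "j = (LEAST j. k \<le> j \<and> j \<in> T j)"
  have j: "k \<le> j" "j \<in> T j" using LeastI_ex[OF ex] unfolding j_def by auto
  have no: "i \<notin> T i" if "k \<le> i" "i < j" for i using not_less_Least[of i "\<lambda>j. k \<le> j \<and> j \<in> T j"] that unfolding j_def by blast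
  have "T k = {j..n}" using * ex unfolding j_def by simp
  then show thesis using that j no k(2) by simp
qed

lemma gen_eq:
  assumes "T k = {j..n}" "k \<le> j" "m \<le> n"
  shows "gen k m = grp (inv (g_word [k..<Suc m])) \<star> Psi_list k m [j..<m]"
proof -
  have "T k \<inter> {k..<m} = {j..<m}" unfolding assms(1) using assms(2,3) by auto
  then show ?thesis unfolding Psi_def by (simp only: sorted_list_of_set_range)
qed

lemma gr_var_U: "i \<in> fixed_points \<Longrightarrow> gr_var i \<in> U_gens"
proof -
  assume i: "i \<in> fixed_points"
  have "gen i i = gr_var i" using i by (simp add: Psi_def gr_var_grp fixed_points_def)
  moreover have "1 \<le> i" "i \<le> n" "i \<in> T i" using i by (simp_all add: fixed_points_def)
  ultimately show ?thesis unfolding U_gens_def by (metis (mono_tags, lifting) CollectI order_refl)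
qed

text \<open>\<open>S\<close> is left arbitrary because the equivalence serves both for
  \<open>U_gens\<close> and for the generators of \<open>K(\<pi>)\<close>.\<close>

lemma gens_span_arms:
  assumes S: "S \<subseteq> carrier \<H>" and k: "1 \<le> k" "k \<le> j" "j \<le> m" "m \<le> n" and Tk: "T k = {j..n}"
  shows "gen k m \<in> Alg S \<longleftrightarrow> arms k j m \<in> Alg S"
proof -
  let ?y = "arms k j m"
  obtain c where c: "c \<noteq> 0" "gen k m - scale_pm c ?y \<in> I"
    using gen_arms[OF k] unfolding gen_eq[OF Tk k(2,4)] by blast
  show ?thesis
  proof
    assume "?y \<in> Alg S"
    then show "gen k m \<in> Alg S" using Alg_cong[OF S c(2)] Alg_scale[OF S] by blast
  next
    assume "gen k m \<in> Alg S"
    then have "gen k m - (gen k m - scale_pm c ?y) \<in> Alg S" by (rule Alg_diff[OF S _ Alg_I[OF S c(2)]])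
    then have "scale_pm c ?y \<in> Alg S" by simp
    then have "scale_pm (inverse c) (scale_pm c ?y) \<in> Alg S" by (rule Alg_scale[OF S])
    then show "?y \<in> Alg S" unfolding pm.scale_scale left_inverse[OF c(1)] pm.scale_one .
  qed
qed

lemma ad_var_arms:
  assumes int: intervals and k: "1 \<le> k" "k \<le> j" "j \<le> m" "m \<le> n" "j \<in> T j"
    and no: "\<And>i. k \<le> i \<Longrightarrow> i < j \<Longrightarrow> i \<notin> T i" and i: "i \<in> {1..n}" "i \<notin> T i"
  shows "ad_word ((rev [k..<j] @ [Suc j..<Suc m]) @ [i]) (gr_var j) \<in> Alg U_gens"
proof -
  note S = U_gens_carrier
  have lower: "rev [k..<j] \<in> letters" and upper: "[Suc j..<Suc m] \<in> letters" using k by auto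
  have j: "j \<in> {1..n}" and y: "gr_var j \<in> carrier \<H>" using k by auto
  \<comment> \<open>As long as no fixed point lies in \<open>[k', j - 1]\<close>, the set
    \<open>T k'\<close> is again \<open>{j..n}\<close>, so the word with these arms comes from a
    generator.\<close>
  have arm: "arms k' j m' \<in> Alg U_gens"
    if "1 \<le> k'" "k' \<le> j" "j \<le> m'" "m' \<le> n" "\<And>i. k' \<le> i \<Longrightarrow> i < j \<Longrightarrow> i \<notin> T i" for k' m'
  proof -
    have T: "T k' = {j..n}" using that k(5) by (intro intervals_T[OF int]) auto
    then have "m' \<in> T k'" using that by simp
    then have "gen k' m' \<in> U_gens" using that(1-4) order_trans[OF that(2,3)] unfolding U_gens_def by blast
    then show ?thesis using gens_span_arms[OF S that(1-4) T] Alg_gen[OF S] by blast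
  qed
  have zero: ?thesis if "annihilates ((rev [k..<j] @ [Suc j..<Suc m]) @ [i]) (gr_var j)"
    using that Alg_I[OF S] unfolding annihilates_def by blast
  have "i \<noteq> j" using i k(5) by blast
  then consider "i = Suc m" | "i > Suc m" | "Suc i < k" | "Suc i = k" | "j < i" "i \<le> m" | "k \<le> i" "i < j" by linarith
  then show ?thesis
  proof cases
    case 1
    then show ?thesis using arm[of k "Suc m"] k no i by (simp add: upt_Suc[of "Suc j" "Suc m"])
  next
    case 2
    \<comment> \<open>\<open>i\<close> is distant from \<open>j\<close> and from both arms; moved to
      the front, it annihilates \<open>gr_var j\<close>.\<close>
    have "annihilates ([] @ [i] @ (rev [k..<j] @ [Suc j..<Suc m]) @ []) (gr_var j)"
      using annihilates_append[OF annihilates_far[of i j], of "rev [k..<j] @ [Suc j..<Suc m]"] 2 i j k lower upper by simp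
    then show ?thesis
      using 2 i k lower upper y
      by (intro zero) (subst (asm) annihilates_move[symmetric], auto)
  next
    case 3
    have "annihilates ([] @ [i] @ (rev [k..<j] @ [Suc j..<Suc m]) @ []) (gr_var j)"
      using annihilates_append[OF annihilates_far[of i j], of "rev [k..<j] @ [Suc j..<Suc m]"] 3 i j k lower upper by simp
    then show ?thesis
      using 3 i k lower upper y
      by (intro zero) (subst (asm) annihilates_move[symmetric], auto)
  next
    case 4
    \<comment> \<open>\<open>i\<close> is distant from the upper arm and may act before it,
      prolonging the lower arm. The longer word is again that of a generator because
      \<open>i\<close> is not a fixed point.\<close>
    have "\<exists>c. c \<noteq> 0 \<and> ad_word ([Suc j..<Suc m] @ [i]) (ad_word (rev [k..<j]) (gr_var j)) -
        scale_pm c (ad_word (i # [Suc j..<Suc m]) (ad_word (rev [k..<j]) (gr_var j))) \<in> I"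
      using 4 i k lower upper y by (intro ad_word_move) auto
    then obtain c where c: "ad_word ((rev [k..<j] @ [Suc j..<Suc m]) @ [i]) (gr_var j) -
        scale_pm c (ad_word (rev [k..<j] @ i # [Suc j..<Suc m]) (gr_var j)) \<in> I" by auto
    have "rev [i..<j] = rev [k..<j] @ [i]" using 4 k by (simp add: upt_conv_Cons)
    moreover have "l \<notin> T l" if "i \<le> l" "l < j" for l using 4 no[of l] i that by (cases "l = i") auto
    ultimately have "ad_word (rev [k..<j] @ i # [Suc j..<Suc m]) (gr_var j) \<in> Alg U_gens"
      using arm[of i m] 4 k i by simp
    then show ?thesis using Alg_cong[OF S c] Alg_scale[OF S] by blast
  next
    case 5
    \<comment> \<open>\<open>i\<close> repeats a letter of the upper arm. The two arms are distant
      from each other, so the upper one may act first, and it is a path starting at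
      \<open>j\<close>.\<close>
    have map: "map (\<lambda>s. j + s) [1..<Suc (m - j)] = [Suc j..<Suc m]"
      using k by (intro nth_equalityI) (simp_all add: nth_upt)
    have "annihilates (map (\<lambda>s. j + s) [1..<Suc (m - j)] @ [j + (i - j)]) (gr_var (j + 0))"
      using 5 k by (intro annihilates_path) auto
    then have "annihilates ([Suc j..<Suc m] @ [i]) (gr_var j)" unfolding map using 5 by simp
    then have "annihilates ([] @ ([Suc j..<Suc m] @ [i]) @ rev [k..<j] @ []) (gr_var j)"
      using annihilates_append[of "[Suc j..<Suc m] @ [i]" _ "rev [k..<j]"] lower by simp
    then have "annihilates ([] @ rev [k..<j] @ ([Suc j..<Suc m] @ [i]) @ []) (gr_var j)"
      by (subst annihilates_blocks) (use 5 i k lower upper y in auto)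
    then show ?thesis by (intro zero) simp
  next
    case 6
    \<comment> \<open>\<open>i\<close> repeats a letter of the lower arm and can be moved in front
      of the distant upper arm. The subtraction is not truncated, since \<open>s\<close> is at most
      \<open>j - k\<close>.\<close>
    have map: "map (\<lambda>s. j - s) [1..<Suc (j - k)] = rev [k..<j]"
      using k by (intro nth_equalityI) (auto simp: rev_nth)
    have "annihilates (map (\<lambda>s. j - s) [1..<Suc (j - k)] @ [j - (j - i)]) (gr_var (j - 0))"
      using 6 k by (intro annihilates_path) auto
    then have "annihilates (rev [k..<j] @ [i]) (gr_var j)" unfolding map using 6 by simp
    then have "annihilates (rev [k..<j] @ [i] @ [Suc j..<Suc m] @ []) (gr_var j)"
      using annihilates_append[of "rev [k..<j] @ [i]" _ "[Suc j..<Suc m]"] upper by simp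
    then have "annihilates (rev [k..<j] @ [Suc j..<Suc m] @ [i] @ []) (gr_var j)"
      by (subst annihilates_move) (use 6 i k lower upper y in auto)
    then show ?thesis by (intro zero) simp
  qed
qed

lemma intervals_imp_invariant:
  assumes int: intervals
  shows "ad_stable U_gens"
proof (intro ballI)
  note S = U_gens_carrier and eigen = U_gens_homog
  fix i f assume i: "i \<in> {1..n}" and f: "f \<in> Alg U_gens"
  show "ad_var i f \<in> Alg U_gens"
  proof (cases "i \<in> T i")
    case True
    then have "gr_var i \<in> Alg U_gens" using i gr_var_U Alg_gen[OF S] by (simp add: fixed_points_def)
    then show ?thesis
      using Alg_conj[OF S eigen _ f, of "g i"] f i unfolding ad_var_def by (intro Alg_diff[OF S] Alg_mult[OF S]) auto
  next
    case False
    show ?thesis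
    proof (rule Alg_ad_var[OF S eigen i _ f])
      fix s assume "s \<in> U_gens"
      then obtain k m where km: "1 \<le> k" "k \<le> m" "m \<le> n" "m \<in> T k" "s = gen k m" by (rule U_gensE)
      obtain j where j: "k \<le> j" "j \<le> m" "j \<in> T j" "\<And>i. k \<le> i \<Longrightarrow> i < j \<Longrightarrow> i \<notin> T i" "T k = {j..n}"
        using intervals_start[OF int km(1,4)] by blast
      let ?y = "arms k j m"
      obtain c where c: "gen k m - scale_pm c ?y \<in> I"
        using gen_arms[OF km(1) j(1,2) km(3)] unfolding gen_eq[OF j(5,1) km(3)] by blast
      have "ad_var i (gen k m - scale_pm c ?y) \<in> I" by (rule I_ad_var[OF c i])
      then have "ad_var i s - scale_pm c (ad_var i ?y) \<in> I" unfolding km(5) by (simp add: ad_var_linear)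
      moreover have "ad_var i ?y \<in> Alg U_gens"
        using ad_var_arms[OF int km(1) j(1,2) km(3) j(3,4) i False] by simp
      ultimately show "ad_var i s \<in> Alg U_gens" using Alg_cong[OF S] Alg_scale[OF S] by blast
    qed
  qed
qed

text \<open>Both algebras are stable under the operators and contain \<open>gr_var j\<close> for all
  fixed points \<open>j\<close>. The generators of either one are obtained from these by operators,
  those of \<open>U\<close> up to units and modulo \<open>I\<close>.\<close>

lemma intervals_imp_K:
  assumes int: intervals
  shows "U1 I \<theta> = K_subalgebra I fixed_points"
proof -
  have \<pi>: "fixed_points \<subseteq> {1..n}" by (auto simp: fixed_points_def)
  note S = U_gens_carrier and K = K_gens_carrier[OF \<pi>]
  have ad: "ad_word w f \<in> Alg X" if "ad_stable X" "f \<in> Alg X" "w \<in> letters" for X f w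
    using that(2,3) by (induction w arbitrary: f rule: list.induct) (use that(1) in auto)
  have "K_gens fixed_points \<subseteq> Alg U_gens"
  proof
    fix s assume "s \<in> K_gens fixed_points"
    then obtain w j where w: "w \<in> letters" "j \<in> fixed_points" "s = ad_word w (gr_var j)"
      using K_gensE[OF \<pi>] by metis
    then show "s \<in> Alg U_gens"
      using ad[OF intervals_imp_invariant[OF int]] Alg_gen[OF S gr_var_U] by blast
  qed
  moreover have "U_gens \<subseteq> Alg (K_gens fixed_points)"
  proof
    fix s assume "s \<in> U_gens"
    then obtain k m where km: "1 \<le> k" "k \<le> m" "m \<le> n" "m \<in> T k" "s = gen k m" by (rule U_gensE)
    obtain j where j: "k \<le> j" "j \<le> m" "j \<in> T j" "T k = {j..n}"
      by (rule intervals_start[OF int km(1,4)])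
    have "j \<in> fixed_points" using j km by (simp add: fixed_points_def)
    then have "gr_var j \<in> K_gens fixed_points" unfolding K_gens_def by (force intro: exI[of _ "[]"])
    moreover have "rev [k..<j] @ [Suc j..<Suc m] \<in> letters" using j km by auto
    ultimately have "arms k j m \<in> Alg (K_gens fixed_points)"
      using ad[OF K_subalgebra_invariant[OF \<pi>]] Alg_gen[OF K] by blast
    then show "s \<in> Alg (K_gens fixed_points)"
      using gens_span_arms[OF K km(1) j(1,2) km(3) j(4)] km(5) by simp
  qed
  ultimately show ?thesis
    unfolding U1_eq K_subalgebra_eq[OF \<pi>] by (intro subalgebra_gen_eqI S K)
qed

lemma invariant_iff_intervals: "ad_r_invariant I (U1 I \<theta>) \<longleftrightarrow> intervals"
proof -
  have "ad_r_invariant I (U1 I \<theta>) \<longleftrightarrow> ad_stable U_gens"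
    unfolding U1_eq by (rule ad_r_invariant_iff[OF U_gens_carrier U_gens_homog])
  then show ?thesis using invariant_imp_intervals intervals_imp_invariant by metis
qed

lemma invariant_iff_K: "ad_r_invariant I (U1 I \<theta>) \<longleftrightarrow> (\<exists>\<pi>. \<pi> \<subseteq> {1..n} \<and> U1 I \<theta> = K_subalgebra I \<pi>)"
proof
  assume "ad_r_invariant I (U1 I \<theta>)"
  then have "U1 I \<theta> = K_subalgebra I fixed_points"
    using intervals_imp_K by (simp add: invariant_iff_intervals)
  then show "\<exists>\<pi>. \<pi> \<subseteq> {1..n} \<and> U1 I \<theta> = K_subalgebra I \<pi>"
    by (intro exI[of _ fixed_points]) (auto simp: fixed_points_def)
next
  assume "\<exists>\<pi>. \<pi> \<subseteq> {1..n} \<and> U1 I \<theta> = K_subalgebra I \<pi>"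
  then obtain \<pi> where \<pi>: "\<pi> \<subseteq> {1..n}" "U1 I \<theta> = K_subalgebra I \<pi>" by blast
  have "ad_r_invariant I (K_subalgebra I \<pi>) \<longleftrightarrow> ad_stable (K_gens \<pi>)"
    unfolding K_subalgebra_eq[OF \<pi>(1)]
    by (rule ad_r_invariant_iff[OF K_gens_carrier[OF \<pi>(1)] K_gens_homog[OF \<pi>(1)]])
  then show "ad_r_invariant I (U1 I \<theta>)"
    unfolding \<pi>(2) using K_subalgebra_invariant[OF \<pi>(1)] by metis
qed

end

theorem theorem7p1:
  fixes n :: nat
    and q :: "'k::field"
    and G :: "('g, 'm) monoid_scheme"
    and g :: "nat \<Rightarrow> 'g"
    and \<chi> :: "nat \<Rightarrow> 'g \<Rightarrow> 'k"
    and I :: "('g \<times> nat list \<Rightarrow>\<^sub>0 'k) set"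
    and \<theta> :: "nat \<Rightarrow> nat"
  assumes "1 \<le> n"
    and "q \<noteq> 0" and "q \<noteq> 1" and "q \<noteq> - 1"
    and "comm_group G"
    and "\<forall>i\<in>{1..n}. g i \<in> carrier G"
    and "\<forall>i\<in>{1..n}. character G (\<chi> i)"
    and "\<forall>i\<in>{1..n}. \<chi> i (g i) = q"
    and "\<forall>i. 1 \<le> i \<and> i < n \<longrightarrow> \<chi> i (g (i + 1)) * \<chi> (i + 1) (g i) = inverse q"
    and "\<forall>i\<in>{1..n}. \<forall>j\<in>{1..n}. \<bar>int i - int j\<bar> > 1 \<longrightarrow> \<chi> i (g j) * \<chi> j (g i) = 1"
    and "((\<forall>t>0. q ^ t \<noteq> 1) \<and> I = skew_hopf.serre_ideal n G g \<chi>) \<or>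
         (\<exists>t>2. q ^ t = 1 \<and> (\<forall>s. 0 < s \<and> s < t \<longrightarrow> q ^ s \<noteq> 1) \<and>
            I = skew_hopf.Lambda_ideal n G g \<chi>)"
    and "\<forall>k\<in>{1..n}. \<theta> k \<le> n - k + 1"
  defines "U \<equiv> skew_hopf.U1 n G g \<chi> I \<theta>"
  shows "(skew_hopf.ad_r_invariant n G g \<chi> I U \<longleftrightarrow>
            (\<forall>k\<in>{1..n}. T_set n \<theta> k =
               (if \<exists>j. k \<le> j \<and> j \<in> T_set n \<theta> j
                then {(LEAST j. k \<le> j \<and> j \<in> T_set n \<theta> j)..n} else {})))
       \<and> (skew_hopf.ad_r_invariant n G g \<chi> I U \<longleftrightarrow>
            (\<exists>\<pi>. \<pi> \<subseteq> {1..n} \<and> U = skew_hopf.K_subalgebra n G g \<chi> I \<pi>))"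
proof -
  interpret comm_group G by fact
  interpret quantum_sl n G g \<chi> q
    by unfold_locales (use assms(2-10) in blast)+
  \<comment> \<open>In the root of unity case the inclusion is the maximality of
    \<open>Lambda_ideal\<close>, applied to the Serre ideal as a Hopf ideal inside
    \<open>decomposables\<close>.\<close>
  have I: "hopf_ideal I" "I \<subseteq> decomposables" "serre_ideal \<subseteq> I"
    using assms(11) serre_ideal(1,2) Lambda_ideal by auto
  interpret quantum_sl_theta n G g \<chi> q I \<theta>
    by unfold_locales (use I assms(12) in blast)+
  show ?thesis
    using invariant_iff_intervals invariant_iff_K unfolding U_def intervals_def by blast
qed

end
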